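(* Let $T\in\mathcal{K}(V)$ be bisectorial of angle $\omega\in(0,\frac{\pi}{2})$ and let $\theta\in(\omega,\frac{\pi}{2})$. Then every $f\in\mathcal{SH}_L(D_\theta)$ for which - there exist $r>0$ and $f_0\in\mathbb{R}_n$ such that $\int_0^r|f(te^{J\phi})-f_0|\frac{dt}{t}<\infty$ for all $J\in\mathbb{S}$, $\phi\in I_\theta$, and - there exist $k\in\mathbb{N}_0$ and $C\geq 0$ such that $|f(s)|\leq C(1+|s|^k)$ for all $s\in D_\theta$, belongs to $\mathcal{SH}_L^{\mathrm{reg}}(D_\theta)$. If $T$ is injective, then moreover every $f\in\mathcal{SH}_L(D_\theta)$ for which there exist $k\in\mathbb{N}_0$ and $C\geq 0$ with $|f(s)|\leq C\big(\frac{1}{|s|^k}+|s|^k\big)$ for all $s\in D_\theta$ belongs to $\mathcal{SH}_L^{\mathrm{reg}}(D_\theta)$.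
   Context: Clifford setting. Fix an integer $n\geq 1$. $\mathbb{R}_n$ is the real Clifford algebra generated by $e_1,\dots,e_n$ with $e_i^2=-1$, $e_ie_j=-e_je_i$ ($i\neq j$), with basis $e_A=e_{i_1}\cdots e_{i_r}$ for $A=(i_1<\dots<i_r)$, $e_\emptyset=1$, and $|s|^2=\sum_As_A^2$ for $s=\sum_As_Ae_A$. Paravectors: $\mathbb{R}^{n+1}=\{s_0+s_1e_1+\dots+s_ne_n\}\subseteq\mathbb{R}_n$ with $\overline{s}=s_0-s_1e_1-\dots-s_ne_n$. $\mathbb{S}=\{s\in\mathbb{R}^{n+1}: s_0=0,|s|=1\}$ and $\mathbb{C}_J=\{x+Jy: x,y\in\mathbb{R}\}$ for $J\in\mathbb{S}$. $U\subseteq\mathbb{R}^{n+1}$ is axially symmetric if $x+Jy\in U$ ($x,y\in\mathbb{R}$, $J\in\mathbb{S}$) implies $x+Iy\in U$ for all $I\in\mathbb{S}$. Slice hyperholomorphic functions. For $U$ open and axially symmetric, $f:U\to\mathbb{R}_n$ is left slice hyperholomorphic ($f\in\mathcal{SH}_L(U)$) if there are continuously differentiable $f_0,f_1:\{(x,y)\in\mathbb{R}^2: x+\mathbb{S}y\subseteq U\}\to\mathbb{R}_n$ with $f(x+Jy)=f_0(x,y)+Jf_1(x,y)$ for all $J\in\mathbb{S}$, $f_0(x,-y)=f_0(x,y)$, $f_1(x,-y)=-f_1(x,y)$, $\partial_xf_0=\partial_yf_1$, $\partial_yf_0=-\partial_xf_1$. If $f_0,f_1$ are real valued, $f$ is called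 intrinsic ($f\in\mathcal{N}(U)$). Operators. $V_\mathbb{R}$ is a real Banach space, $V=\{\sum_Av_A\otimes e_A: v_A\in V_\mathbb{R}\}$ the corresponding Clifford module with norm $\|v\|^2=\sum_A\|v_A\|^2$ and the natural left and right multiplications by $\mathbb{R}_n$. $\mathcal{B}(V)$: bounded everywhere defined right-linear operators; $\mathcal{K}(V)$: closed right-linear operators $T:\operatorname{dom}(T)\to V$ with right-linear domain $\operatorname{dom}(T)\subseteq V$. A Clifford number $a$ is identified with the operator $v\mapsto av$, so $(aT)v=a(Tv)$, $(Ta)v=T(av)$. For $s\in\mathbb{R}^{n+1}$, $Q_s[T]=T^2-2s_0T+|s|^2$ on $\operatorname{dom}(T^2)$; $\rho_S(T)=\{s\in\mathbb{R}^{n+1}: Q_s[T]^{-1}\in\mathcal{B}(V)\}$, $\sigma_S(T)=\mathbb{R}^{n+1}\setminus\rho_S(T)$, and $S_L^{-1}(s,T)=Q_s[T]^{-1}\overline{s}-TQ_s[T]^{-1}$ for $s\in\rho_S(T)$. Bisectorial operators. For $\omega\in(0,\frac{\pi}{2})$, $I_\omega=(-\omega,\omega)\cup(\pi-\omega,\pi+\omega)$ and $D_\omega=\{re^{J\phi}: r>0,\,J\in\mathbb{S},\,\phi\in I_\omega\}\subseteq\mathbb{R}^{n+1}$. $T\in\mathcal{K}(V)$ is bisectorial of angle $\omega$ if $\sigma_S(T)\subseteq\overline{D_\omega}$ and for every $\varphi\in(\omega,\frac{\pi}{2})$ there is $C_\varphi\geq 0$ with $\|S_L^{-1}(s,T)\|\leq\frac{C_\varphi}{|s|}$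 for all $s\in\mathbb{R}^{n+1}\setminus(D_\varphi\cup\{0\})$. $\omega$-functional calculus. $\mathcal{SH}_L^0(D_\theta)$ is the set of bounded $f\in\mathcal{SH}_L(D_\theta)$ with $\int_0^\infty|f(te^{J\phi})|\frac{dt}{t}<\infty$ for all $J\in\mathbb{S}$, $\phi\in I_\theta$; $\mathcal{N}^0(D_\theta)$ is the set of intrinsic such functions. For $T$ bisectorial of angle $\omega$, $\theta\in(\omega,\frac{\pi}{2})$ and $f\in\mathcal{SH}_L^0(D_\theta)$, $$f(T)=\frac{1}{2\pi}\int_{\partial D_\varphi\cap\mathbb{C}_J}S_L^{-1}(s,T)ds_Jf(s):=\frac{1}{2\pi}\sum_\pm\int_\mathbb{R}S_L^{-1}(\gamma_\pm(t),T)\frac{\gamma_\pm'(t)}{J}f(\gamma_\pm(t))dt\in\mathcal{B}(V),$$ with $\gamma_\pm(t)=\pm|t|e^{-\operatorname{sgn}(t)J\varphi}$; it does not depend on the choice of $\varphi\in(\omega,\theta)$ and $J\in\mathbb{S}$. Extended $\omega$-functional calculus. $\mathcal{SH}_L^{\mathrm{bnd}}(D_\theta)$ is the set of functions $f(s)=f_\infty+\frac{1}{1+s^2}(f_0-f_\infty)+\widetilde{f}(s)$ on $D_\theta$ with $f_0,f_\infty\in\mathbb{R}_n$, $\widetilde{f}\in\mathcal{SH}_L^0(D_\theta)$ (unique components); $\mathcal{N}^{\mathrm{bnd}}(D_\theta)$ is the analogous set with $f_0,f_\infty\in\mathbb{R}$, $\widetilde{f}\in\mathcal{N}^0(D_\theta)$.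 For such $f$, $f(T):=f_\infty+(1+T^2)^{-1}(f_0-f_\infty)+\widetilde{f}(T)\in\mathcal{B}(V)$; here $1+T^2$ is boundedly invertible since $\mathbb{S}\subseteq\rho_S(T)$. Regularizable functions. $\mathcal{SH}_L^{\mathrm{reg}}(D_\theta)$ is the set of $f\in\mathcal{SH}_L(D_\theta)$ for which there exists $e\in\mathcal{N}^{\mathrm{bnd}}(D_\theta)$ (a regularizer of $f$) such that $ef\in\mathcal{SH}_L^{\mathrm{bnd}}(D_\theta)$ and the operator $e(T)$ (extended $\omega$-functional calculus) is injective. *)

theory Defs
  imports "HOL-Analysis.Analysis"
begin

section \<open>The Clifford algebra and Clifford modules\<close>

text \<open>
  The generators are indexed by a finite linearly ordered type \<open>'n\<close>, so \<open>n = CARD('n) \<ge> 1\<close>, and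
  the basis elements \<open>e_A\<close> by the subsets \<open>A\<close> of \<open>'n\<close>. A Clifford number is the vector of its
  coefficients; \<^const>\<open>norm\<close> on this type is the Euclidean norm. Likewise the Clifford module
  \<open>V\<close> over the Banach space \<open>'v\<close> is the type \<open>'v ^ 'n set\<close>, with \<open>norm v = sqrt (\<Sum>A. (norm (v $ A))\<^sup>2)\<close>.
  Since \<open>*\<close> and \<open>1\<close> on vectors are componentwise, they are not used for Clifford numbers:
  \<open>axis {} x\<close> is the real number \<open>x\<close>, \<open>axis A 1\<close> is \<open>e_A\<close>, and \<open>\<odot>\<close> below is the product.
\<close>

type_synonym 'n clifford = "real ^ 'n set"
type_synonym ('v, 'n) cmodule = "'v ^ 'n set"

text \<open>
  \<open>e_A e_B = cl_sign A B e_C\<close> with \<open>C\<close> the symmetric difference of \<open>A\<close> and \<open>B\<close>: sorting the product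
  costs one sign for each pair \<open>j < i\<close> with \<open>i \<in> A\<close>, \<open>j \<in> B\<close>, and \<open>e_i\<^sup>2 = -1\<close> costs one for each
  \<open>i = j\<close>.
\<close>

definition cl_sign :: "'n::{finite,linorder} set \<Rightarrow> 'n set \<Rightarrow> real" where
  "cl_sign A B = (-1) ^ card {(i, j). i \<in> A \<and> j \<in> B \<and> j \<le> i}"

text \<open>Left multiplication of a module element; for \<open>'v = real\<close> this is the product of the algebra.\<close>

definition lmul :: "'n::{finite,linorder} clifford \<Rightarrow> ('v::real_vector, 'n) cmodule \<Rightarrow> ('v, 'n) cmodule"
    (infixr "\<odot>" 75) where
  "a \<odot> v = (\<Sum>A\<in>UNIV. \<Sum>B\<in>UNIV. axis (sym_diff A B) ((cl_sign A B * a $ A) *\<^sub>R v $ B))"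

definition rmul :: "('v::real_vector, 'n::{finite,linorder}) cmodule \<Rightarrow> 'n clifford \<Rightarrow> ('v, 'n) cmodule" where
  "rmul v a = (\<Sum>A\<in>UNIV. \<Sum>B\<in>UNIV. axis (sym_diff A B) ((cl_sign A B * a $ B) *\<^sub>R v $ A))"

text \<open>
  The lemmas below confirm that \<open>\<odot>\<close> is the Clifford product (associativity, unit, relations of the
  generators, \<open>e_A\<close> as an increasing product) and that \<open>rmul\<close> agrees with it on the basis.
\<close>

lemma cl_sign_prod:
  "cl_sign A B = (\<Prod>(i, j)\<in>UNIV. if i \<in> A \<and> j \<in> B \<and> j \<le> i then -1 else 1)"
  for A B :: "'n::{finite,linorder} set"
proof -
  have "(\<Prod>p\<in>UNIV. if p \<in> {(i, j). i \<in> A \<and> j \<in> B \<and> j \<le> i} then -1 else (1::real))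
      = (-1) ^ card {(i, j). i \<in> A \<and> j \<in> B \<and> j \<le> i}"
    by (simp add: prod.If_cases)
  then show ?thesis
    by (simp add: cl_sign_def case_prod_unfold)
qed

lemma cl_sign_sym_diff:
  fixes A B C :: "'n::{finite,linorder} set"
  shows "cl_sign (sym_diff A B) C = cl_sign A C * cl_sign B C"
    and "cl_sign C (sym_diff A B) = cl_sign C A * cl_sign C B"
  unfolding cl_sign_prod prod.distrib[symmetric] by (intro prod.cong; auto)+

lemma sym_diff_cancel: "sym_diff A (sym_diff A B) = B"
  by blast

lemma sum_sym_diff: "(\<Sum>B\<in>UNIV. g (sym_diff A B)) = (\<Sum>B\<in>UNIV. g B)"
  for A :: "'n::finite set" and g :: "'n set \<Rightarrow> 'a::comm_monoid_add"
  by (rule sum.reindex_bij_witness[of _ "sym_diff A" "sym_diff A"]) (auto simp: sym_diff_cancel)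

lemma axis_nth_sym_diff: "axis (sym_diff A B) x $ C = (if B = sym_diff A C then x else 0)"
  for A :: "'n::finite set"
  by (auto simp: axis_def)

lemma axis_nth_sym_diff': "axis (sym_diff A B) x $ C = (if A = sym_diff B C then x else 0)"
  for A :: "'n::finite set"
  by (auto simp: axis_def)

lemma lmul_nth:
  "(a \<odot> v) $ C = (\<Sum>A\<in>UNIV. (cl_sign A (sym_diff A C) * a $ A) *\<^sub>R v $ sym_diff A C)"
  unfolding lmul_def sum_component axis_nth_sym_diff by (simp add: sum.delta)

lemma rmul_nth:
  "rmul v a $ C = (\<Sum>B\<in>UNIV. (cl_sign (sym_diff B C) B * a $ B) *\<^sub>R v $ sym_diff B C)"
  unfolding rmul_def sum_component axis_nth_sym_diff'
  by (subst sum.swap) (simp add: sum.delta)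

lemma lmul_assoc: "(a \<odot> b) \<odot> v = a \<odot> b \<odot> v" for a b :: "'n::{finite,linorder} clifford"
proof (rule vec_eq_iff[THEN iffD2], rule allI)
  fix D
  let ?g = "\<lambda>A B. (cl_sign (sym_diff A B) (sym_diff (sym_diff A B) D) * (cl_sign A B * a $ A * b $ B))
              *\<^sub>R v $ sym_diff (sym_diff A B) D"
  have "((a \<odot> b) \<odot> v) $ D = (\<Sum>C\<in>UNIV. \<Sum>A\<in>UNIV. ?g A (sym_diff A C))"
    unfolding lmul_nth[of "a \<odot> b"] lmul_nth[of a b]
    by (simp add: sum_distrib_left scaleR_sum_left sym_diff_cancel)
  also have "\<dots> = (\<Sum>A\<in>UNIV. \<Sum>B\<in>UNIV. ?g A B)"
    by (subst sum.swap) (subst sum_sym_diff, rule refl)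
  also have "\<dots> = (\<Sum>A\<in>UNIV. \<Sum>B\<in>UNIV. (cl_sign A (sym_diff A D) * a $ A) *\<^sub>R
      ((cl_sign B (sym_diff B (sym_diff A D)) * b $ B) *\<^sub>R v $ sym_diff B (sym_diff A D)))"
  proof (intro sum.cong refl)
    fix A B :: "'n set"
    define E where "E = sym_diff (sym_diff A B) D"
    have "sym_diff B (sym_diff A D) = E" "sym_diff A D = sym_diff B E"
      unfolding E_def by blast+
    then show "?g A B = (cl_sign A (sym_diff A D) * a $ A) *\<^sub>R
      ((cl_sign B (sym_diff B (sym_diff A D)) * b $ B) *\<^sub>R v $ sym_diff B (sym_diff A D))"
      unfolding E_def[symmetric] by (simp add: cl_sign_sym_diff sym_diff_cancel)
  qed
  also have "\<dots> = (a \<odot> b \<odot> v) $ D"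
    unfolding lmul_nth by (simp only: scaleR_sum_right)
  finally show "((a \<odot> b) \<odot> v) $ D = (a \<odot> b \<odot> v) $ D" .
qed

lemma lmul_axis: "axis A x \<odot> axis B y = axis (sym_diff A B) ((cl_sign A B * x) *\<^sub>R y)"
proof -
  have "axis A x \<odot> axis B y = (\<Sum>A'\<in>UNIV. \<Sum>B'\<in>UNIV. if B' = B then
      (if A' = A then axis (sym_diff A B) ((cl_sign A B * x) *\<^sub>R y) else 0) else 0)"
    unfolding lmul_def by (intro sum.cong refl) (auto simp: axis_def vec_eq_iff)
  then show ?thesis
    by (simp add: sum.delta)
qed

lemma rmul_axis: "rmul (axis A x) (axis B y) = axis (sym_diff A B) ((cl_sign A B * y) *\<^sub>R x)"
proof -
  have "rmul (axis A x) (axis B y) = (\<Sum>A'\<in>UNIV. \<Sum>B'\<in>UNIV. if B' = B then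
      (if A' = A then axis (sym_diff A B) ((cl_sign A B * y) *\<^sub>R x) else 0) else 0)"
    unfolding rmul_def by (intro sum.cong refl) (auto simp: axis_def vec_eq_iff)
  then show ?thesis
    by (simp add: sum.delta)
qed

lemma rmul_real: "rmul v a = v \<odot> a" for v a :: "'n::{finite,linorder} clifford"
  unfolding rmul_def lmul_def by (simp add: mult.commute mult.left_commute)

lemma lmul_scalar: "axis {} x \<odot> v = x *\<^sub>R v" for v :: "('v::real_vector, 'n::{finite,linorder}) cmodule"
proof -
  have "(axis {} x \<odot> v) $ C = (\<Sum>A\<in>(UNIV::'n set set). if A = {} then x *\<^sub>R v $ C else 0)" for C
    unfolding lmul_nth by (intro sum.cong refl) (auto simp: axis_def cl_sign_def)
  then show ?thesis
    by (simp add: vec_eq_iff sum.delta)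
qed

lemma generator_relations:
  fixes i j :: "'n::{finite,linorder}"
  shows "axis {i} 1 \<odot> axis {i} 1 = (- axis {} 1 :: 'n clifford)"
    and "i \<noteq> j \<Longrightarrow> axis {i} 1 \<odot> axis {j} 1 = - (axis {j} 1 \<odot> axis {i} 1 :: 'n clifford)"
proof -
  have sgn: "cl_sign {i} {j} = (if j \<le> i then -1 else 1)" for i j :: 'n
  proof -
    have "{(i', j'). i' \<in> {i} \<and> j' \<in> {j} \<and> j' \<le> i'} = (if j \<le> i then {(i, j)} else {})"
      by auto
    then show ?thesis
      by (simp add: cl_sign_def)
  qed
  show "axis {i} 1 \<odot> axis {i} 1 = (- axis {} 1 :: 'n clifford)"
    unfolding lmul_axis sgn by (simp add: axis_def vec_eq_iff)
  show "axis {i} 1 \<odot> axis {j} 1 = - (axis {j} 1 \<odot> axis {i} 1 :: 'n clifford)" if "i \<noteq> j"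
    using that unfolding lmul_axis sgn by (auto simp: axis_def vec_eq_iff)
qed

lemma basis_product:
  fixes i :: "'n::{finite,linorder}"
  assumes "\<And>j. j \<in> A \<Longrightarrow> i < j"
  shows "(axis (insert i A) 1 :: 'n clifford) = axis {i} 1 \<odot> axis A 1"
proof -
  have "{(i', j). i' \<in> {i} \<and> j \<in> A \<and> j \<le> i'} = {}"
    using assms by fastforce
  then have "cl_sign {i} A = 1"
    unfolding cl_sign_def by (simp only: card.empty power_0)
  moreover have "sym_diff {i} A = insert i A"
    using assms by fastforce
  ultimately show ?thesis
    unfolding lmul_axis by simp
qed

definition paravectors :: "'n::finite clifford set" where
  "paravectors = {s. \<forall>A. card A \<ge> 2 \<longrightarrow> s $ A = 0}"

text \<open>Conjugation and inverse, used for paravectors only: there \<open>s \<odot> pv_conj s = |s|\<^sup>2\<close>.\<close>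

definition pv_conj :: "'n::finite clifford \<Rightarrow> 'n clifford" where
  "pv_conj s = (\<chi> A. if A = {} then s $ A else - s $ A)"

definition pv_inverse :: "'n::finite clifford \<Rightarrow> 'n clifford" where
  "pv_inverse s = (1 / (norm s)\<^sup>2) *\<^sub>R pv_conj s"

definition imag_sphere :: "'n::finite clifford set" where
  "imag_sphere = {s \<in> paravectors. s $ {} = 0 \<and> norm s = 1}"

text \<open>\<open>slice J x y = x + J y\<close> and \<open>expi J \<phi> = e\<^bsup>J\<phi>\<^esup>\<close> for \<open>J\<close> in the sphere.\<close>

definition slice :: "'n::finite clifford \<Rightarrow> real \<Rightarrow> real \<Rightarrow> 'n clifford" where
  "slice J x y = axis {} x + y *\<^sub>R J"

definition expi :: "'n::finite clifford \<Rightarrow> real \<Rightarrow> 'n clifford" where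
  "expi J \<phi> = slice J (cos \<phi>) (sin \<phi>)"

section \<open>Slice hyperholomorphic functions\<close>

text \<open>
  Functions on \<open>U\<close> are total functions of which only the values on \<open>U\<close> matter. These notions are
  meant for \<open>U\<close> open in \<^const>\<open>paravectors\<close> and axially symmetric; then \<open>slice_dom U\<close> is open in the plane.
\<close>

definition slice_dom :: "'n::finite clifford set \<Rightarrow> (real \<times> real) set" where
  "slice_dom U = {(x, y). \<forall>J\<in>imag_sphere. slice J x y \<in> U}"

definition slice_components ::
    "'n::{finite,linorder} clifford set \<Rightarrow> ('n clifford \<Rightarrow> 'n clifford) \<Rightarrow>
     (real \<times> real \<Rightarrow> 'n clifford) \<Rightarrow> (real \<times> real \<Rightarrow> 'n clifford) \<Rightarrow> bool" where
  "slice_components U f f0 f1 \<longleftrightarrow>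
     (\<forall>(x, y) \<in> slice_dom U.
        (\<forall>J\<in>imag_sphere. f (slice J x y) = f0 (x, y) + J \<odot> f1 (x, y)) \<and>
        f0 (x, -y) = f0 (x, y) \<and> f1 (x, -y) = - f1 (x, y)) \<and>
     (\<exists>f0' f1' :: real \<times> real \<Rightarrow> (real \<times> real) \<Rightarrow>\<^sub>L 'n clifford.
        continuous_on (slice_dom U) f0' \<and> continuous_on (slice_dom U) f1' \<and>
        (\<forall>p \<in> slice_dom U.
           (f0 has_derivative blinfun_apply (f0' p)) (at p) \<and>
           (f1 has_derivative blinfun_apply (f1' p)) (at p) \<and>
           blinfun_apply (f0' p) (1, 0) = blinfun_apply (f1' p) (0, 1) \<and>
           blinfun_apply (f0' p) (0, 1) = - blinfun_apply (f1' p) (1, 0)))"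

definition SH_L :: "'n::{finite,linorder} clifford set \<Rightarrow> ('n clifford \<Rightarrow> 'n clifford) set" where
  "SH_L U = {f. \<exists>f0 f1. slice_components U f f0 f1}"

definition SH_intrinsic :: "'n::{finite,linorder} clifford set \<Rightarrow> ('n clifford \<Rightarrow> 'n clifford) set" where
  "SH_intrinsic U = {f. \<exists>f0 f1. slice_components U f f0 f1 \<and>
     (\<forall>p \<in> slice_dom U. f0 p \<in> range (axis {}) \<and> f1 p \<in> range (axis {}))}"

section \<open>Unbounded right-linear operators and the S-spectrum\<close>

text \<open>An unbounded operator on \<open>V\<close> is a partial map, with domain \<^const>\<open>dom\<close>.\<close>

type_synonym ('v, 'n) op = "('v, 'n) cmodule \<rightharpoonup> ('v, 'n) cmodule"

definition closed_ops :: "('v::banach, 'n::{finite,linorder}) op set" where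
  "closed_ops = {T. closed (Map.graph T) \<and> 0 \<in> dom T \<and>
     (\<forall>v w x y. T v = Some x \<and> T w = Some y \<longrightarrow> T (v + w) = Some (x + y)) \<and>
     (\<forall>v x a. T v = Some x \<longrightarrow> T (rmul v a) = Some (rmul x a))}"

definition bounded_ops :: "(('v::banach, 'n::{finite,linorder}) cmodule \<Rightarrow>\<^sub>L ('v, 'n) cmodule) set" where
  "bounded_ops = {R. \<forall>v a. blinfun_apply R (rmul v a) = rmul (blinfun_apply R v) a}"

definition is_bounded_inverse ::
    "('v::banach, 'n::{finite,linorder}) op \<Rightarrow> (('v, 'n) cmodule \<Rightarrow>\<^sub>L ('v, 'n) cmodule) \<Rightarrow> bool" where
  "is_bounded_inverse A R \<longleftrightarrow> R \<in> bounded_ops \<and> (\<forall>v w. A v = Some w \<longleftrightarrow> v = blinfun_apply R w)"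

definition bounded_inverse ::
    "('v::banach, 'n::{finite,linorder}) op \<Rightarrow> ('v, 'n) cmodule \<Rightarrow>\<^sub>L ('v, 'n) cmodule" where
  "bounded_inverse A = (THE R. is_bounded_inverse A R)"

definition Q_op :: "'n::{finite,linorder} clifford \<Rightarrow> ('v::banach, 'n) op \<Rightarrow> ('v, 'n) op" where
  "Q_op s T = (\<lambda>v. if v \<in> dom (T \<circ>\<^sub>m T)
     then Some (the ((T \<circ>\<^sub>m T) v) - (2 * s $ {}) *\<^sub>R the (T v) + (norm s)\<^sup>2 *\<^sub>R v) else None)"

definition S_resolvent_set :: "('v::banach, 'n::{finite,linorder}) op \<Rightarrow> 'n clifford set" where
  "S_resolvent_set T = {s \<in> paravectors. \<exists>R. is_bounded_inverse (Q_op s T) R}"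

definition S_spectrum :: "('v::banach, 'n::{finite,linorder}) op \<Rightarrow> 'n clifford set" where
  "S_spectrum T = paravectors - S_resolvent_set T"

definition SL_inv ::
    "'n::{finite,linorder} clifford \<Rightarrow> ('v::banach, 'n) op \<Rightarrow> ('v, 'n) cmodule \<Rightarrow> ('v, 'n) cmodule" where
  "SL_inv s T v = (let R = blinfun_apply (bounded_inverse (Q_op s T))
     in R (pv_conj s \<odot> v) - the (T (R v)))"

section \<open>Bisectorial operators\<close>

definition angles :: "real \<Rightarrow> real set" where
  "angles \<omega> = {- \<omega> <..< \<omega>} \<union> {pi - \<omega> <..< pi + \<omega>}"

definition dsector :: "real \<Rightarrow> 'n::finite clifford set" where
  "dsector \<omega> = {r *\<^sub>R expi J \<phi> | r J \<phi>. r > 0 \<and> J \<in> imag_sphere \<and> \<phi> \<in> angles \<omega>}"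

text \<open>
  The bound on the operator norm of \<open>SL_inv s T\<close> is written out pointwise.
\<close>

definition bisectorial :: "real \<Rightarrow> ('v::banach, 'n::{finite,linorder}) op \<Rightarrow> bool" where
  "bisectorial \<omega> T \<longleftrightarrow>
     S_spectrum T \<subseteq> closure (dsector \<omega>) \<and>
     (\<forall>\<phi>\<in>{\<omega> <..< pi / 2}. \<exists>C\<ge>0. \<forall>s \<in> paravectors - (dsector \<phi> \<union> {0}).
        \<forall>v. norm (SL_inv s T v) \<le> C / norm s * norm v)"

section \<open>The functional calculi\<close>

definition SH_L0 :: "real \<Rightarrow> ('n::{finite,linorder} clifford \<Rightarrow> 'n clifford) set" where
  "SH_L0 \<theta> = {f \<in> SH_L (dsector \<theta>). bounded (f ` dsector \<theta>) \<and>
     (\<forall>J\<in>imag_sphere. \<forall>\<phi>\<in>angles \<theta>.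
        (\<integral>\<^sup>+t\<in>{0<..}. ennreal (norm (f (t *\<^sub>R expi J \<phi>)) / t) \<partial>lborel) < \<infinity>)}"

definition intrinsic0 :: "real \<Rightarrow> ('n::{finite,linorder} clifford \<Rightarrow> 'n clifford) set" where
  "intrinsic0 \<theta> = SH_L0 \<theta> \<inter> SH_intrinsic (dsector \<theta>)"

text \<open>The paths \<open>\<gamma>\<^sub>\<plusminus>\<close>, for \<open>\<epsilon> = 1\<close> and \<open>\<epsilon> = -1\<close>.\<close>

definition bisector_path :: "real \<Rightarrow> 'n::finite clifford \<Rightarrow> real \<Rightarrow> real \<Rightarrow> 'n clifford" where
  "bisector_path \<phi> J \<epsilon> t = (\<epsilon> * \<bar>t\<bar>) *\<^sub>R expi J (- sgn t * \<phi>)"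

text \<open>
  The integral takes values in the Banach space of bounded operators; the integrand is undefined
  at \<open>t = 0\<close> only.
\<close>

definition omega_integral ::
    "real \<Rightarrow> 'n::{finite,linorder} clifford \<Rightarrow> ('v::banach, 'n) op \<Rightarrow> ('n clifford \<Rightarrow> 'n clifford) \<Rightarrow>
     ('v, 'n) cmodule \<Rightarrow>\<^sub>L ('v, 'n) cmodule" where
  "omega_integral \<phi> J T f = (1 / (2 * pi)) *\<^sub>R (\<Sum>\<epsilon>\<in>{1, -1}. integral UNIV (\<lambda>t.
     Blinfun (\<lambda>v. SL_inv (bisector_path \<phi> J \<epsilon> t) T
       ((vector_derivative (bisector_path \<phi> J \<epsilon>) (at t) \<odot> pv_inverse J) \<odot>
          f (bisector_path \<phi> J \<epsilon> t) \<odot> v))))"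

text \<open>The calculus does not depend on the choice of \<open>\<phi>\<close> and \<open>J\<close>.\<close>

definition omega_calculus ::
    "real \<Rightarrow> real \<Rightarrow> ('v::banach, 'n::{finite,linorder}) op \<Rightarrow> ('n clifford \<Rightarrow> 'n clifford) \<Rightarrow>
     ('v, 'n) cmodule \<Rightarrow>\<^sub>L ('v, 'n) cmodule" where
  "omega_calculus \<omega> \<theta> T f =
     (let (\<phi>, J) = (SOME (\<phi>, J). \<phi> \<in> {\<omega> <..< \<theta>} \<and> J \<in> imag_sphere) in omega_integral \<phi> J T f)"

definition bnd_components ::
    "real \<Rightarrow> ('n::{finite,linorder} clifford \<Rightarrow> 'n clifford) \<Rightarrow>
     'n clifford \<Rightarrow> 'n clifford \<Rightarrow> ('n clifford \<Rightarrow> 'n clifford) \<Rightarrow> bool" where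
  "bnd_components \<theta> f f0 finf ft \<longleftrightarrow> ft \<in> SH_L0 \<theta> \<and>
     (\<forall>s\<in>dsector \<theta>. f s = finf + pv_inverse (axis {} 1 + s \<odot> s) \<odot> (f0 - finf) + ft s)"

definition SH_Lbnd :: "real \<Rightarrow> ('n::{finite,linorder} clifford \<Rightarrow> 'n clifford) set" where
  "SH_Lbnd \<theta> = {f. \<exists>f0 finf ft. bnd_components \<theta> f f0 finf ft}"

definition intrinsic_bnd :: "real \<Rightarrow> ('n::{finite,linorder} clifford \<Rightarrow> 'n clifford) set" where
  "intrinsic_bnd \<theta> = {f. \<exists>f0 finf ft. bnd_components \<theta> f f0 finf ft \<and>
     f0 \<in> range (axis {}) \<and> finf \<in> range (axis {}) \<and> ft \<in> intrinsic0 \<theta>}"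

text \<open>The components are unique, \<open>ft\<close> as a function on \<open>dsector \<theta>\<close>.\<close>

definition ext_calculus ::
    "real \<Rightarrow> real \<Rightarrow> ('v::banach, 'n::{finite,linorder}) op \<Rightarrow> ('n clifford \<Rightarrow> 'n clifford) \<Rightarrow>
     ('v, 'n) cmodule \<Rightarrow> ('v, 'n) cmodule" where
  "ext_calculus \<omega> \<theta> T f v =
     (let (f0, finf, ft) = (SOME (f0, finf, ft). bnd_components \<theta> f f0 finf ft)
      in finf \<odot> v
       + blinfun_apply (bounded_inverse (\<lambda>w. map_option (\<lambda>u. w + u) ((T \<circ>\<^sub>m T) w))) ((f0 - finf) \<odot> v)
       + blinfun_apply (omega_calculus \<omega> \<theta> T ft) v)"

definition SH_Lreg ::
    "real \<Rightarrow> real \<Rightarrow> ('v::banach, 'n::{finite,linorder}) op \<Rightarrow> ('n clifford \<Rightarrow> 'n clifford) set" where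
  "SH_Lreg \<omega> \<theta> T = {f \<in> SH_L (dsector \<theta>). \<exists>e\<in>intrinsic_bnd \<theta>.
     (\<lambda>s. e s \<odot> f s) \<in> SH_Lbnd \<theta> \<and> inj (ext_calculus \<omega> \<theta> T e)}"

end

theory Submission
  imports Defs "HOL-Probability.Sinc_Integral"
begin

text \<open>
  Regularizers are \<open>e = u\<^sup>m\<close> for functions that are regular at \<open>0\<close>, and \<open>e = (u (1 - u))\<^sup>m\<close> for
  injective \<open>T\<close>, where \<open>u(s) = (1 + s\<^sup>2)\<^sup>-\<^sup>1\<close> and \<open>m\<close> is so large that \<open>e f\<close> decays. With
  \<open>A = (1 + T\<^sup>2)\<^sup>-\<^sup>1\<close> one has \<open>e(T) = A\<^sup>m\<close> and \<open>e(T) = (A (1 - A))\<^sup>m\<close>, which are injective because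
  \<open>1 - A = T\<^sup>2 A\<close>.

  The point is to evaluate the contour integral for \<open>g(u)\<close>, \<open>g\<close> a real polynomial divisible by
  \<open>u (1 - u)\<close>. Right multiplication by a unit paravector makes \<open>V\<close> a complex space on which
  right-linear operators are complex linear, and \<open>R(l) = (l - T)\<^sup>-\<^sup>1\<close> is a pseudo-resolvent outside the
  double sector. The four rays of the contour combine into one ray for \<open>N(l) = (l\<^sup>2 - T\<^sup>2)\<^sup>-\<^sup>1\<close> minus its
  conjugate. The relation \<open>u N = A N - u A\<close> reduces multiplication of the integrand by \<open>u\<close> to
  multiplication of the integral by \<open>A\<close>, up to scalar integrals that have an elementary primitive and
  vanish. In the base case \<open>g = u (1 - u)\<close> it leaves \<open>A (1 - A) N\<close>, which is holomorphic even at \<open>\<plusminus>i\<close>, so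
  that the ray can be rotated through the complement of the double sector onto its mirror image.
\<close>

section \<open>Pseudo-resolvents on the complement of a double sector\<close>

text \<open>The S-resolvent contains a left multiplication by \<open>s\<close>, with which
  \<open>T\<close> need not commute, whereas scalars acting from the right do commute with
  \<open>T\<close>. Summing the integrand over a point and its conjugate leaves only real
  coefficients in front of \<open>Q^-1\<close> and \<open>T Q^-1\<close>, and real scalars act alike
  from both sides; this permits a purely complex argument. Divisibility by \<open>u (1 - u)\<close>
  is a matter of convergence: against \<open>dt / t\<close>, \<open>u\<close> alone does not decay
  at 0 and \<open>1 - u\<close> does not decay at infinity. A pure power is therefore split as
  \<open>u + (u^m - u)\<close>, where the first summand is the explicit term
  \<open>(1 + T^2)^-1\<close> of the extended calculus. After the reduction the separate pieces may
  still diverge logarithmically: a single ray at infinity, and the real part of a scalar logarithm.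
  Hence identities are stated for integrals over \<open>[1 / (n + 1), n + 1]\<close>, and only
  convergent combinations are passed to the limit. The rotation sweeps the angle
  \<open>pi - 2 * \<phi>\<close>, the logarithm ends with argument \<open>2 * \<phi>\<close>, and
  together they produce the constant \<open>2 * pi\<close> for every \<phi>.\<close>

abbreviation op_comp :: "('a::real_normed_vector \<Rightarrow>\<^sub>L 'a) \<Rightarrow> ('a \<Rightarrow>\<^sub>L 'a) \<Rightarrow> ('a \<Rightarrow>\<^sub>L 'a)" (infixl "\<star>" 70) where
  "X \<star> Y \<equiv> blinfun_compose X Y"

lemma op_comp_assoc: "(X \<star> Y) \<star> Z = X \<star> (Y \<star> Z)"
  by (rule blinfun_eqI) simp

lemmas op_bilinear = bounded_bilinear.add_left[OF bounded_bilinear_blinfun_compose]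
  bounded_bilinear.add_right[OF bounded_bilinear_blinfun_compose]
  bounded_bilinear.diff_left[OF bounded_bilinear_blinfun_compose]
  bounded_bilinear.diff_right[OF bounded_bilinear_blinfun_compose]
  bounded_bilinear.minus_left[OF bounded_bilinear_blinfun_compose]
  bounded_bilinear.minus_right[OF bounded_bilinear_blinfun_compose]
  bounded_bilinear.scaleR_left[OF bounded_bilinear_blinfun_compose]
  bounded_bilinear.scaleR_right[OF bounded_bilinear_blinfun_compose]

text \<open>The complement of the open double sector without the origin, written with
  \<open>tan\<close> instead of arguments: in this form it is visibly invariant under negation and
  conjugation.\<close>

definition dcone :: "real \<Rightarrow> complex set" where
  "dcone \<phi> = {l. l \<noteq> 0 \<and> \<bar>Re l\<bar> * tan \<phi> \<le> \<bar>Im l\<bar>}"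

lemma dcone_minus [simp]: "- l \<in> dcone \<phi> \<longleftrightarrow> l \<in> dcone \<phi>"
  and dcone_cnj [simp]: "cnj l \<in> dcone \<phi> \<longleftrightarrow> l \<in> dcone \<phi>"
  and dcone_ii [simp]: "\<i> \<in> dcone \<phi>"
  by (auto simp: dcone_def)

lemma dcone_nonzero: "l \<in> dcone \<phi> \<Longrightarrow> l \<noteq> 0"
  by (simp add: dcone_def)

lemma dcone_cis:
  assumes "0 < \<phi>" "\<phi> < pi / 2" "\<psi> \<in> {\<phi>..pi - \<phi>}" "t > 0"
  shows "of_real t * cis \<psi> \<in> dcone \<phi>"
proof -
  have c: "cos \<phi> > 0" and s: "sin \<psi> > 0"
    using assms by (auto intro!: cos_gt_zero sin_gt_zero)
  have "\<bar>cos \<psi>\<bar> * sin \<phi> \<le> sin \<psi> * cos \<phi>"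
  proof -
    have "sin (\<psi> - \<phi>) \<ge> 0" "sin (\<psi> + \<phi>) \<ge> 0"
      using assms by (auto intro!: sin_ge_zero)
    then show ?thesis
      by (auto simp: sin_diff sin_add abs_if algebra_simps)
  qed
  then have "\<bar>cos \<psi>\<bar> * tan \<phi> \<le> sin \<psi>"
    using c by (simp add: tan_def field_simps)
  then have "t * (\<bar>cos \<psi>\<bar> * tan \<phi>) \<le> t * sin \<psi>"
    using assms by simp
  then show ?thesis
    using assms s by (simp add: dcone_def abs_mult mult.assoc)
qed

text \<open>The factor \<open>\<bar>Re z\<bar> / cmod z\<close> is the cosine of the angle to the
  real axis, so on a double sector this bounds \<open>1 / (1 + z^2)\<close> by a multiple of
  \<open>1 / (1 + \<bar>z\<bar>^2)\<close>. In terms of \<open>x\<close> and \<open>y\<close>, the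
  squared inequality says that \<open>y * (1 - x - y)^2\<close> is nonnegative.\<close>

lemma norm_one_plus_square:
  assumes "z \<noteq> 0"
  shows "\<bar>Re z\<bar> / cmod z * (1 + (cmod z)\<^sup>2) \<le> cmod (1 + z\<^sup>2)"
proof -
  have n: "(cmod z)\<^sup>2 = (Re z)\<^sup>2 + (Im z)\<^sup>2" "cmod z > 0"
    using assms by (auto simp: cmod_power2)
  define x y where "x = (Re z)\<^sup>2" and "y = (Im z)\<^sup>2"
  have xy: "x \<ge> 0" "y \<ge> 0" "x + y > 0" "(cmod z)\<^sup>2 = x + y"
    using n unfolding x_def y_def by (auto simp flip: n(1))
  have "x * (1 + x + y)\<^sup>2 \<le> (x + y) * ((1 + x - y)\<^sup>2 + 4 * x * y)"
  proof -
    have "(x + y) * ((1 + x - y)\<^sup>2 + 4 * x * y) - x * (1 + x + y)\<^sup>2 = y * (1 - x - y)\<^sup>2"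
      by (simp add: power2_eq_square algebra_simps)
    moreover have "y * (1 - x - y)\<^sup>2 \<ge> 0" using xy by simp
    ultimately show ?thesis by linarith
  qed
  moreover have "(cmod (1 + z\<^sup>2))\<^sup>2 = (1 + x - y)\<^sup>2 + 4 * x * y"
    by (simp add: cmod_power2 x_def y_def) (simp add: power2_eq_square algebra_simps)
  ultimately have "x * (1 + x + y)\<^sup>2 / (x + y) \<le> (cmod (1 + z\<^sup>2))\<^sup>2"
    using xy by (simp add: field_simps)
  moreover have "x * (1 + x + y)\<^sup>2 / (x + y) = (\<bar>Re z\<bar> / cmod z * (1 + (cmod z)\<^sup>2))\<^sup>2"
    by (simp add: power_mult_distrib power_divide xy add.assoc) (simp add: x_def)
  ultimately show ?thesis
    by (metis norm_ge_zero power2_le_imp_le)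
qed

text \<open>\<open>fcalc A g G\<close>: \<open>g\<close> is a real polynomial divisible by \<open>u (1 - u)\<close>, and \<open>G = g(A)\<close>.\<close>

inductive fcalc :: "('a::real_normed_vector \<Rightarrow>\<^sub>L 'a) \<Rightarrow> (complex \<Rightarrow> complex) \<Rightarrow> ('a \<Rightarrow>\<^sub>L 'a) \<Rightarrow> bool" for A where
  base: "fcalc A (\<lambda>u. u * (1 - u)) (A - A \<star> A)"
| mult: "fcalc A g G \<Longrightarrow> fcalc A (\<lambda>u. u * g u) (A \<star> G)"
| diff: "fcalc A g G \<Longrightarrow> fcalc A h H \<Longrightarrow> fcalc A (\<lambda>u. g u - h u) (G - H)"

text \<open>Four inductions over \<open>fcalc\<close>, each with its own purpose: conjugation
  symmetry makes the lifted function intrinsic, the derivative gives slice hyperholomorphy, the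
  bound gives decay on the contour, and the primitive evaluates the scalar integrals left over by
  the reduction.\<close>

lemma fcalc_props:
  assumes "fcalc A g G"
  shows fcalc_cnj: "g (cnj z) = cnj (g z)"
    and fcalc_differentiable: "\<exists>g'. continuous_on UNIV g' \<and> (\<forall>z. (g has_field_derivative g' z) (at z))"
    and fcalc_bound: "\<exists>C\<ge>0. \<forall>z. cmod z \<le> M \<longrightarrow> cmod (g z) \<le> C * cmod (z * (1 - z))"
    and fcalc_primitive: "\<exists>p P. (\<forall>z. g z = z * p z \<and> (P has_field_derivative z ^ k * p z) (at z)) \<and>
          Im (P 0) = 0 \<and> Im (P 1) = 0"
proof -
  show "g (cnj z) = cnj (g z)"
    using assms by (induction arbitrary: z) simp_all
  show "\<exists>g'. continuous_on UNIV g' \<and> (\<forall>z. (g has_field_derivative g' z) (at z))"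
    using assms
  proof induction
    case base
    show ?case
    proof (intro exI[of _ "\<lambda>z. 1 - 2 * z"] conjI allI)
      show "continuous_on UNIV (\<lambda>z::complex. 1 - 2 * z)"
        by (intro continuous_intros)
      show "((\<lambda>u. u * (1 - u)) has_field_derivative 1 - 2 * z) (at z)" for z :: complex
        by (rule derivative_eq_intros refl)+ (simp add: algebra_simps)
    qed
  next
    case (mult g G)
    then obtain g' where g': "continuous_on UNIV g'" "\<And>z. (g has_field_derivative g' z) (at z)"
      by blast
    then have "continuous_on UNIV g"
      by (meson DERIV_isCont continuous_at_imp_continuous_on)
    show ?case
    proof (intro exI[of _ "\<lambda>z. z * g' z + g z"] conjI allI)
      show "continuous_on UNIV (\<lambda>z. z * g' z + g z)"
        using g'(1) \<open>continuous_on UNIV g\<close> by (intro continuous_intros)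
      show "((\<lambda>u. u * g u) has_field_derivative z * g' z + g z) (at z)" for z
        by (rule derivative_eq_intros g'(2) refl)+ simp
    qed
  next
    case (diff g G h H)
    then obtain g' h' where "continuous_on UNIV g'" "\<And>z. (g has_field_derivative g' z) (at z)"
      "continuous_on UNIV h'" "\<And>z. (h has_field_derivative h' z) (at z)"
      by blast
    then show ?case
      by (intro exI[of _ "\<lambda>z. g' z - h' z"] conjI allI DERIV_diff continuous_on_diff)
  qed
  show "\<exists>C\<ge>0. \<forall>z. cmod z \<le> M \<longrightarrow> cmod (g z) \<le> C * cmod (z * (1 - z))"
    using assms
  proof induction
    case base
    show ?case by (rule exI[of _ 1]) simp
  next
    case (mult g G)
    then obtain C where C: "C \<ge> 0" "\<And>z. cmod z \<le> M \<Longrightarrow> cmod (g z) \<le> C * cmod (z * (1 - z))"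
      by blast
    have "cmod (z * g z) \<le> \<bar>M\<bar> * C * cmod (z * (1 - z))" if "cmod z \<le> M" for z
    proof -
      have "cmod (z * g z) \<le> \<bar>M\<bar> * (C * cmod (z * (1 - z)))"
        unfolding norm_mult[of z "g z"] using C that by (intro mult_mono) auto
      then show ?thesis by (simp add: mult.assoc)
    qed
    then show ?case using C(1) by (intro exI[of _ "\<bar>M\<bar> * C"]) auto
  next
    case (diff g G h H)
    then obtain C D where C: "C \<ge> 0" "\<And>z. cmod z \<le> M \<Longrightarrow> cmod (g z) \<le> C * cmod (z * (1 - z))"
      and D: "D \<ge> 0" "\<And>z. cmod z \<le> M \<Longrightarrow> cmod (h z) \<le> D * cmod (z * (1 - z))"
      by metis
    have "cmod (g z - h z) \<le> (C + D) * cmod (z * (1 - z))" if "cmod z \<le> M" for z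
      using C(2)[OF that] D(2)[OF that] norm_triangle_ineq4[of "g z" "h z"] by (simp add: algebra_simps)
    then show ?case using C(1) D(1) by (intro exI[of _ "C + D"]) auto
  qed
  show "\<exists>p P. (\<forall>z. g z = z * p z \<and> (P has_field_derivative z ^ k * p z) (at z)) \<and>
          Im (P 0) = 0 \<and> Im (P 1) = 0"
    using assms
  \<comment> \<open>For \<open>z * g z\<close> the cofactor of \<open>z\<close> is
    \<open>g z\<close> itself, and its primitive for exponent \<open>k\<close> is the one of
    \<open>g\<close> for exponent \<open>Suc k\<close>; hence \<open>k\<close> is generalized. The
    values at 0 and 1 are real because the coefficients are.\<close>
  proof (induction arbitrary: k)
    case base
    have "((\<lambda>z. of_real (1 / (real k + 1)) * z ^ (k + 1) - of_real (1 / (real k + 2)) * z ^ (k + 2))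
        has_field_derivative z ^ k * (1 - z)) (at z)" for z :: complex
    proof -
      have *: "complex_of_real (1 / x) * (of_nat j * y) = y" if "x = real j" "j > 0" for x j y
      proof -
        have "complex_of_real (1 / x * real j) = 1"
          using that by simp
        then show ?thesis
          by (simp only: of_real_mult of_real_of_nat_eq mult.assoc[symmetric] mult_1)
      qed
      have 1: "of_real (1 / (real k + 1)) * (of_nat (k + 1) * z ^ k) = z ^ k"
        by (rule *) auto
      have 2: "of_real (1 / (real k + 2)) * (of_nat (k + 2) * z ^ (k + 1)) = z ^ (k + 1)"
        by (rule *) auto
      have "((\<lambda>z. of_real (1 / (real k + 1)) * z ^ (k + 1) - of_real (1 / (real k + 2)) * z ^ (k + 2))
          has_field_derivative of_real (1 / (real k + 1)) * (of_nat (k + 1) * z ^ k)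
            - of_real (1 / (real k + 2)) * (of_nat (k + 2) * z ^ (k + 1))) (at z)"
        by (rule derivative_eq_intros refl)+ simp
      then show ?thesis
        unfolding 1 2 by (simp add: algebra_simps)
    qed
    then show ?case
      by (intro exI[of _ "\<lambda>z. 1 - z"] exI) (auto simp del: of_real_divide)
  next
    case (mult g G)
    then obtain p P where "\<forall>z. g z = z * p z \<and> (P has_field_derivative z ^ Suc k * p z) (at z)"
      "Im (P 0) = 0" "Im (P 1) = 0" by blast
    then show ?case
      by (intro exI[of _ g] exI[of _ P]) (auto simp: mult_ac)
  next
    case (diff g G h H)
    obtain p P where p: "\<And>z. g z = z * p z \<and> (P has_field_derivative z ^ k * p z) (at z)"
      "Im (P 0) = 0" "Im (P 1) = 0" using diff.IH(1) by meson
    obtain q Q where q: "\<And>z. h z = z * q z \<and> (Q has_field_derivative z ^ k * q z) (at z)"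
      "Im (Q 0) = 0" "Im (Q 1) = 0" using diff.IH(2) by meson
    show ?case
      by (intro exI[of _ "\<lambda>z. p z - q z"] exI[of _ "\<lambda>z. P z - Q z"])
        (use p q in \<open>auto intro!: derivative_eq_intros simp: algebra_simps\<close>)
  qed
qed

abbreviation trunc_integral :: "nat \<Rightarrow> (real \<Rightarrow> 'a::banach) \<Rightarrow> 'a" where
  "trunc_integral n \<equiv> integral {1 / real (Suc n)..real (Suc n)}"

lemma trunc_pos: "t \<in> {1 / real (Suc n)..real (Suc n)} \<Longrightarrow> 0 < t"
  by (auto intro: less_le_trans[of 0 "1 / real (Suc n)"])

text \<open>The resolvent identity is an exact formula for difference quotients, so in this form it
  can be differentiated directly.\<close>

lemma has_vector_derivative_iff_quotient:
  fixes f :: "real \<Rightarrow> 'a::real_normed_vector"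
  shows "(f has_vector_derivative D) (at x within S) \<longleftrightarrow>
    ((\<lambda>y. (1 / (y - x)) *\<^sub>R (f y - f x)) \<longlongrightarrow> D) (at x within S)"
proof -
  have "((\<lambda>y. (1 / norm (y - x)) *\<^sub>R (f y - (f x + (y - x) *\<^sub>R D))) \<longlongrightarrow> 0) (at x within S) \<longleftrightarrow>
      ((\<lambda>y. (1 / (y - x)) *\<^sub>R (f y - f x) - D) \<longlongrightarrow> 0) (at x within S)"
    unfolding tendsto_norm_zero_iff[symmetric, of "\<lambda>y. (1 / norm (y - x)) *\<^sub>R _ y"]
      tendsto_norm_zero_iff[symmetric, of "\<lambda>y. (1 / (y - x)) *\<^sub>R (f y - f x) - D"]
  proof (intro filterlim_cong refl)
    show "\<forall>\<^sub>F y in at x within S. norm ((1 / norm (y - x)) *\<^sub>R (f y - (f x + (y - x) *\<^sub>R D))) =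
        norm ((1 / (y - x)) *\<^sub>R (f y - f x) - D)"
      unfolding eventually_at_topological
    proof (intro exI[of _ UNIV] conjI ballI impI)
      fix y assume "y \<noteq> x"
      then have "f y - (f x + (y - x) *\<^sub>R D) = (y - x) *\<^sub>R ((1 / (y - x)) *\<^sub>R (f y - f x) - D)"
        by (simp add: scaleR_diff_right)
      then show "norm ((1 / norm (y - x)) *\<^sub>R (f y - (f x + (y - x) *\<^sub>R D))) =
          norm ((1 / (y - x)) *\<^sub>R (f y - f x) - D)"
        using \<open>y \<noteq> x\<close> by simp
    qed auto
  qed
  then show ?thesis
    unfolding has_vector_derivative_def has_derivative_within Lim_null[of _ D]
    by (simp add: bounded_linear_scaleR_left)
qed

lemma op_commute_comp:
  assumes "X \<star> Y = Y \<star> X" "X \<star> Z = Z \<star> X"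
  shows "X \<star> (Y \<star> Z) = (Y \<star> Z) \<star> X"
  by (metis assms op_comp_assoc)

text \<open>\<open>J\<close> is the imaginary unit of a complex structure on the real space \<open>'a\<close>.\<close>

locale pseudo_resolvent =
  fixes J :: "'a::banach \<Rightarrow>\<^sub>L 'a" and R :: "complex \<Rightarrow> 'a \<Rightarrow>\<^sub>L 'a" and \<phi> C :: real
  assumes JJ: "J \<star> J = - id_blinfun"
    and RJ: "l \<in> dcone \<phi> \<Longrightarrow> R l \<star> J = J \<star> R l"
    and resolvent: "l \<in> dcone \<phi> \<Longrightarrow> m \<in> dcone \<phi> \<Longrightarrow>
      R l - R m = Re (m - l) *\<^sub>R (R l \<star> R m) + Im (m - l) *\<^sub>R (J \<star> (R l \<star> R m))"
    and R_bound: "l \<in> dcone \<phi> \<Longrightarrow> norm (R l) \<le> C / cmod l"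
    and phi: "0 < \<phi>" "\<phi> < pi / 2"
begin

text \<open>Complex scalars on operators: the imaginary unit acts by composition with
  \<open>J\<close> on the left. Scalars move past a left factor that commutes with \<open>J\<close>
  (\<open>comp_sc\<close>), and freely past a right factor (\<open>sc_comp\<close>).\<close>

definition sc :: "complex \<Rightarrow> ('a \<Rightarrow>\<^sub>L 'a) \<Rightarrow> 'a \<Rightarrow>\<^sub>L 'a" where
  "sc z X = Re z *\<^sub>R X + Im z *\<^sub>R (J \<star> X)"

lemma JJ': "J \<star> (J \<star> X) = - X"
proof -
  have "J \<star> (J \<star> X) = (J \<star> J) \<star> X" by (simp only: op_comp_assoc)
  also have "\<dots> = - X" unfolding JJ by (rule blinfun_eqI) (simp add: blinfun.bilinear_simps)
  finally show ?thesis .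
qed

sublocale sc: bounded_bilinear sc
proof
  fix z w X Y and r :: real
  show "sc (z + w) X = sc z X + sc w X" "sc z (X + Y) = sc z X + sc z Y"
    "sc (r *\<^sub>R z) X = r *\<^sub>R sc z X" "sc z (r *\<^sub>R X) = r *\<^sub>R sc z X"
    by (simp_all add: sc_def op_bilinear algebra_simps)
  have "norm (sc z X) \<le> norm z * norm X * (1 + norm J)" for z X
  proof -
    have "norm (sc z X) \<le> \<bar>Re z\<bar> * norm X + \<bar>Im z\<bar> * norm (J \<star> X)"
      unfolding sc_def by (rule norm_triangle_le) simp
    also have "\<dots> \<le> norm z * norm X + norm z * (norm J * norm X)"
      by (intro add_mono mult_mono norm_blinfun_compose abs_Re_le_cmod abs_Im_le_cmod) auto
    finally show ?thesis by (simp add: algebra_simps)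
  qed
  then show "\<exists>K. \<forall>z X. norm (sc z X) \<le> norm z * norm X * K" by blast
qed

lemma sc_sc: "sc z (sc w X) = sc (z * w) X"
  by (simp add: sc_def op_bilinear JJ' algebra_simps)

lemma sc_of_real [simp]: "sc (of_real r) X = r *\<^sub>R X"
  and sc_one [simp]: "sc 1 X = X"
  by (simp_all add: sc_def)

lemma sc_comp: "sc z X \<star> Y = sc z (X \<star> Y)"
  by (simp add: sc_def op_bilinear op_comp_assoc)

definition J_linear where "J_linear X \<longleftrightarrow> X \<star> J = J \<star> X"

lemma comp_sc: "J_linear X \<Longrightarrow> X \<star> sc z Y = sc z (X \<star> Y)"
  unfolding sc_def J_linear_def by (simp add: op_bilinear) (metis op_comp_assoc)

lemma J_linear_comp: "J_linear X \<Longrightarrow> J_linear Y \<Longrightarrow> J_linear (X \<star> Y)"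
  unfolding J_linear_def by (metis op_comp_assoc)

lemma J_linear_R: "l \<in> dcone \<phi> \<Longrightarrow> J_linear (R l)"
  by (simp add: J_linear_def RJ)

lemma resolvent_sc: "l \<in> dcone \<phi> \<Longrightarrow> m \<in> dcone \<phi> \<Longrightarrow> R l - R m = sc (m - l) (R l \<star> R m)"
  using resolvent by (simp add: sc_def)

text \<open>Exchanging \<open>l\<close> and \<open>m\<close> in the resolvent identity changes the
  sign of the left side and of the scalar, so the two products agree after division by
  \<open>m - l\<close>.\<close>

lemma R_commute:
  assumes "l \<in> dcone \<phi>" "m \<in> dcone \<phi>"
  shows "R l \<star> R m = R m \<star> R l"
proof (cases "l = m")
  case False
  have "sc (m - l) (R l \<star> R m) = sc (m - l) (R m \<star> R l)"
    using resolvent_sc[OF assms] resolvent_sc[OF assms(2,1)]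
    by (metis minus_diff_eq sc.minus_left)
  then have "sc (1 / (m - l)) (sc (m - l) (R l \<star> R m)) = sc (1 / (m - l)) (sc (m - l) (R m \<star> R l))"
    by simp
  then show ?thesis
    using False by (simp add: sc_sc)
qed simp

text \<open>If \<open>R l = (l - T)\<^sup>-\<^sup>1\<close>, then \<open>N l = (l\<^sup>2 - T\<^sup>2)\<^sup>-\<^sup>1\<close> and \<open>A = (1 + T\<^sup>2)\<^sup>-\<^sup>1\<close>.\<close>

definition N :: "complex \<Rightarrow> 'a \<Rightarrow>\<^sub>L 'a" where "N l = - (R l \<star> R (- l))"

definition A :: "'a \<Rightarrow>\<^sub>L 'a" where "A = R \<i> \<star> R (- \<i>)"

lemma N_minus: "l \<in> dcone \<phi> \<Longrightarrow> N (- l) = N l"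
  by (simp add: N_def R_commute)

lemma N_i: "N \<i> = - A"
  by (simp add: N_def A_def)

lemma J_linear_A: "J_linear A"
  by (simp add: A_def J_linear_comp J_linear_R)

lemma R_diff_minus: "l \<in> dcone \<phi> \<Longrightarrow> R l - R (- l) = sc (2 * l) (N l)"
  by (simp add: N_def resolvent_sc sc.minus_left sc.minus_right)

lemma N_commute:
  assumes "l \<in> dcone \<phi>" "m \<in> dcone \<phi>"
  shows "N l \<star> N m = N m \<star> N l"
proof -
  note c = op_commute_comp[OF R_commute[of _ m] R_commute[of _ "- m"]]
  have "R l \<star> R (- l) \<star> (R m \<star> R (- m)) = R m \<star> R (- m) \<star> (R l \<star> R (- l))"
    using assms by (intro op_commute_comp[symmetric] c[symmetric]) simp_all
  then show ?thesis by (simp add: N_def op_bilinear)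
qed

text \<open>Telescoping twice: both terms of \<open>N m - N l\<close> share the factor
  \<open>R m \<star> R (- l)\<close>, and what remains is the resolvent difference
  \<open>R l - R (- m)\<close>. The scalars collected on the way multiply to
  \<open>(m - l) * (- m - l) = l^2 - m^2\<close>.\<close>

lemma N_resolvent:
  assumes "l \<in> dcone \<phi>" "m \<in> dcone \<phi>"
  shows "N l - N m = sc (m\<^sup>2 - l\<^sup>2) (N l \<star> N m)"
proof -
  have mm: "- l \<in> dcone \<phi>" "- m \<in> dcone \<phi>" using assms by simp_all
  have "N m - N l = (R l - R m) \<star> R (- l) + R m \<star> (R (- l) - R (- m))"
    by (simp add: N_def op_bilinear)
  also have "(R l - R m) \<star> R (- l) = sc (m - l) (R m \<star> R (- l) \<star> R l)"
    using assms by (simp add: resolvent_sc sc_comp R_commute[of l m] op_comp_assoc R_commute[of l "- l"])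
  also have "R m \<star> (R (- l) - R (- m)) = sc (l - m) (R m \<star> R (- l) \<star> R (- m))"
    using assms by (simp add: resolvent_sc comp_sc J_linear_R op_comp_assoc)
  also have "sc (m - l) (R m \<star> R (- l) \<star> R l) + sc (l - m) (R m \<star> R (- l) \<star> R (- m)) =
      sc (m - l) (R m \<star> R (- l) \<star> (R l - R (- m)))"
    by (simp add: op_bilinear sc.diff_left sc.diff_right)
  also have "\<dots> = sc ((m - l) * (- m - l)) (R m \<star> R (- l) \<star> (R l \<star> R (- m)))"
    using assms by (simp add: resolvent_sc comp_sc J_linear_R J_linear_comp sc_sc)
  also have "(m - l) * (- m - l) = - (m\<^sup>2 - l\<^sup>2)"
    by (simp add: power2_eq_square algebra_simps)
  also have "R m \<star> R (- l) \<star> (R l \<star> R (- m)) = N l \<star> N m"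
  proof -
    have "R m \<star> R (- l) \<star> (R l \<star> R (- m)) = R l \<star> R (- l) \<star> (R m \<star> R (- m))"
      using assms R_commute[of l m] R_commute[of l "- m"] R_commute[of "- l" m] R_commute[of "- l" "- m"]
        R_commute[of l "- l"] by simp (metis op_comp_assoc)
    then show ?thesis by (simp add: N_def op_bilinear)
  qed
  finally have "N m - N l = - sc (m\<^sup>2 - l\<^sup>2) (N l \<star> N m)"
    by (simp only: sc.minus_left)
  then show ?thesis
    by (metis minus_diff_eq minus_minus)
qed

lemma A_commute: "l \<in> dcone \<phi> \<Longrightarrow> A \<star> N l = N l \<star> A"
  using N_commute[of l \<i>] by (simp add: N_i op_bilinear)

text \<open>The resolvent identity for \<open>T\<^sup>2\<close> at \<open>l\<^sup>2\<close> and \<open>-1\<close>.\<close>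

lemma A_N:
  assumes "l \<in> dcone \<phi>" "1 + l\<^sup>2 \<noteq> 0"
  shows "A \<star> N l = sc (1 / (1 + l\<^sup>2)) (N l + A)"
proof -
  have "N l + A = sc (1 + l\<^sup>2) (N l \<star> A)"
    using N_resolvent[OF assms(1), of \<i>] by (simp add: N_i op_bilinear sc.minus_right)
      (metis sc.minus_left minus_diff_eq diff_minus_eq_add add.commute)
  then have "sc (1 / (1 + l\<^sup>2)) (N l + A) = N l \<star> A"
    using assms by (simp add: sc_sc)
  then show ?thesis using A_commute assms by simp
qed


lemma C_nonneg: "C \<ge> 0"
  using R_bound[of \<i>] norm_ge_zero[of "R \<i>"] by (simp del: norm_ge_zero)

lemma N_bound: "l \<in> dcone \<phi> \<Longrightarrow> norm (N l) \<le> C\<^sup>2 / (cmod l)\<^sup>2"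
proof -
  assume l: "l \<in> dcone \<phi>"
  have "norm (N l) \<le> norm (R l) * norm (R (- l))"
    by (simp add: N_def norm_blinfun_compose)
  also have "\<dots> \<le> C / cmod l * (C / cmod l)"
    using R_bound[of l] R_bound[of "- l"] l C_nonneg by (intro mult_mono) auto
  finally show ?thesis by (simp add: power2_eq_square)
qed

lemma continuous_on_R: "continuous_on (dcone \<phi>) R"
  unfolding continuous_on_def
proof
  fix m assume m: "m \<in> dcone \<phi>"
  obtain K where K: "\<And>z X. norm (sc z X) \<le> norm z * norm X * K" "K > 0"
    using sc.pos_bounded by blast
  show "(R \<longlongrightarrow> R m) (at m within dcone \<phi>)"
    unfolding Lim_null[of R]
  proof (rule Lim_null_comparison)
    show "\<forall>\<^sub>F l in at m within dcone \<phi>. norm (R l - R m) \<le> cmod (m - l) * (C / cmod l * (C / cmod m)) * K"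
      unfolding eventually_at_topological
    proof (intro exI[of _ UNIV] conjI ballI impI)
      fix l assume l: "l \<in> dcone \<phi>"
      have "norm (R l \<star> R m) \<le> C / cmod l * (C / cmod m)"
        by (rule order_trans[OF norm_blinfun_compose mult_mono])
          (use l m C_nonneg R_bound in auto)
      then show "norm (R l - R m) \<le> cmod (m - l) * (C / cmod l * (C / cmod m)) * K"
        unfolding resolvent_sc[OF l m]
        using K(2) by (intro order_trans[OF K(1)] mult_right_mono mult_left_mono) auto
    qed auto
    show "((\<lambda>l. cmod (m - l) * (C / cmod l * (C / cmod m)) * K) \<longlongrightarrow> 0) (at m within dcone \<phi>)"
      using dcone_nonzero[OF m] by (auto intro!: tendsto_eq_intros)
  qed
qed

lemma continuous_on_N: "continuous_on (dcone \<phi>) N"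
  unfolding N_def
  by (intro continuous_intros bounded_bilinear.continuous_on[OF bounded_bilinear_blinfun_compose]
      continuous_on_R continuous_on_compose2[OF continuous_on_R]) auto

lemma continuous_on_N_comp [continuous_intros]:
  assumes "continuous_on S l" "\<And>x. x \<in> S \<Longrightarrow> l x \<in> dcone \<phi>"
  shows "continuous_on S (\<lambda>x. N (l x))"
  by (rule continuous_on_compose2[OF continuous_on_N]) (use assms in auto)

text \<open>\<open>N_resolvent\<close> expresses the difference quotient through that of
  \<open>l^2\<close>; the chain rule factor \<open>2 * l * l'\<close> is the derivative of
  \<open>l^2\<close> along the curve.\<close>

lemma N_has_vector_derivative:
  fixes l :: "real \<Rightarrow> complex"
  assumes l: "(l has_vector_derivative l') (at x within S)"
    and S: "\<And>y. y \<in> S \<Longrightarrow> l y \<in> dcone \<phi>" "x \<in> S"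
  shows "((\<lambda>y. N (l y)) has_vector_derivative sc (- (2 * l x * l')) (N (l x) \<star> N (l x))) (at x within S)"
  unfolding has_vector_derivative_iff_quotient
proof (rule Lim_transform_eventually)
  have c: "(l \<longlongrightarrow> l x) (at x within S)"
    using has_vector_derivative_continuous[OF l] by (simp add: continuous_within)
  have N: "((\<lambda>y. N (l y)) \<longlongrightarrow> N (l x)) (at x within S)"
  proof -
    have "continuous (at x within S) (\<lambda>y. N (l y))"
      by (rule continuous_within_compose2[of _ _ l, OF has_vector_derivative_continuous[OF l]])
        (use S continuous_on_N in \<open>auto simp: continuous_on_eq_continuous_within intro: continuous_within_subset\<close>)
    then show ?thesis by (simp add: continuous_within)
  qed
  have "((\<lambda>y. (l y)\<^sup>2) has_vector_derivative 2 * l x * l') (at x within S)"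
    unfolding power2_eq_square using has_vector_derivative_mult[OF l l] by (simp add: algebra_simps)
  then have "((\<lambda>y. (1 / (y - x)) *\<^sub>R ((l y)\<^sup>2 - (l x)\<^sup>2)) \<longlongrightarrow> 2 * l x * l') (at x within S)"
    by (simp only: has_vector_derivative_iff_quotient)
  from tendsto_minus[OF this]
  show "((\<lambda>y. sc (- ((1 / (y - x)) *\<^sub>R ((l y)\<^sup>2 - (l x)\<^sup>2))) (N (l y) \<star> N (l x))) \<longlongrightarrow>
      sc (- (2 * l x * l')) (N (l x) \<star> N (l x))) (at x within S)"
    by (intro sc.tendsto bounded_bilinear.tendsto[OF bounded_bilinear_blinfun_compose] N tendsto_const)
  show "\<forall>\<^sub>F y in at x within S. sc (- ((1 / (y - x)) *\<^sub>R ((l y)\<^sup>2 - (l x)\<^sup>2))) (N (l y) \<star> N (l x)) =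
      (1 / (y - x)) *\<^sub>R (N (l y) - N (l x))"
    unfolding eventually_at_topological
  proof (intro exI[of _ UNIV] conjI ballI impI)
    fix y assume y: "y \<in> S"
    have "- ((1 / (y - x)) *\<^sub>R ((l y)\<^sup>2 - (l x)\<^sup>2)) = (1 / (y - x)) *\<^sub>R ((l x)\<^sup>2 - (l y)\<^sup>2)"
      by (simp add: algebra_simps)
    then show "sc (- ((1 / (y - x)) *\<^sub>R ((l y)\<^sup>2 - (l x)\<^sup>2))) (N (l y) \<star> N (l x)) =
        (1 / (y - x)) *\<^sub>R (N (l y) - N (l x))"
      by (simp only: N_resolvent[OF S(1)[OF y] S(1)[OF S(2)]] sc.scaleR_left)
  qed auto
qed

section \<open>Rotating a ray through the complement of the double sector\<close>

definition ray_integrand :: "real \<Rightarrow> real \<Rightarrow> 'a \<Rightarrow>\<^sub>L 'a" where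
  "ray_integrand \<psi> t = sc (2 * of_real t * (cis \<psi>)\<^sup>2) (N (of_real t * cis \<psi>))"

text \<open>The form \<open>2 l N(l) dl\<close> on the circle of radius \<open>t\<close>, where
  \<open>dl = i l d\<psi>\<close>; \<open>ray_integrand\<close> is the same form on the ray of angle
  \<psi>, where \<open>dl = cis \<psi> dt\<close>.\<close>

definition arc_integrand :: "real \<Rightarrow> real \<Rightarrow> 'a \<Rightarrow>\<^sub>L 'a" where
  "arc_integrand \<psi> t = sc (2 * \<i> * (of_real t * cis \<psi>)\<^sup>2) (N (of_real t * cis \<psi>))"

text \<open>Cauchy's theorem on an annular sector, by differentiation in the angle: both partial
  derivatives below are equal because \<open>N\<close> is holomorphic.\<close>

lemma ray_integral_derivative:
  assumes ab: "0 < a" "a \<le> b" and \<psi>: "\<psi> \<in> {\<phi>..pi - \<phi>}"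
  shows "((\<lambda>\<psi>. integral {a..b} (ray_integrand \<psi>)) has_vector_derivative
      arc_integrand \<psi> b - arc_integrand \<psi> a) (at \<psi> within {\<phi>..pi - \<phi>})"
proof -
  define D where "D \<psi> t = sc (4 * \<i> * of_real t * (cis \<psi>)\<^sup>2) (N (of_real t * cis \<psi>))
      - sc (4 * \<i> * of_real t ^ 3 * cis \<psi> ^ 4) (N (of_real t * cis \<psi>) \<star> N (of_real t * cis \<psi>))" for \<psi> t
  have cone: "of_real t * cis \<psi> \<in> dcone \<phi>" if "\<psi> \<in> {\<phi>..pi - \<phi>}" "t \<in> {a..b}" for \<psi> t
    using that ab phi by (intro dcone_cis) auto
  have "((\<lambda>\<psi>. integral (cbox a b) (ray_integrand \<psi>)) has_vector_derivative integral (cbox a b) (D \<psi>))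
      (at \<psi> within {\<phi>..pi - \<phi>})"
  proof (rule leibniz_rule_vector_derivative)
    fix \<psi> t assume \<psi>: "\<psi> \<in> {\<phi>..pi - \<phi>}" and t: "t \<in> cbox a b"
    have cis': "(cis has_vector_derivative \<i> * cis \<psi>) (at \<psi> within {\<phi>..pi - \<phi>})" for \<psi>
      unfolding has_vector_derivative_complex_iff by (auto intro!: derivative_eq_intros)
    have 1: "((\<lambda>\<psi>. of_real t * cis \<psi>) has_vector_derivative of_real t * (\<i> * cis \<psi>)) (at \<psi> within {\<phi>..pi - \<phi>})"
      by (intro has_vector_derivative_mult_right cis')
    have 2: "((\<lambda>\<psi>. 2 * of_real t * (cis \<psi>)\<^sup>2) has_vector_derivative 4 * \<i> * of_real t * (cis \<psi>)\<^sup>2) (at \<psi> within {\<phi>..pi - \<phi>})"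
      using has_vector_derivative_mult_right[OF has_vector_derivative_mult[OF cis' cis'], of "2 * of_real t"]
      by (simp add: power2_eq_square algebra_simps)
    have "((\<lambda>\<psi>. sc (2 * of_real t * (cis \<psi>)\<^sup>2) (N (of_real t * cis \<psi>))) has_vector_derivative
        sc (2 * of_real t * (cis \<psi>)\<^sup>2) (sc (- (2 * (of_real t * cis \<psi>) * (of_real t * (\<i> * cis \<psi>))))
          (N (of_real t * cis \<psi>) \<star> N (of_real t * cis \<psi>)))
        + sc (4 * \<i> * of_real t * (cis \<psi>)\<^sup>2) (N (of_real t * cis \<psi>))) (at \<psi> within {\<phi>..pi - \<phi>})"
      by (rule sc.has_vector_derivative[OF 2 N_has_vector_derivative[OF 1]]) (use \<psi> t cone in auto)
    then show "((\<lambda>\<psi>. ray_integrand \<psi> t) has_vector_derivative D \<psi> t) (at \<psi> within {\<phi>..pi - \<phi>})"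
      by (simp add: ray_integrand_def D_def sc_sc sc.minus_left sc.minus_right power2_eq_square power3_eq_cube power4_eq_xxxx mult_ac)
  next
    show "ray_integrand \<psi> integrable_on cbox a b" if "\<psi> \<in> {\<phi>..pi - \<phi>}" for \<psi>
      unfolding ray_integrand_def
      by (intro integrable_continuous sc.continuous_on continuous_intros) (use cone that in auto)
    show "continuous_on ({\<phi>..pi - \<phi>} \<times> cbox a b) (\<lambda>(x, t). D x t)"
      unfolding D_def split_beta cis_conv_exp
      by (intro continuous_intros sc.continuous_on bounded_bilinear.continuous_on[OF bounded_bilinear_blinfun_compose])
        (use cone in \<open>auto simp: cis_conv_exp\<close>)
  qed (use \<psi> in auto)
  moreover have "(D \<psi> has_integral arc_integrand \<psi> b - arc_integrand \<psi> a) {a..b}"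
  proof (rule fundamental_theorem_of_calculus[OF ab(2)])
    fix t assume t: "t \<in> {a..b}"
    have 1: "((\<lambda>t. of_real t * cis \<psi>) has_vector_derivative cis \<psi>) (at t within {a..b})"
      unfolding scaleR_conv_of_real[symmetric] by (auto intro!: derivative_eq_intros)
    have 2: "((\<lambda>t. 2 * \<i> * (of_real t * cis \<psi>)\<^sup>2) has_vector_derivative 2 * \<i> * (2 * (of_real t * cis \<psi>) * cis \<psi>)) (at t within {a..b})"
      using has_vector_derivative_mult_right[OF has_vector_derivative_mult[OF 1 1], of "2 * \<i>"]
      by (simp add: power2_eq_square algebra_simps)
    have "((\<lambda>t. sc (2 * \<i> * (of_real t * cis \<psi>)\<^sup>2) (N (of_real t * cis \<psi>))) has_vector_derivative
        sc (2 * \<i> * (of_real t * cis \<psi>)\<^sup>2) (sc (- (2 * (of_real t * cis \<psi>) * cis \<psi>))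
          (N (of_real t * cis \<psi>) \<star> N (of_real t * cis \<psi>)))
        + sc (2 * \<i> * (2 * (of_real t * cis \<psi>) * cis \<psi>)) (N (of_real t * cis \<psi>))) (at t within {a..b})"
      by (rule sc.has_vector_derivative[OF 2 N_has_vector_derivative[OF 1]]) (use \<psi> t cone in auto)
    then show "((arc_integrand \<psi>) has_vector_derivative D \<psi> t) (at t within {a..b})"
      unfolding arc_integrand_def[abs_def]
      by (simp add: D_def sc_sc sc.minus_left sc.minus_right power2_eq_square power3_eq_cube power4_eq_xxxx mult_ac)
  qed
  ultimately show ?thesis
    by (simp add: integral_unique)
qed


abbreviation B :: "'a \<Rightarrow>\<^sub>L 'a" where "B \<equiv> A - A \<star> A"

lemma N_B:
  assumes "l \<in> dcone \<phi>" "1 + l\<^sup>2 \<noteq> 0"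
  shows "N l \<star> B = sc (1 / (1 + l\<^sup>2) - (1 / (1 + l\<^sup>2))\<^sup>2) (N l + A) - sc (1 / (1 + l\<^sup>2)) (A \<star> A)"
proof -
  define u where "u = 1 / (1 + l\<^sup>2)"
  have AN: "A \<star> N l = sc u (N l + A)"
    unfolding u_def by (rule A_N[OF assms])
  have "N l \<star> B = A \<star> N l - A \<star> (A \<star> N l)"
    by (simp add: op_bilinear op_comp_assoc[symmetric]) (simp add: op_comp_assoc A_commute[OF assms(1), symmetric])
  also have "A \<star> (A \<star> N l) = sc u (sc u (N l + A) + A \<star> A)"
    by (subst AN) (simp add: comp_sc J_linear_A op_bilinear AN)
  finally show ?thesis
    unfolding u_def[symmetric] AN by (simp add: sc.add_right sc.diff_left sc_sc power2_eq_square)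
qed

text \<open>\<open>N_B\<close> solved for \<open>u (1 - u) N\<close>. The poles at \<open>i\<close>
  and \<open>-i\<close> now sit only in the two terms with constant operators, whose scalar
  integrals have the primitives \<open>Ln (1 + l^2)\<close> and \<open>- u\<close>.\<close>

lemma N_base:
  assumes "l \<in> dcone \<phi>" "1 + l\<^sup>2 \<noteq> 0" "u = 1 / (1 + l\<^sup>2)"
  shows "sc (u * (1 - u)) (N l) = N l \<star> B - sc u B + sc (u\<^sup>2) A"
  unfolding N_B[OF assms(1,2)] assms(3)[symmetric]
  by (simp add: sc.add_right sc.diff_right sc.diff_left power2_eq_square algebra_simps)

text \<open>Because of \<open>l^2 u = 1 - u\<close>, both ends of the annulus can be read off: at
  infinity \<open>u\<close> tends to 0 and the right side tends to \<open>A - A \<star> A\<close>,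
  while at 0 the square of \<open>1 - u = O(l^2)\<close> outweighs
  \<open>N = O(l^-2)\<close>.\<close>

lemma arc_identity:
  assumes "l \<in> dcone \<phi>" "1 + l\<^sup>2 \<noteq> 0" "u = 1 / (1 + l\<^sup>2)"
  shows "sc (l\<^sup>2) (N l \<star> B) = sc ((1 - u)\<^sup>2) (N l + A) - sc (1 - u) (A \<star> A)"
proof -
  have "l\<^sup>2 * u = 1 - u"
    using assms by (simp add: field_simps)
  have "l\<^sup>2 * (u - u\<^sup>2) = l\<^sup>2 * u - l\<^sup>2 * u * u"
    by (simp add: power2_eq_square algebra_simps)
  then have "l\<^sup>2 * (u - u\<^sup>2) = (1 - u)\<^sup>2"
    unfolding \<open>l\<^sup>2 * u = 1 - u\<close> by (simp add: power2_eq_square algebra_simps)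
  with \<open>l\<^sup>2 * u = 1 - u\<close> show ?thesis
    unfolding N_B[OF assms(1,2)] assms(3)[symmetric] by (simp add: sc.diff_right sc_sc)
qed

lemma arc_estimate:
  obtains M where "M \<ge> 0"
    "\<And>l. l \<in> dcone \<phi> \<Longrightarrow> cmod l \<ge> 2 \<Longrightarrow> norm (sc (l\<^sup>2) (N l \<star> B) - B) \<le> M / (cmod l)\<^sup>2"
    "\<And>l. l \<in> dcone \<phi> \<Longrightarrow> cmod l \<le> 1 / 2 \<Longrightarrow> norm (sc (l\<^sup>2) (N l \<star> B)) \<le> M * (cmod l)\<^sup>2"
proof -
  obtain K where K: "\<And>z X. norm (sc z X) \<le> norm z * norm X * K" "K > 0"
    using sc.pos_bounded by blast
  define a where "a = norm A + norm (A \<star> A)"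
  have a: "norm A \<le> a" "norm (A \<star> A) \<le> a" "0 \<le> a" by (auto simp: a_def)
  \<comment> \<open>At infinity the terms with \<open>N l\<close>, \<open>A\<close> and
    \<open>A \<star> A\<close> contribute \<open>4 * C^2\<close>, \<open>6 * a\<close> and
    \<open>2 * a\<close>; the bound at 0 needs only \<open>4 * C^2 + 6 * a\<close>.\<close>
  define M where "M = K * (4 * C\<^sup>2 + 8 * a)"
  show ?thesis
  proof (rule that[of M])
    show "M \<ge> 0" using K a by (simp add: M_def)
  next
    fix l assume l: "l \<in> dcone \<phi>" "cmod l \<ge> 2"
    define u where "u = 1 / (1 + l\<^sup>2)"
    define r where "r = (cmod l)\<^sup>2"
    have r: "r \<ge> 4"
      using power_mono[OF l(2), of 2] by (simp add: r_def)
    have "cmod (1 + l\<^sup>2) \<ge> r - 1"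
      using norm_diff_ineq[of "l\<^sup>2" 1] by (simp add: r_def norm_power add.commute)
    then have n: "cmod (1 + l\<^sup>2) \<ge> r / 2" using r by simp
    then have nz: "1 + l\<^sup>2 \<noteq> 0" using r by auto
    have u: "cmod u \<le> 2 / r"
      using n r nz by (simp add: u_def norm_divide field_simps)
    moreover have "2 / r \<le> 1" using r by (simp add: field_simps)
    ultimately have u1: "cmod u \<le> 1" by linarith
    have u2: "cmod ((1 - u)\<^sup>2) \<le> 4"
      using power_mono[of "cmod (1 - u)" 2 2] norm_triangle_ineq4[of 1 u] u1 by (simp add: norm_power)
    have "(1 - u)\<^sup>2 - 1 = u * (u - 2)"
      by (simp add: power2_eq_square algebra_simps)
    moreover have "cmod (u * (u - 2)) \<le> 2 / r * 3"
      unfolding norm_mult using u u1 r norm_triangle_ineq4[of u 2] by (intro mult_mono) auto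
    ultimately have u3: "cmod ((1 - u)\<^sup>2 - 1) \<le> 6 / r" by simp
    have "sc (l\<^sup>2) (N l \<star> B) - B = sc ((1 - u)\<^sup>2) (N l) + sc ((1 - u)\<^sup>2 - 1) A + sc u (A \<star> A)"
      using arc_identity[OF l(1) nz u_def] by (simp add: sc.add_right sc.diff_left)
    also have "norm \<dots> \<le> cmod ((1 - u)\<^sup>2) * norm (N l) * K + cmod ((1 - u)\<^sup>2 - 1) * norm A * K + cmod u * norm (A \<star> A) * K"
      by (intro norm_triangle_mono K)
    also have "\<dots> \<le> 4 * (C\<^sup>2 / r) * K + 6 / r * a * K + 2 / r * a * K"
      using N_bound[OF l(1)] u u2 u3 a r K(2)
      by (intro add_mono mult_mono) (auto simp: r_def)
    also have "\<dots> = M / r" using r by (simp add: M_def field_simps)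
    finally show "norm (sc (l\<^sup>2) (N l \<star> B) - B) \<le> M / (cmod l)\<^sup>2" by (simp add: r_def)
  next
    fix l assume l: "l \<in> dcone \<phi>" "cmod l \<le> 1 / 2"
    define u where "u = 1 / (1 + l\<^sup>2)"
    define r where "r = (cmod l)\<^sup>2"
    have r: "r \<le> 1 / 4" "r > 0"
      using power_mono[OF l(2), of 2] dcone_nonzero[OF l(1)] by (auto simp: r_def power_divide)
    have "cmod (1 + l\<^sup>2) \<ge> 1 - r"
      using norm_diff_ineq[of 1 "l\<^sup>2"] by (simp add: r_def norm_power add.commute)
    then have n: "cmod (1 + l\<^sup>2) \<ge> 1 / 2" using r by simp
    then have nz: "1 + l\<^sup>2 \<noteq> 0" by auto
    have "cmod u \<le> 2"
      using n nz by (simp add: u_def norm_divide field_simps)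
    moreover have "1 - u = l\<^sup>2 * u"
      using nz by (simp add: u_def field_simps)
    ultimately have u1: "cmod (1 - u) \<le> 2 * r"
      using r by (simp add: norm_mult norm_power r_def)
    have u2: "cmod ((1 - u)\<^sup>2) \<le> 4 * (r * r)"
      unfolding norm_power using power_mono[OF u1, of 2] by (simp add: power2_eq_square)
    have "norm (N l + A) \<le> C\<^sup>2 / r + a"
      using N_bound[OF l(1)] a by (intro norm_triangle_le add_mono) (auto simp: r_def)
    then have "norm (sc ((1 - u)\<^sup>2) (N l + A)) \<le> 4 * (r * r) * (C\<^sup>2 / r + a) * K"
      using u2 K(2) a r by (intro order_trans[OF K(1)] mult_mono) auto
    moreover have "norm (sc (1 - u) (A \<star> A)) \<le> 2 * r * a * K"
      using u1 a r K(2) by (intro order_trans[OF K(1)] mult_mono) auto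
    ultimately have "norm (sc (l\<^sup>2) (N l \<star> B)) \<le> 4 * (r * r) * (C\<^sup>2 / r + a) * K + 2 * r * a * K"
      unfolding arc_identity[OF l(1) nz u_def] by (intro order_trans[OF norm_triangle_ineq4 add_mono])
    also have "\<dots> = 4 * C\<^sup>2 * K * r + 4 * a * K * (r * r) + 2 * a * K * r"
      using r by (simp add: field_simps)
    also have "\<dots> \<le> 4 * C\<^sup>2 * K * r + 4 * a * K * (1 * r) + 2 * a * K * r"
      using r a K(2) by (intro add_mono mult_mono order_refl) auto
    also have "\<dots> \<le> M * r"
      using r a K(2) by (simp add: M_def algebra_simps)
    finally show "norm (sc (l\<^sup>2) (N l \<star> B)) \<le> M * (cmod l)\<^sup>2" by (simp add: r_def)
  qed
qed

text \<open>By \<open>ray_integral_derivative\<close> and \<open>arc_estimate\<close>, the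
  derivative in the angle of the truncated integral times \<open>B\<close> is \<open>2 i B\<close>
  up to an error uniform in the angle: the outer arc gives the main term and the inner arc vanishes.
  The angle swept is \<open>pi - 2 * \<phi>\<close>.\<close>

lemma ray_integral_limit:
  "(\<lambda>n. (trunc_integral n (ray_integrand \<phi>)
       - trunc_integral n (ray_integrand (pi - \<phi>))) \<star> B)
    \<longlonglongrightarrow> - ((pi - 2 * \<phi>) *\<^sub>R sc (2 * \<i>) B)"
proof -
  obtain M where M: "M \<ge> 0"
    "\<And>l. l \<in> dcone \<phi> \<Longrightarrow> cmod l \<ge> 2 \<Longrightarrow> norm (sc (l\<^sup>2) (N l \<star> B) - B) \<le> M / (cmod l)\<^sup>2"
    "\<And>l. l \<in> dcone \<phi> \<Longrightarrow> cmod l \<le> 1 / 2 \<Longrightarrow> norm (sc (l\<^sup>2) (N l \<star> B)) \<le> M * (cmod l)\<^sup>2"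
    using arc_estimate by blast
  obtain K where K: "\<And>z X. norm (sc z X) \<le> norm z * norm X * K" "K > 0"
    using sc.pos_bounded by blast
  let ?I = "\<lambda>n \<psi>. trunc_integral n (ray_integrand \<psi>)"
  have "norm ((?I n \<phi> - ?I n (pi - \<phi>)) \<star> B - - ((pi - 2 * \<phi>) *\<^sub>R sc (2 * \<i>) B))
      \<le> pi * (3 * (4 * M * K / (real (Suc n))\<^sup>2))" if n: "n \<ge> 1" for n
  proof -
    define r where "r = real (Suc n)"
    have r: "r \<ge> 2" using n by (simp add: r_def)
    define \<delta> where "\<delta> = 4 * M * K / r\<^sup>2"
    have \<delta>: "\<delta> \<ge> 0" using M K by (simp add: \<delta>_def)
    define F' where "F' \<psi> = (arc_integrand \<psi> r - arc_integrand \<psi> (1 / r)) \<star> B - sc (2 * \<i>) B" for \<psi>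
    have bd: "norm (F' \<psi>) \<le> \<delta>" if \<psi>: "\<psi> \<in> {\<phi>..pi - \<phi>}" for \<psi>
    proof -
      define l m where "l = of_real r * cis \<psi>" and "m = of_real (1 / r) * cis \<psi>"
      have lm: "l \<in> dcone \<phi>" "m \<in> dcone \<phi>"
        unfolding l_def m_def using phi \<psi> r by (auto intro!: dcone_cis simp del: of_real_divide)
      have nlm: "cmod l = r" "cmod m = 1 / r" using r by (simp_all add: l_def m_def norm_mult norm_divide)
      have "F' \<psi> = sc (2 * \<i>) (sc (l\<^sup>2) (N l \<star> B) - B) - sc (2 * \<i>) (sc (m\<^sup>2) (N m \<star> B))"
        by (simp add: F'_def arc_integrand_def l_def m_def op_bilinear(3) sc_comp sc.diff_right sc_sc mult.assoc)
      also have "norm \<dots> \<le> 2 * (M / r\<^sup>2) * K + 2 * (M * (1 / r)\<^sup>2) * K"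
      proof -
        have sc2: "norm (sc (2 * \<i>) X) \<le> 2 * c * K" if "norm X \<le> c" for X c
          by (rule order_trans[OF K(1)]) (use that K(2) in \<open>simp add: norm_mult\<close>)
        have "1 / r \<le> 1 / 2" using r by simp
        then have "norm (sc (l\<^sup>2) (N l \<star> B) - B) \<le> M / r\<^sup>2" "norm (sc (m\<^sup>2) (N m \<star> B)) \<le> M * (1 / r)\<^sup>2"
          using M(2)[OF lm(1)] M(3)[OF lm(2)] r unfolding nlm by blast+
        then show ?thesis
          by (intro order_trans[OF norm_triangle_ineq4 add_mono[OF sc2 sc2]])
      qed
      also have "\<dots> = \<delta>" by (simp add: \<delta>_def power_divide)
      finally show ?thesis .
    qed
    \<comment> \<open>Subtracting the linear main term leaves a function of \<psi> whose derivative
      has norm at most \<delta>.\<close>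
    define F where "F \<psi> = ?I n \<psi> \<star> B - \<psi> *\<^sub>R sc (2 * \<i>) B" for \<psi>
    have d: "(F has_vector_derivative F' \<psi>) (at \<psi> within {\<phi>..pi - \<phi>})"
      if "\<psi> \<in> {\<phi>..pi - \<phi>}" for \<psi>
    proof -
      have "((\<lambda>\<psi>. ?I n \<psi>) has_vector_derivative arc_integrand \<psi> r - arc_integrand \<psi> (1 / r))
          (at \<psi> within {\<phi>..pi - \<phi>})"
        unfolding r_def by (rule ray_integral_derivative) (use that in \<open>auto simp: field_simps\<close>)
      then have "((\<lambda>\<psi>. ?I n \<psi> \<star> B) has_vector_derivative (arc_integrand \<psi> r - arc_integrand \<psi> (1 / r)) \<star> B)
          (at \<psi> within {\<phi>..pi - \<phi>})"
        by (rule bounded_linear.has_vector_derivative[OF bounded_bilinear.bounded_linear_left[OF bounded_bilinear_blinfun_compose]])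
      moreover have "((\<lambda>\<psi>. \<psi> *\<^sub>R sc (2 * \<i>) B) has_vector_derivative sc (2 * \<i>) B) (at \<psi> within {\<phi>..pi - \<phi>})"
        by (auto intro!: derivative_eq_intros)
      ultimately show ?thesis
        unfolding F'_def F_def[abs_def] by (rule has_vector_derivative_diff)
    qed
    have \<phi>: "\<phi> \<le> pi - \<phi>" using phi by simp
    have bd2: "norm (F' \<psi> - F' \<phi>) \<le> \<delta> + \<delta>" if "\<psi> \<in> {\<phi>..pi - \<phi>}" for \<psi>
      using \<phi> that by (intro order_trans[OF norm_triangle_ineq4 add_mono[OF bd bd]]) auto
    \<comment> \<open>The linearization bound uses the variation of \<open>F'\<close>, at most
      \<open>\<delta> + \<delta>\<close>; restoring the term with \<open>F' \<phi>\<close> adds one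
      more \<delta>, whence the factor 3.\<close>
    have "norm (F (pi - \<phi>) - F \<phi> - (pi - \<phi> - \<phi>) *\<^sub>R F' \<phi>) \<le> norm (pi - \<phi> - \<phi>) * (\<delta> + \<delta>)"
      using \<phi> by (intro vector_differentiable_bound_linearization[OF d])
        (use bd2 in \<open>auto simp: closed_segment_eq_real_ivl\<close>)
    moreover have "norm ((pi - \<phi> - \<phi>) *\<^sub>R F' \<phi>) \<le> norm (pi - \<phi> - \<phi>) * \<delta>"
      using bd[of \<phi>] \<phi> by (auto intro!: mult_left_mono)
    ultimately have "norm (F (pi - \<phi>) - F \<phi>) \<le> norm (pi - \<phi> - \<phi>) * \<delta> + norm (pi - \<phi> - \<phi>) * (\<delta> + \<delta>)"
      by (intro order_trans[OF norm_triangle_sub add_mono])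
    also have "\<dots> = norm (pi - \<phi> - \<phi>) * (3 * \<delta>)"
      by (simp only: distrib_left[symmetric]) simp
    also have "\<dots> \<le> pi * (3 * \<delta>)"
      using phi \<delta> by (intro mult_right_mono) auto
    also have "norm (F (pi - \<phi>) - F \<phi>) = norm ((?I n \<phi> - ?I n (pi - \<phi>)) \<star> B - - ((pi - 2 * \<phi>) *\<^sub>R sc (2 * \<i>) B))"
    proof -
      have "(pi - 2 * \<phi>) *\<^sub>R sc (2 * \<i>) B = (pi - \<phi>) *\<^sub>R sc (2 * \<i>) B - \<phi> *\<^sub>R sc (2 * \<i>) B"
        by (simp add: scaleR_diff_left[symmetric])
      moreover have "P - u - (Q - v) = P - Q - - (v - u)" for P Q u v :: "'a \<Rightarrow>\<^sub>L 'a"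
        by simp
      ultimately show ?thesis
        unfolding F_def by (subst norm_minus_commute) (simp only: op_bilinear(3))
    qed
    finally show ?thesis by (simp add: \<delta>_def r_def)
  qed
  then have ev: "\<forall>\<^sub>F n in sequentially. norm ((?I n \<phi> - ?I n (pi - \<phi>)) \<star> B - - ((pi - 2 * \<phi>) *\<^sub>R sc (2 * \<i>) B))
      \<le> pi * (3 * (4 * M * K / (real (Suc n))\<^sup>2))"
    by (auto simp: eventually_sequentially)
  have "(\<lambda>n. pi * (3 * (4 * M * K * (inverse (real (Suc n)))\<^sup>2))) \<longlonglongrightarrow> pi * (3 * (4 * M * K * 0\<^sup>2))"
    by (intro tendsto_intros LIMSEQ_inverse_real_of_nat)
  then have "(\<lambda>n. pi * (3 * (4 * M * K / (real (Suc n))\<^sup>2))) \<longlonglongrightarrow> 0"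
    by (simp add: divide_inverse power_inverse)
  from Lim_null_comparison[OF ev this] show ?thesis
    by (subst Lim_null)
qed


text \<open>\<open>ray_weight t\<close> is the derivative of \<open>(ray_point t)\<^sup>2\<close>.\<close>

definition ray_point :: "real \<Rightarrow> complex" where "ray_point t = of_real t * cis \<phi>"

definition ray_weight :: "real \<Rightarrow> complex" where "ray_weight t = 2 * of_real t * (cis \<phi>)\<^sup>2"

definition ray_u :: "real \<Rightarrow> complex" where "ray_u t = 1 / (1 + (ray_point t)\<^sup>2)"

definition H :: "(complex \<Rightarrow> complex) \<Rightarrow> real \<Rightarrow> 'a \<Rightarrow>\<^sub>L 'a" where
  "H g t = sc (ray_weight t * g (ray_u t)) (N (ray_point t))
     - sc (cnj (ray_weight t * g (ray_u t))) (N (cnj (ray_point t)))"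

section \<open>Scalar integrals along the ray\<close>

lemma cis_square: "(cis x)\<^sup>2 = cis (2 * x)"
  by (simp add: power2_eq_square cis_mult)

lemma ray_point_dcone: "t > 0 \<Longrightarrow> ray_point t \<in> dcone \<phi>"
  unfolding ray_point_def using phi by (intro dcone_cis) auto

text \<open>Keeps \<open>1 + l^2\<close> in the open upper half plane, so that \<open>u\<close> has
  no pole on the ray and the principal logarithm is differentiable along it.\<close>

lemma Im_ray_point_square:
  assumes "t > 0"
  shows "Im ((ray_point t)\<^sup>2) > 0"
proof -
  have "(ray_point t)\<^sup>2 = of_real (t\<^sup>2) * cis (2 * \<phi>)"
    unfolding ray_point_def power_mult_distrib cis_square by simp
  moreover have "sin (2 * \<phi>) > 0" using phi by (intro sin_gt_zero) auto
  ultimately show ?thesis using assms by simp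
qed

lemma ray_nonpos: "t > 0 \<Longrightarrow> 1 + (ray_point t)\<^sup>2 \<notin> \<real>\<^sub>\<le>\<^sub>0"
  using Im_ray_point_square[of t] by (auto simp: complex_nonpos_Reals_iff)

lemma ray_nonzero: "t > 0 \<Longrightarrow> 1 + (ray_point t)\<^sup>2 \<noteq> 0"
  using ray_nonpos[of t] by auto

lemma continuous_on_ray [continuous_intros]:
  "continuous_on S ray_point" "continuous_on S ray_weight" "(\<And>t. t \<in> S \<Longrightarrow> t > 0) \<Longrightarrow> continuous_on S ray_u"
  unfolding ray_point_def[abs_def] ray_weight_def[abs_def] ray_u_def[abs_def]
  by (intro continuous_intros; use ray_nonzero in \<open>force simp: ray_point_def\<close>)+

lemma ray_square_derivative:
  "((\<lambda>t. 1 + (ray_point t)\<^sup>2) has_vector_derivative ray_weight t) (at t within S)"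
proof -
  have 1: "(ray_point has_vector_derivative cis \<phi>) (at t within S)"
    unfolding ray_point_def[abs_def] scaleR_conv_of_real[symmetric] by (auto intro!: derivative_eq_intros)
  have "((\<lambda>t. 1 + ray_point t * ray_point t) has_vector_derivative 0 + (ray_point t * cis \<phi> + cis \<phi> * ray_point t)) (at t within S)"
    by (intro has_vector_derivative_add has_vector_derivative_mult 1 has_vector_derivative_const)
  then show ?thesis
    by (simp add: power2_eq_square ray_weight_def ray_point_def algebra_simps)
qed

lemma ray_u_derivative:
  "t > 0 \<Longrightarrow> (ray_u has_vector_derivative - (ray_weight t * (ray_u t)\<^sup>2)) (at t within S)"
proof -
  assume t: "t > 0"
  have "((\<lambda>z. 1 / z) has_field_derivative - (1 / (1 + (ray_point t)\<^sup>2)\<^sup>2)) (at (1 + (ray_point t)\<^sup>2))"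
    by (rule derivative_eq_intros refl ray_nonzero t)+ (simp add: power2_eq_square)
  from field_vector_diff_chain_within[OF ray_square_derivative DERIV_subset[OF this], of S]
  show ?thesis
    unfolding ray_u_def[abs_def] o_def by (simp add: power_divide)
qed

lemma ray_u_bound: "t > 0 \<Longrightarrow> cmod (ray_u t) \<le> 1 / (cos \<phi> * (1 + t\<^sup>2))"
proof -
  assume t: "t > 0"
  have c: "cos \<phi> > 0" using phi by (intro cos_gt_zero) auto
  have "cos \<phi> * (1 + t\<^sup>2) \<le> cmod (1 + (ray_point t)\<^sup>2)"
    using norm_one_plus_square[of "ray_point t"] t c
    by (simp add: ray_point_def norm_mult abs_mult)
  then show ?thesis
    using c t by (simp add: ray_u_def norm_divide) (intro divide_left_mono mult_pos_pos; use c ray_nonzero[OF t] in \<open>auto simp: add_pos_nonneg\<close>)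
qed

lemma ray_one_minus_u: "t > 0 \<Longrightarrow> 1 - ray_u t = (ray_point t)\<^sup>2 * ray_u t"
  using ray_nonzero[of t] by (simp add: ray_u_def field_simps)

lemma ray_u_limits:
  "(\<lambda>n. ray_u (1 / real (Suc n))) \<longlonglongrightarrow> 1" "(\<lambda>n. ray_u (real (Suc n))) \<longlonglongrightarrow> 0"
proof -
  have 0: "(\<lambda>n. complex_of_real (inverse (real (Suc n)))) \<longlonglongrightarrow> of_real 0"
    by (intro tendsto_of_real LIMSEQ_inverse_real_of_nat)
  have "(\<lambda>n. 1 / (1 + (of_real (inverse (real (Suc n))) * cis \<phi>)\<^sup>2)) \<longlonglongrightarrow> 1 / (1 + (of_real 0 * cis \<phi>)\<^sup>2)"
    by (intro tendsto_intros 0) auto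
  then show "(\<lambda>n. ray_u (1 / real (Suc n))) \<longlonglongrightarrow> 1"
    by (simp add: ray_u_def ray_point_def divide_inverse)
  have c: "cos \<phi> > 0" using phi by (intro cos_gt_zero) auto
  show "(\<lambda>n. ray_u (real (Suc n))) \<longlonglongrightarrow> 0"
  proof (rule Lim_null_comparison)
    have "cmod (ray_u (real (Suc n))) \<le> inverse (cos \<phi>) * inverse (real (Suc n))" for n
    proof -
      define r where "r = real (Suc n)"
      have r: "r \<ge> 1" by (simp add: r_def)
      have "r * 1 \<le> r * r" using r by (intro mult_left_mono) auto
      then have "r \<le> 1 + r\<^sup>2" by (simp add: power2_eq_square)
      then have "cos \<phi> * r \<le> cos \<phi> * (1 + r\<^sup>2)" using c by simp
      then have "1 / (cos \<phi> * (1 + r\<^sup>2)) \<le> 1 / (cos \<phi> * r)"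
        using c r by (intro divide_left_mono mult_pos_pos) (auto simp: add_pos_nonneg)
      then show ?thesis
        using ray_u_bound[of r] r unfolding r_def by (simp add: divide_inverse)
    qed
    then show "\<forall>\<^sub>F n in sequentially. norm (ray_u (real (Suc n))) \<le> inverse (cos \<phi>) * inverse (real (Suc n))"
      by simp
    show "(\<lambda>n. inverse (cos \<phi>) * inverse (real (Suc n))) \<longlonglongrightarrow> 0"
      using tendsto_mult_left[OF LIMSEQ_inverse_real_of_nat, of "inverse (cos \<phi>)"] by simp
  qed
qed

text \<open>Substitution of \<open>u\<close>: along the ray \<open>du = - w u^2 dt\<close> for the
  weight \<open>w\<close>. This accounts for the two factors \<open>ray_u t\<close> in the integrand
  and for the order of the endpoints.\<close>

lemma scalar_integral:
  assumes P: "\<And>z. (P has_field_derivative p z) (at z)" and ab: "0 < a" "a \<le> b"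
  shows "((\<lambda>t. ray_weight t * (ray_u t * (ray_u t * p (ray_u t)))) has_integral P (ray_u a) - P (ray_u b)) {a..b}"
proof -
  have "((\<lambda>t. - (ray_weight t * (ray_u t)\<^sup>2) * p (ray_u t)) has_integral P (ray_u b) - P (ray_u a)) {a..b}"
  proof (rule fundamental_theorem_of_calculus[OF ab(2)])
    fix t assume "t \<in> {a..b}"
    then have t: "t > 0" using ab by simp
    show "((\<lambda>t. P (ray_u t)) has_vector_derivative - (ray_weight t * (ray_u t)\<^sup>2) * p (ray_u t)) (at t within {a..b})"
      using field_vector_diff_chain_within[OF ray_u_derivative[OF t] DERIV_subset[OF P], of "{a..b}"]
      by (simp add: o_def)
  qed
  from has_integral_neg[OF this] show ?thesis
    by (simp add: power2_eq_square mult_ac)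
qed

text \<open>Subtracting the conjugate in \<open>H\<close> turns its scalar integrals into this
  expression, which forgets real parts; a divergent real logarithm disappears here.\<close>

definition imag_diff :: "complex \<Rightarrow> complex" where "imag_diff z = z - cnj z"

lemma bounded_linear_imag_diff: "bounded_linear imag_diff"
  unfolding imag_diff_def[abs_def]
  by (intro bounded_linear_sub bounded_linear_ident bounded_linear_cnj)

lemma imag_diff_eq: "imag_diff z = 2 * \<i> * of_real (Im z)"
  by (simp add: imag_diff_def complex_eq_iff)

lemma imag_diff_integral:
  "(f has_integral z) S \<Longrightarrow> ((\<lambda>t. imag_diff (f t)) has_integral imag_diff z) S"
  using has_integral_linear[OF _ bounded_linear_imag_diff] by (simp add: o_def)

text \<open>The primitive is \<open>Ln (1 + l^2)\<close>. Its imaginary part tends to 0 at the inner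
  end and to the argument \<open>2 * \<phi>\<close> of \<open>l^2\<close> at the outer end, and
  \<open>imag_diff\<close> doubles it.\<close>

lemma scalar_log_limit:
  "(\<lambda>n. imag_diff (trunc_integral n (\<lambda>t. ray_weight t * ray_u t))) \<longlonglongrightarrow> 4 * \<phi> * \<i>"
proof -
  have int: "integral {a..b} (\<lambda>t. ray_weight t * ray_u t) = Ln (1 + (ray_point b)\<^sup>2) - Ln (1 + (ray_point a)\<^sup>2)"
    if "0 < a" "a \<le> b" for a b
  proof (intro integral_unique fundamental_theorem_of_calculus[OF that(2)])
    fix t assume "t \<in> {a..b}"
    then have t: "t > 0" using that by simp
    show "((\<lambda>t. Ln (1 + (ray_point t)\<^sup>2)) has_vector_derivative ray_weight t * ray_u t) (at t within {a..b})"
      using field_vector_diff_chain_within[OF ray_square_derivative has_field_derivative_at_within[OF has_field_derivative_Ln[OF ray_nonpos[OF t]]], of "{a..b}"]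
      by (simp add: o_def ray_u_def divide_inverse)
  qed
  have sin: "sin (2 * \<phi>) > 0" using phi by (intro sin_gt_zero) auto
  have np: "cis (2 * \<phi>) \<notin> \<real>\<^sub>\<le>\<^sub>0"
    using sin by (auto simp: complex_nonpos_Reals_iff)
  have inv: "(\<lambda>n. complex_of_real ((inverse (real (Suc n)))\<^sup>2)) \<longlonglongrightarrow> of_real (0\<^sup>2)"
    by (intro tendsto_intros LIMSEQ_inverse_real_of_nat)
  have Im_a: "Im (Ln (1 + (ray_point (1 / real (Suc n)))\<^sup>2)) = Im (Ln (1 + of_real ((inverse (real (Suc n)))\<^sup>2) * cis (2 * \<phi>)))" for n
    unfolding ray_point_def power_mult_distrib cis_square by (simp add: divide_inverse)
  \<comment> \<open>Dividing by the positive number \<open>r^2\<close> changes only the real part of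
    the logarithm and leaves an argument that converges.\<close>
  have Im_b: "Im (Ln (1 + (ray_point (real (Suc n)))\<^sup>2)) = Im (Ln (of_real ((inverse (real (Suc n)))\<^sup>2) + cis (2 * \<phi>)))" for n
  proof -
    define r where "r = real (Suc n)"
    have r: "r > 0" by (simp add: r_def)
    have "1 + (ray_point r)\<^sup>2 = of_real (r\<^sup>2) * (of_real ((inverse r)\<^sup>2) + cis (2 * \<phi>))"
      using r unfolding ray_point_def power_mult_distrib cis_square
      by (simp add: algebra_simps power_inverse)
    moreover have "of_real ((inverse r)\<^sup>2) + cis (2 * \<phi>) \<noteq> 0"
      using sin by (auto simp: complex_eq_iff)
    ultimately have "Ln (1 + (ray_point r)\<^sup>2) = of_real (ln (r\<^sup>2)) + Ln (of_real ((inverse r)\<^sup>2) + cis (2 * \<phi>))"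
      using r by (simp add: Ln_times_of_real Ln_of_real del: of_real_power)
    then show ?thesis unfolding r_def by simp
  qed
  have "(\<lambda>n. Im (Ln (of_real ((inverse (real (Suc n)))\<^sup>2) + cis (2 * \<phi>)))) \<longlonglongrightarrow> Im (Ln (of_real (0\<^sup>2) + cis (2 * \<phi>)))"
    by (intro tendsto_intros inv) (use np in auto)
  moreover have "Im (Ln (of_real (0\<^sup>2) + cis (2 * \<phi>))) = 2 * \<phi>"
    using phi by (simp add: cis_conv_exp)
  moreover have "(\<lambda>n. Im (Ln (1 + of_real ((inverse (real (Suc n)))\<^sup>2) * cis (2 * \<phi>)))) \<longlonglongrightarrow> Im (Ln (1 + of_real (0\<^sup>2) * cis (2 * \<phi>)))"
    by (intro tendsto_intros inv) auto
  ultimately have "(\<lambda>n. 2 * \<i> * of_real (Im (Ln (1 + (ray_point (real (Suc n)))\<^sup>2)) - Im (Ln (1 + (ray_point (1 / real (Suc n)))\<^sup>2))))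
      \<longlonglongrightarrow> 2 * \<i> * of_real (2 * \<phi> - 0)"
    unfolding Im_a Im_b by (intro tendsto_intros) simp_all
  moreover have "imag_diff (trunc_integral n (\<lambda>t. ray_weight t * ray_u t)) =
      2 * \<i> * of_real (Im (Ln (1 + (ray_point (real (Suc n)))\<^sup>2)) - Im (Ln (1 + (ray_point (1 / real (Suc n)))\<^sup>2)))" for n
    by (subst int) (simp_all add: field_simps imag_diff_eq)
  ultimately show ?thesis
    by (simp add: mult_ac del: of_nat_Suc)
qed


section \<open>The truncated contour integral and its limit\<close>

lemma continuous_on_H:
  assumes "continuous_on UNIV g" "\<And>t. t \<in> S \<Longrightarrow> t > 0"
  shows "continuous_on S (H g)"
proof -
  have "continuous_on S (\<lambda>t. g (ray_u t))"
    using assms by (intro continuous_on_compose2[OF assms(1)] continuous_intros) auto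
  then show ?thesis
    unfolding H_def[abs_def]
    by (intro continuous_intros sc.continuous_on) (use assms ray_point_dcone in auto)
qed

lemma fcalc_continuous: "fcalc D g G \<Longrightarrow> continuous_on UNIV g"
  using fcalc_differentiable[of D g G] by (meson DERIV_isCont continuous_at_imp_continuous_on)

text \<open>\<open>N\<close> is even, so the conjugate ray may be replaced by its negative, the ray
  of angle \<open>pi - \<phi>\<close>. That ray lies in the upper half plane like the one of angle
  \<phi>, and the rotation between them stays inside \<open>dcone \<phi>\<close>.\<close>

lemma ray_point_reflect:
  "t > 0 \<Longrightarrow> sc (cnj (ray_weight t)) (N (cnj (ray_point t))) = ray_integrand (pi - \<phi>) t"
proof -
  assume t: "t > 0"
  have "cis (pi - \<phi>) = - cnj (cis \<phi>)"
    by (simp add: complex_eq_iff)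
  then have 1: "of_real t * cis (pi - \<phi>) = - cnj (ray_point t)"
    and 2: "2 * of_real t * (cis (pi - \<phi>))\<^sup>2 = cnj (ray_weight t)"
    by (simp_all add: ray_point_def ray_weight_def)
  show ?thesis
    unfolding ray_integrand_def 1 2 using ray_point_dcone[OF t] by (simp add: N_minus)
qed

lemma H_base:
  assumes t: "t > 0"
  shows "H (\<lambda>u. u * (1 - u)) t = (ray_integrand \<phi> t - ray_integrand (pi - \<phi>) t) \<star> B
    - sc (imag_diff (ray_weight t * ray_u t)) B
    + sc (imag_diff (ray_weight t * (ray_u t * (ray_u t * 1)))) A"
proof -
  have 1: "sc (w * (u * (1 - u))) (N l) = sc w (N l) \<star> B - sc (w * u) B + sc (w * (u * (u * 1))) A"
    if "l \<in> dcone \<phi>" "1 + l\<^sup>2 \<noteq> 0" "u = 1 / (1 + l\<^sup>2)" for w u l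
  proof -
    have "sc (w * (u * (1 - u))) (N l) = sc w (sc (u * (1 - u)) (N l))"
      by (simp only: sc_sc)
    then show ?thesis
      unfolding N_base[OF that] by (simp only: sc.add_right sc.diff_right sc_sc sc_comp power2_eq_square mult_1_right)
  qed
  have c: "cnj (ray_u t) = 1 / (1 + (cnj (ray_point t))\<^sup>2)"
    by (simp add: ray_u_def)
  have nz: "1 + (cnj (ray_point t))\<^sup>2 \<noteq> 0"
    using ray_nonzero[OF t] by (metis complex_cnj_add complex_cnj_one complex_cnj_power complex_cnj_zero_iff)
  have "H (\<lambda>u. u * (1 - u)) t = sc (ray_weight t * (ray_u t * (1 - ray_u t))) (N (ray_point t))
      - sc (cnj (ray_weight t) * (cnj (ray_u t) * (1 - cnj (ray_u t)))) (N (cnj (ray_point t)))"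
    by (simp add: H_def)
  also have "\<dots> = (sc (ray_weight t) (N (ray_point t)) - sc (cnj (ray_weight t)) (N (cnj (ray_point t)))) \<star> B
    - sc (ray_weight t * ray_u t - cnj (ray_weight t) * cnj (ray_u t)) B
    + sc (ray_weight t * (ray_u t * (ray_u t * 1)) - cnj (ray_weight t) * (cnj (ray_u t) * (cnj (ray_u t) * 1))) A"
    using ray_point_dcone[OF t] ray_nonzero[OF t] nz c
    by (subst (1 2) 1) (simp_all add: ray_u_def op_bilinear(3) sc.diff_left)
  finally show ?thesis
    unfolding ray_point_reflect[OF t] by (simp add: imag_diff_def ray_integrand_def ray_point_def ray_weight_def)
qed

lemma H_mult:
  assumes t: "t > 0"
  shows "H (\<lambda>u. u * g u) t = A \<star> H g t - sc (imag_diff (ray_weight t * (ray_u t * g (ray_u t)))) A"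
proof -
  have 1: "sc (w * u * v) (N l) = A \<star> sc (w * v) (N l) - sc (w * u * v) A"
    if "l \<in> dcone \<phi>" "1 + l\<^sup>2 \<noteq> 0" "u = 1 / (1 + l\<^sup>2)" for w u v l
  proof -
    have "A \<star> sc (w * v) (N l) = sc (w * v) (sc u (N l + A))"
      using A_N[OF that(1,2)] that(3) by (simp add: comp_sc J_linear_A)
    then show ?thesis
      by (simp add: sc_sc sc.add_right mult_ac)
  qed
  have c: "cnj (ray_u t) = 1 / (1 + (cnj (ray_point t))\<^sup>2)"
    by (simp add: ray_u_def)
  have nz: "1 + (cnj (ray_point t))\<^sup>2 \<noteq> 0"
    using ray_nonzero[OF t] by (metis complex_cnj_add complex_cnj_one complex_cnj_power complex_cnj_zero_iff)
  have "H (\<lambda>u. u * g u) t = sc (ray_weight t * ray_u t * g (ray_u t)) (N (ray_point t))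
      - sc (cnj (ray_weight t) * cnj (ray_u t) * cnj (g (ray_u t))) (N (cnj (ray_point t)))"
    by (simp add: H_def mult.assoc)
  also have "\<dots> = (A \<star> sc (ray_weight t * g (ray_u t)) (N (ray_point t)) - sc (ray_weight t * ray_u t * g (ray_u t)) A)
     - (A \<star> sc (cnj (ray_weight t) * cnj (g (ray_u t))) (N (cnj (ray_point t)))
         - sc (cnj (ray_weight t) * cnj (ray_u t) * cnj (g (ray_u t))) A)"
    using 1[OF ray_point_dcone[OF t] ray_nonzero[OF t] ray_u_def] 1[of "cnj (ray_point t)", OF _ nz c] ray_point_dcone[OF t]
    by simp
  finally show ?thesis
    by (simp add: H_def op_bilinear imag_diff_def sc.diff_left mult.assoc)
qed

text \<open>Along the ray \<open>u\<close> runs from 1 to 0, so the integral tends to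
  \<open>P 1 - P 0\<close>, a real number that \<open>imag_diff\<close> annihilates.\<close>

lemma scalar_integral_limit:
  assumes "\<And>z. (P has_field_derivative p z) (at z)" "Im (P 0) = 0" "Im (P 1) = 0"
  shows "(\<lambda>n. imag_diff (trunc_integral n
     (\<lambda>t. ray_weight t * (ray_u t * (ray_u t * p (ray_u t)))))) \<longlonglongrightarrow> 0"
proof -
  have "1 / real (Suc n) \<le> real (Suc n)" for n by (simp add: field_simps)
  then have eq: "trunc_integral n (\<lambda>t. ray_weight t * (ray_u t * (ray_u t * p (ray_u t))))
      = P (ray_u (1 / real (Suc n))) - P (ray_u (real (Suc n)))" for n
    by (intro integral_unique scalar_integral assms(1)) auto
  have "isCont P z" for z using assms(1) DERIV_isCont by blast
  then have "(\<lambda>n. P (ray_u (1 / real (Suc n))) - P (ray_u (real (Suc n)))) \<longlonglongrightarrow> P 1 - P 0"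
    by (intro tendsto_diff isCont_tendsto_compose[of _ P] ray_u_limits)
  from bounded_linear.tendsto[OF bounded_linear_imag_diff this] show ?thesis
    unfolding eq using assms by (simp add: imag_diff_eq)
qed

lemma fcalc_limit:
  assumes "fcalc A g G"
  shows "(\<lambda>n. trunc_integral n (H g)) \<longlonglongrightarrow> sc (- (2 * pi * \<i>)) G"
  using assms
proof induction
  case base
  let ?S = "\<lambda>n. {1 / real (Suc n)..real (Suc n)}"
  note pos = trunc_pos
  have sc_int: "((\<lambda>t. sc (imag_diff (f t)) X) has_integral sc (imag_diff (trunc_integral n f)) X) (?S n)"
    if "continuous_on (?S n) f" for f X n
    using has_integral_linear[OF imag_diff_integral[OF integrable_integral[OF integrable_continuous_real[OF that]]]
        sc.bounded_linear_left, of X]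
    by (simp add: o_def)
  have eq: "trunc_integral n (H (\<lambda>u. u * (1 - u))) =
      (trunc_integral n (ray_integrand \<phi>) - trunc_integral n (ray_integrand (pi - \<phi>))) \<star> B
      - sc (imag_diff (trunc_integral n (\<lambda>t. ray_weight t * ray_u t))) B
      + sc (imag_diff (trunc_integral n (\<lambda>t. ray_weight t * (ray_u t * (ray_u t * 1))))) A" (is "_ = ?r n") for n
  proof (rule integral_unique)
    have ray: "(ray_integrand \<psi> has_integral trunc_integral n (ray_integrand \<psi>)) (?S n)"
      if "\<psi> \<in> {\<phi>..pi - \<phi>}" for \<psi>
      unfolding ray_integrand_def
      by (intro integrable_integral integrable_continuous_real sc.continuous_on continuous_intros dcone_cis) (use phi that pos in auto)
    have "((\<lambda>t. (ray_integrand \<phi> t - ray_integrand (pi - \<phi>) t) \<star> B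
        - sc (imag_diff (ray_weight t * ray_u t)) B
        + sc (imag_diff (ray_weight t * (ray_u t * (ray_u t * 1)))) A) has_integral ?r n) (?S n)"
    proof (intro has_integral_add has_integral_diff sc_int continuous_intros pos)
      show "((\<lambda>t. (ray_integrand \<phi> t - ray_integrand (pi - \<phi>) t) \<star> B) has_integral
          (trunc_integral n (ray_integrand \<phi>) - trunc_integral n (ray_integrand (pi - \<phi>))) \<star> B) (?S n)"
        using phi by (intro has_integral_linear[OF has_integral_diff[OF ray ray], unfolded o_def]
            bounded_bilinear.bounded_linear_left[OF bounded_bilinear_blinfun_compose]) auto
    qed
    then show "(H (\<lambda>u. u * (1 - u)) has_integral ?r n) (?S n)"
      by (rule has_integral_eq[rotated]) (use pos in \<open>auto simp: H_base\<close>)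
  qed
  have "(\<lambda>n. trunc_integral n (H (\<lambda>u. u * (1 - u)))) \<longlonglongrightarrow>
    - ((pi - 2 * \<phi>) *\<^sub>R sc (2 * \<i>) B) - sc (4 * \<phi> * \<i>) B + sc 0 A"
    unfolding eq
    by (intro tendsto_intros sc.tendsto ray_integral_limit scalar_log_limit
        scalar_integral_limit[where P = "\<lambda>z. z"] DERIV_ident) auto
  \<comment> \<open>The angle cancels:
    \<open>- 2 (pi - 2 \<phi>) i - 4 \<phi> i = - 2 pi i\<close>.\<close>
  also have "- ((pi - 2 * \<phi>) *\<^sub>R sc (2 * \<i>) B) - sc (4 * \<phi> * \<i>) B + sc 0 A = sc (- (2 * pi * \<i>)) B"
    unfolding sc.scaleR_left[symmetric] sc.minus_left[symmetric] sc.diff_left[symmetric]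
    by (simp add: sc.zero_left) (simp add: scaleR_conv_of_real algebra_simps)
  finally show ?case .
next
  case (mult g G)
  let ?S = "\<lambda>n. {1 / real (Suc n)..real (Suc n)}"
  note pos = trunc_pos
  obtain p P where p: "\<And>z. g z = z * p z" "\<And>z. (P has_field_derivative p z) (at z)" "Im (P 0) = 0" "Im (P 1) = 0"
    using fcalc_primitive[OF mult.hyps, of 0] by auto
  have cg: "continuous_on S (\<lambda>t. g (ray_u t))" if "\<And>t. t \<in> S \<Longrightarrow> t > 0" for S
    using that by (intro continuous_on_compose2[OF fcalc_continuous[OF mult.hyps]] continuous_intros) auto
  have eq: "trunc_integral n (H (\<lambda>u. u * g u)) = A \<star> trunc_integral n (H g)
      - sc (imag_diff (trunc_integral n (\<lambda>t. ray_weight t * (ray_u t * g (ray_u t))))) A" for n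
  proof (rule integral_unique)
    have "((\<lambda>t. ray_weight t * (ray_u t * g (ray_u t))) has_integral
        trunc_integral n (\<lambda>t. ray_weight t * (ray_u t * g (ray_u t)))) (?S n)"
      by (intro integrable_integral integrable_continuous_real continuous_intros cg pos)
    from has_integral_linear[OF imag_diff_integral[OF this] sc.bounded_linear_left, of A]
    have 1: "((\<lambda>t. sc (imag_diff (ray_weight t * (ray_u t * g (ray_u t)))) A) has_integral
        sc (imag_diff (trunc_integral n (\<lambda>t. ray_weight t * (ray_u t * g (ray_u t))))) A) (?S n)"
      by (simp add: o_def)
    have "(H g has_integral trunc_integral n (H g)) (?S n)"
      by (intro integrable_integral integrable_continuous_real continuous_on_H fcalc_continuous[OF mult.hyps] pos)
    from has_integral_linear[OF this bounded_bilinear.bounded_linear_right[OF bounded_bilinear_blinfun_compose], of A]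
    have "((\<lambda>t. A \<star> H g t) has_integral A \<star> trunc_integral n (H g)) (?S n)"
      by (simp add: o_def)
    from has_integral_diff[OF this 1]
    show "(H (\<lambda>u. u * g u) has_integral A \<star> trunc_integral n (H g)
      - sc (imag_diff (trunc_integral n (\<lambda>t. ray_weight t * (ray_u t * g (ray_u t))))) A) (?S n)"
      by (rule has_integral_eq[rotated]) (use pos in \<open>auto simp: H_mult\<close>)
  qed
  \<comment> \<open>The factor \<open>z\<close> split off from \<open>g\<close> supplies the second
    \<open>ray_u t\<close> that \<open>scalar_integral_limit\<close> requires.\<close>
  have "(\<lambda>n. imag_diff (trunc_integral n (\<lambda>t. ray_weight t * (ray_u t * g (ray_u t))))) \<longlonglongrightarrow> 0"
    unfolding p(1) by (rule scalar_integral_limit[OF p(2-4)])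
  then have "(\<lambda>n. trunc_integral n (H (\<lambda>u. u * g u))) \<longlonglongrightarrow> A \<star> sc (- (2 * pi * \<i>)) G - sc 0 A"
    unfolding eq
    by (intro tendsto_intros sc.tendsto bounded_bilinear.tendsto[OF bounded_bilinear_blinfun_compose] mult.IH) auto
  then show ?case
    by (simp add: sc.zero_left comp_sc J_linear_A)
next
  case (diff g G h K)
  let ?S = "\<lambda>n. {1 / real (Suc n)..real (Suc n)}"
  note pos = trunc_pos
  have eq: "trunc_integral n (H (\<lambda>u. g u - h u)) = trunc_integral n (H g) - trunc_integral n (H h)" for n
  proof -
    have "H (\<lambda>u. g u - h u) = (\<lambda>t. H g t - H h t)"
      by (simp add: H_def fun_eq_iff right_diff_distrib sc.diff_left algebra_simps)
    then show ?thesis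
      by (simp only:) (intro integral_diff integrable_continuous_real continuous_on_H fcalc_continuous[OF diff.hyps(1)]
          fcalc_continuous[OF diff.hyps(2)] pos)
  qed
  show ?case
    unfolding eq sc.diff_right by (intro tendsto_intros diff.IH)
qed

end

section \<open>Improper integrals over the real line\<close>

lemma le_one_plus_square: "\<bar>r\<bar> \<le> 1 + r\<^sup>2" for r :: real
  using zero_le_power2[of "\<bar>r\<bar> - 1"] by (simp add: power2_diff)

lemma integrable_inverse_square: "(\<lambda>t::real. 1 / (1 + t\<^sup>2)) integrable_on UNIV"
  using set_borel_integral_eq_integral(1)[OF integrable_inverse_1_plus_square] by (simp add: inverse_eq_divide)

text \<open>The contour integrand has no meaningful value at 0, so nothing is assumed there and
  \<open>q\<close> puts 0 instead. Near 0 the bound is at most \<open>c * \<bar>t\<bar>\<close>,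
  which makes \<open>q\<close> continuous and the omitted interval negligible; far out it is at most
  \<open>c / (1 + t^2)\<close>, which gives integrability. Folding \<open>t\<close> onto
  \<open>- t\<close> leaves an integral over the positive half-line only.\<close>

lemma integral_line_limit:
  fixes p :: "real \<Rightarrow> 'a::banach"
  assumes cont: "continuous_on {0<..} p" "continuous_on {..<0} p"
    and bd: "\<And>t. t \<noteq> 0 \<Longrightarrow> norm (p t) \<le> c * \<bar>t\<bar> / (1 + t\<^sup>2)\<^sup>2"
  shows "p integrable_on UNIV"
    and "(\<lambda>n. trunc_integral n (\<lambda>t. p t + p (- t))) \<longlonglongrightarrow> integral UNIV p"
proof -
  define q where "q t = (if t = 0 then 0 else p t)" for t
  have "0 \<le> c * \<bar>1\<bar> / (1 + 1\<^sup>2)\<^sup>2" by (rule order_trans[OF norm_ge_zero bd]) simp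
  then have c: "c \<ge> 0" by simp
  have bd1: "norm (q t) \<le> c * \<bar>t\<bar>" for t
  proof (cases "t = 0")
    case False
    have "c * \<bar>t\<bar> / (1 + t\<^sup>2)\<^sup>2 \<le> c * \<bar>t\<bar> / 1"
      using c add_pos_nonneg[OF zero_less_one zero_le_power2[of t]]
      by (intro divide_left_mono mult_nonneg_nonneg mult_pos_pos zero_less_power one_le_power) auto
    then show ?thesis using bd[OF False] False by (simp add: q_def)
  qed (simp add: q_def)
  have bd2: "norm (q t) \<le> c * (1 / (1 + t\<^sup>2))" for t
  proof (cases "t = 0")
    case False
    have "c * \<bar>t\<bar> / (1 + t\<^sup>2)\<^sup>2 \<le> c * (1 + t\<^sup>2) / (1 + t\<^sup>2)\<^sup>2"
      using c le_one_plus_square[of t] by (intro divide_right_mono mult_left_mono) auto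
    also have "\<dots> = c * (1 / (1 + t\<^sup>2))"
      using add_pos_nonneg[OF zero_less_one zero_le_power2[of t]] by (simp add: power2_eq_square[of "1 + t\<^sup>2"])
    finally show ?thesis using bd[OF False] False by (simp add: q_def)
  qed (use c in \<open>simp add: q_def\<close>)
  have "isCont q t" for t
  proof (cases t "0 :: real" rule: linorder_cases)
    case less
    then have "isCont p t"
      using cont(2) by (simp add: continuous_on_eq_continuous_at)
    moreover have "\<forall>\<^sub>F x in nhds t. x \<in> {..<0}"
      using less by (intro eventually_nhds_in_open) auto
    then have "\<forall>\<^sub>F x in nhds t. q x = p x"
      by eventually_elim (auto simp: q_def)
    ultimately show ?thesis by (simp add: isCont_cong)
  next
    case greater
    then have "isCont p t"
      using cont(1) by (simp add: continuous_on_eq_continuous_at)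
    moreover have "\<forall>\<^sub>F x in nhds t. x \<in> {0<..}"
      using greater by (intro eventually_nhds_in_open) auto
    then have "\<forall>\<^sub>F x in nhds t. q x = p x"
      by eventually_elim (auto simp: q_def)
    ultimately show ?thesis by (simp add: isCont_cong)
  next
    case equal
    have "(q \<longlongrightarrow> 0) (at 0)"
      by (rule Lim_null_comparison[of _ "\<lambda>t. c * \<bar>t\<bar>"]) (auto simp: bd1 intro!: tendsto_eq_intros)
    then show ?thesis using equal by (simp add: isCont_def q_def)
  qed
  then have contq: "continuous_on S q" for S
    by (simp add: continuous_at_imp_continuous_on)
  have intq: "q integrable_on UNIV"
  proof (rule integrable_on_all_intervals_integrable_bound)
    show "(\<lambda>t. if t \<in> UNIV then q t else 0) integrable_on cbox a b" for a b
      by (simp add: integrable_continuous_real contq)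
    show "(\<lambda>t. c * (1 / (1 + t\<^sup>2))) integrable_on UNIV"
      using integrable_on_cmult_left[OF integrable_inverse_square, of c] by simp
  qed (use bd2 in simp)
  show "p integrable_on UNIV"
    by (rule integrable_spike[OF intq, of "{0}"]) (auto simp: q_def)
  have eq: "integral UNIV p = integral UNIV q"
    by (rule integral_spike[of "{0}"]) (auto simp: q_def)
  have lim: "(\<lambda>n. integral {- real (Suc n)..real (Suc n)} q) \<longlonglongrightarrow> integral UNIV q"
  proof (rule LIMSEQ_I)
    fix e :: real assume "e > 0"
    then obtain b where b: "b > 0" "\<And>x y. ball 0 b \<subseteq> cbox x y \<Longrightarrow> norm (integral (cbox x y) q - integral UNIV q) < e"
      using integrable_integral[OF intq] unfolding has_integral_alt'[of q] by auto
    obtain m where "real m \<ge> b" using real_arch_simple by blast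
    then have "ball 0 b \<subseteq> cbox (- real (Suc n)) (real (Suc n))" if "n \<ge> m" for n
      using that by (auto simp: dist_real_def)
    then show "\<exists>m. \<forall>n\<ge>m. norm (integral {- real (Suc n)..real (Suc n)} q - integral UNIV q) < e"
      using b(2) by (metis cbox_interval)
  qed
  have lim0: "(\<lambda>n. integral {- (1 / real (Suc n))..1 / real (Suc n)} q) \<longlonglongrightarrow> 0"
  proof (rule Lim_null_comparison)
    have "norm (integral {- (1 / real (Suc n))..1 / real (Suc n)} q) \<le> 2 * c * inverse (real (Suc n))" for n
    proof -
      define r where "r = 1 / real (Suc n)"
      have r: "0 \<le> r" "r \<le> 1" by (simp_all add: r_def)
      have "norm (integral (cbox (- r) r) q) \<le> c * measure lborel (cbox (- r) r)"
      proof (rule integrable_bound[OF c integrable_continuous[OF contq]])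
        fix t assume "t \<in> cbox (- r) r"
        then have "\<bar>t\<bar> \<le> 1" using r by auto
        then show "norm (q t) \<le> c" using bd1[of t] c by (metis mult.right_neutral mult_left_mono order_trans)
      qed
      also have "measure lborel (cbox (- r) r) = 2 * r" using r by simp
      finally show ?thesis by (simp add: r_def inverse_eq_divide mult_ac)
    qed
    then show "\<forall>\<^sub>F n in sequentially. norm (integral {- (1 / real (Suc n))..1 / real (Suc n)} q) \<le> 2 * c * inverse (real (Suc n))"
      by simp
    show "(\<lambda>n. 2 * c * inverse (real (Suc n))) \<longlonglongrightarrow> 0"
      using tendsto_mult_left[OF LIMSEQ_inverse_real_of_nat, of "2 * c"] by simp
  qed
  have "(\<lambda>n. integral {- real (Suc n)..real (Suc n)} q - integral {- (1 / real (Suc n))..1 / real (Suc n)} q)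
      \<longlonglongrightarrow> integral UNIV q"
    using tendsto_diff[OF lim lim0] by (simp only: diff_zero)
  moreover have "integral {- real (Suc n)..real (Suc n)} q - integral {- (1 / real (Suc n))..1 / real (Suc n)} q
      = trunc_integral n (\<lambda>t. p t + p (- t))" for n
  proof -
    define r where "r = real (Suc n)"
    have r: "r > 0" "1 / r \<le> r" "0 < 1 / r" by (simp_all add: r_def field_simps)
    have i: "q integrable_on {a..b}" for a b
      by (rule integrable_continuous_real[OF contq])
    have "integral {- r..r} q = integral {- r..- (1 / r)} q + integral {- (1 / r)..1 / r} q + integral {1 / r..r} q"
    proof -
      have "integral {- r..- (1 / r)} q + integral {- (1 / r)..r} q = integral {- r..r} q"
        "integral {- (1 / r)..1 / r} q + integral {1 / r..r} q = integral {- (1 / r)..r} q"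
        by (rule Henstock_Kurzweil_Integration.integral_combine[OF _ _ i]; use r in linarith)+
      then show ?thesis by (metis add.assoc)
    qed
    also have "integral {- r..- (1 / r)} q = integral {1 / r..r} (\<lambda>t. q (- t))"
      by (subst Henstock_Kurzweil_Integration.integral_reflect_real[symmetric]) simp
    finally have "integral {- r..r} q - integral {- (1 / r)..1 / r} q = integral {1 / r..r} (\<lambda>t. q (- t)) + integral {1 / r..r} q"
      by simp
    also have "\<dots> = integral {1 / r..r} (\<lambda>t. q t + q (- t))"
      by (subst integral_add[OF i])
        (auto intro!: integrable_continuous_real continuous_on_compose2[OF contq[of UNIV]] continuous_intros)
    also have "\<dots> = integral {1 / r..r} (\<lambda>t. p t + p (- t))"
      using r by (intro integral_cong) (auto simp: q_def)
    finally show ?thesis by (simp only: r_def)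
  qed
  ultimately show "(\<lambda>n. trunc_integral n (\<lambda>t. p t + p (- t))) \<longlonglongrightarrow> integral UNIV p"
    unfolding eq by simp
qed

section \<open>Clifford numbers and double sectors\<close>

lemma norm_axis_vec: "norm (axis i x :: 'a::real_normed_vector ^ 'n::finite) = norm x"
proof -
  have "(\<Sum>j\<in>UNIV. (norm ((axis i x :: 'a ^ 'n) $ j))\<^sup>2) = (norm x)\<^sup>2"
    by (simp add: axis_def if_distrib[of norm] if_distrib[of "\<lambda>x. x\<^sup>2"] cong: if_cong)
  then show ?thesis by (simp add: norm_vec_def L2_set_def)
qed

lemma bounded_bilinear_lmul:
  "bounded_bilinear (lmul :: 'n::{finite,linorder} clifford \<Rightarrow> ('v::real_normed_vector, 'n) cmodule \<Rightarrow> _)"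
proof
  fix a b :: "'n clifford" and v w :: "('v, 'n) cmodule" and r :: real
  show "(a + b) \<odot> v = a \<odot> v + b \<odot> v" "a \<odot> (v + w) = a \<odot> v + a \<odot> w"
    by (simp_all add: vec_eq_iff lmul_nth algebra_simps sum.distrib)
  show "(r *\<^sub>R a) \<odot> v = r *\<^sub>R (a \<odot> v)" "a \<odot> (r *\<^sub>R v) = r *\<^sub>R (a \<odot> v)"
    by (simp_all add: vec_eq_iff lmul_nth scaleR_sum_right mult_ac)
  have "norm (a \<odot> v) \<le> norm a * norm v * (real CARD('n set) * real CARD('n set))"
    for a :: "'n clifford" and v :: "('v, 'n) cmodule"
  proof -
    have "norm (a \<odot> v) \<le> (\<Sum>A\<in>(UNIV::'n set set). \<Sum>B\<in>(UNIV::'n set set). norm a * norm v)"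
      unfolding lmul_def
    proof (intro order_trans[OF norm_sum sum_mono] order_trans[OF norm_sum] sum_mono)
      fix A B :: "'n set"
      have "norm (axis (sym_diff A B) ((cl_sign A B * a $ A) *\<^sub>R v $ B) :: ('v, 'n) cmodule) = \<bar>a $ A\<bar> * norm (v $ B)"
        by (simp add: norm_axis_vec cl_sign_def abs_mult power_abs)
      also have "\<dots> \<le> norm a * norm v"
        using Finite_Cartesian_Product.norm_nth_le[of a A] Finite_Cartesian_Product.norm_nth_le[of v B] by (intro mult_mono) auto
      finally show "norm (axis (sym_diff A B) ((cl_sign A B * a $ A) *\<^sub>R v $ B) :: ('v, 'n) cmodule) \<le> norm a * norm v" .
    qed
    then show ?thesis by (simp add: mult_ac)
  qed
  then show "\<exists>K. \<forall>a v. norm (a \<odot> v :: ('v, 'n) cmodule) \<le> norm a * norm v * K" by blast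
qed

interpretation lmul: bounded_bilinear lmul
  by (rule bounded_bilinear_lmul)

text \<open>For a generator, right multiplication is a permutation of the coordinates up to signs,
  so its square and its boundedness can be checked coordinatewise. This is why a generator is taken
  as the imaginary unit.\<close>

lemma rmul_generator:
  "rmul v (axis {i} 1) $ C = cl_sign (sym_diff {i} C) {i} *\<^sub>R v $ sym_diff {i} C"
proof -
  have "rmul v (axis {i} 1) $ C = (\<Sum>B\<in>UNIV. if B = {i} then cl_sign (sym_diff {i} C) {i} *\<^sub>R v $ sym_diff {i} C else 0)"
    unfolding rmul_nth by (intro sum.cong refl) (auto simp: axis_def)
  then show ?thesis by simp
qed

lemma rmul_generator_twice: "rmul (rmul v (axis {i} 1)) (axis {i} 1) = - v"
proof -
  have s: "cl_sign {i} {i} = -1"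
  proof -
    have "{(i', j). i' \<in> {i} \<and> j \<in> {i} \<and> j \<le> i'} = {(i, i)}" by auto
    then show ?thesis by (simp add: cl_sign_def)
  qed
  have "cl_sign C {i} * cl_sign C {i} = 1" for C
    by (simp add: cl_sign_def flip: power_add mult_2)
  then have "rmul (rmul v (axis {i} 1)) (axis {i} 1) $ C = - v $ C" for C
    unfolding rmul_generator sym_diff_cancel by (simp add: cl_sign_sym_diff s algebra_simps)
  then show ?thesis by (simp add: vec_eq_iff)
qed

lemma bounded_linear_rmul_generator:
  "bounded_linear (\<lambda>v :: ('v::real_normed_vector, 'n::{finite,linorder}) cmodule. rmul v (axis {i} 1))"
proof
  fix v w :: "('v, 'n) cmodule" and r :: real
  show "rmul (v + w) (axis {i} 1) = rmul v (axis {i} 1) + rmul w (axis {i} 1)"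
    "rmul (r *\<^sub>R v) (axis {i} 1) = r *\<^sub>R rmul v (axis {i} 1)"
    by (simp_all add: vec_eq_iff rmul_generator algebra_simps)
  have "norm (rmul v (axis {i} 1)) \<le> norm v * real CARD('n set)" for v :: "('v, 'n) cmodule"
  proof -
    have "norm (rmul v (axis {i} 1)) \<le> (\<Sum>C\<in>UNIV. norm (rmul v (axis {i} 1) $ C))"
      unfolding norm_vec_def by (rule L2_set_le_sum) simp
    also have "\<dots> \<le> (\<Sum>C\<in>(UNIV::'n set set). norm v)"
      by (intro sum_mono) (simp add: rmul_generator cl_sign_def power_abs Finite_Cartesian_Product.norm_nth_le)
    finally show ?thesis by (simp add: mult_ac)
  qed
  then show "\<exists>K. \<forall>v :: ('v, 'n) cmodule. norm (rmul v (axis {i} 1)) \<le> norm v * K" by blast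
qed

lemma rmul_real_scalar: "rmul v (axis {} x) = x *\<^sub>R v"
  for v :: "('v::real_vector, 'n::{finite,linorder}) cmodule"
proof -
  have "rmul v (axis {} x) $ C = (\<Sum>B\<in>(UNIV::'n set set). if B = {} then x *\<^sub>R v $ C else 0)" for C
    unfolding rmul_nth by (intro sum.cong refl) (auto simp: axis_def cl_sign_def)
  then show ?thesis by (simp add: vec_eq_iff)
qed

lemma axis_linear [simp]:
  "axis i (x + y) = axis i x + axis i y" "axis i (x - y) = axis i x - axis i y"
  "axis i (- x) = - axis i (x :: 'a::real_vector)" "axis i (r *\<^sub>R x) = r *\<^sub>R axis i x"
  "axis i (0 :: 'a) = 0"
  by (simp_all add: axis_def vec_eq_iff)

lemma axis_mult: "axis i (r * x) = r *\<^sub>R axis i (x :: real)"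
  using axis_linear(4)[of i r x] by simp

lemma imag_sphere_nth:
  assumes "J \<in> imag_sphere" "\<nexists>i. A = {i}"
  shows "J $ A = 0"
proof (cases "A = {}")
  case False
  then have "card A \<noteq> 0" "card A \<noteq> 1"
    using assms(2) by (auto simp: card_1_singleton_iff)
  then have "card A \<ge> 2" by linarith
  then show ?thesis using assms by (simp add: imag_sphere_def paravectors_def)
qed (use assms in \<open>simp add: imag_sphere_def\<close>)

lemma sum_singletons:
  fixes g :: "'n::finite set \<Rightarrow> 'a::comm_monoid_add"
  assumes "\<And>A. \<nexists>i. A = {i} \<Longrightarrow> g A = 0"
  shows "(\<Sum>A\<in>UNIV. g A) = (\<Sum>i\<in>UNIV. g {i})"
proof -
  have "(\<Sum>i\<in>UNIV. g {i}) = (\<Sum>A\<in>range (\<lambda>i. {i}). g A)"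
    by (subst sum.reindex) (auto simp: inj_on_def)
  also have "\<dots> = (\<Sum>A\<in>UNIV. g A)"
    by (rule sum.mono_neutral_left) (use assms in auto)
  finally show ?thesis ..
qed

text \<open>Adding the double sum over generators to its transpose produces anticommutators, which
  vanish off the diagonal and equal -2 on it; what is left is the squared norm of
  \<open>J\<close>.\<close>

lemma imag_sphere_square:
  fixes J :: "'n::{finite,linorder} clifford"
  assumes "J \<in> imag_sphere"
  shows "J \<odot> J = - axis {} 1"
proof -
  define c where "c i = J $ {i}" for i
  define e where "e i = (axis {i} 1 :: 'n clifford)" for i
  have J: "J = (\<Sum>i\<in>UNIV. c i *\<^sub>R e i)"
  proof -
    have "J = (\<Sum>A\<in>UNIV. axis A (J $ A))"
      by (simp add: vec_eq_iff axis_def if_distrib cong: if_cong)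
    also have "\<dots> = (\<Sum>i\<in>UNIV. axis {i} (c i))"
      unfolding c_def by (rule sum_singletons) (simp add: imag_sphere_nth[OF assms])
    finally show ?thesis
      by (simp add: e_def flip: axis_linear(4))
  qed
  have "1 = (norm J)\<^sup>2" using assms by (simp add: imag_sphere_def)
  also have "\<dots> = (\<Sum>A\<in>UNIV. (J $ A)\<^sup>2)"
    by (simp add: norm_vec_def L2_set_def sum_nonneg)
  also have "\<dots> = (\<Sum>i\<in>UNIV. (c i)\<^sup>2)"
    unfolding c_def by (rule sum_singletons) (simp add: imag_sphere_nth[OF assms])
  finally have n: "(\<Sum>i\<in>UNIV. (c i)\<^sup>2) = 1" ..
  have JJ: "J \<odot> J = (\<Sum>i\<in>UNIV. \<Sum>j\<in>UNIV. (c i * c j) *\<^sub>R (e i \<odot> e j))"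
    unfolding J by (simp add: lmul.sum_left lmul.sum_right lmul.scaleR_left lmul.scaleR_right scaleR_sum_right)
      (rule sum.swap[THEN trans], simp add: mult.commute)
  also have "\<dots> = (\<Sum>i\<in>UNIV. \<Sum>j\<in>UNIV. (c i * c j) *\<^sub>R (e j \<odot> e i))"
    by (subst sum.swap) (simp add: mult.commute)
  finally have "J \<odot> J + J \<odot> J = (\<Sum>i\<in>UNIV. \<Sum>j\<in>UNIV. (c i * c j) *\<^sub>R (e i \<odot> e j + e j \<odot> e i))"
    using JJ by (simp add: sum.distrib scaleR_add_right)
  also have "\<dots> = (\<Sum>i\<in>UNIV. \<Sum>j\<in>UNIV. if j = i then - (2 * (c i)\<^sup>2) *\<^sub>R axis {} 1 else 0)"
  proof (intro sum.cong refl)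
    fix i j
    show "(c i * c j) *\<^sub>R (e i \<odot> e j + e j \<odot> e i) = (if j = i then - (2 * (c i)\<^sup>2) *\<^sub>R axis {} 1 else 0)"
      using generator_relations(1)[of i] generator_relations(2)[of i j]
      by (auto simp: e_def power2_eq_square scaleR_2[symmetric] simp flip: scaleR_2)
  qed
  also have "\<dots> = - (2 * (\<Sum>i\<in>UNIV. (c i)\<^sup>2)) *\<^sub>R axis {} 1"
    by (simp add: scaleR_sum_left sum_negf sum_distrib_left)
  finally have "2 *\<^sub>R (J \<odot> J) = 2 *\<^sub>R (- axis {} 1)"
    unfolding n by (simp add: scaleR_2)
  then show ?thesis by (simp only: scaleR_cancel_left) simp
qed

lemma generator_imag_sphere: "(axis {i} 1 :: 'n::finite clifford) \<in> imag_sphere"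
  unfolding imag_sphere_def paravectors_def by (auto simp: norm_axis_vec) (auto simp: axis_def)

lemma imag_sphere_square_action:
  "J \<in> imag_sphere \<Longrightarrow> J \<odot> J \<odot> v = - v"
  for v :: "('v::real_normed_vector, 'n::{finite,linorder}) cmodule"
  unfolding lmul_assoc[symmetric] by (simp add: imag_sphere_square lmul.minus_left lmul_scalar)

text \<open>The parametrization of \<open>\<complex>\<^sub>J\<close> by the type of complex numbers.\<close>

definition cslice :: "'n::finite clifford \<Rightarrow> complex \<Rightarrow> 'n clifford" where
  "cslice J z = slice J (Re z) (Im z)"

lemma cslice_lmul: "cslice J z \<odot> v = Re z *\<^sub>R v + Im z *\<^sub>R (J \<odot> v)"
  for v :: "('v::real_normed_vector, 'n::{finite,linorder}) cmodule"
  by (simp add: cslice_def slice_def lmul.add_left lmul_scalar lmul.scaleR_left)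

lemma cslice_mult_action: "J \<in> imag_sphere \<Longrightarrow> cslice J z \<odot> cslice J w \<odot> v = cslice J (z * w) \<odot> v"
  for v :: "('v::real_normed_vector, 'n::{finite,linorder}) cmodule"
  by (simp add: cslice_lmul lmul.add_right lmul.scaleR_right imag_sphere_square_action algebra_simps)

lemma lmul_one_right: "a \<odot> axis {} 1 = (a :: 'n::{finite,linorder} clifford)"
  by (metis rmul_real rmul_real_scalar scaleR_one)

lemma cslice_mult: "J \<in> imag_sphere \<Longrightarrow> cslice J z \<odot> cslice J w = cslice J (z * w)"
  for J :: "'n::{finite,linorder} clifford"
  using cslice_mult_action[of J z w "axis {} 1 :: 'n clifford"] by (simp only: lmul_one_right)

lemma cslice_add: "cslice J (z + w) = cslice J z + cslice J w"
  and cslice_diff: "cslice J (z - w) = cslice J z - cslice J w"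
  and cslice_of_real: "cslice J (of_real x) = axis {} x"
  and cslice_scaleR: "cslice J (r *\<^sub>R z) = r *\<^sub>R cslice J z"
  by (simp_all add: cslice_def slice_def axis_mult algebra_simps)

lemma slice_nth_empty: "J \<in> imag_sphere \<Longrightarrow> slice J x y $ {} = x"
  by (simp add: slice_def imag_sphere_def axis_def)

lemma slice_paravector: "J \<in> imag_sphere \<Longrightarrow> slice J x y \<in> paravectors"
  by (auto simp: slice_def imag_sphere_def axis_def paravectors_def)

lemma norm_slice: "J \<in> imag_sphere \<Longrightarrow> norm (slice J x y) = sqrt (x\<^sup>2 + y\<^sup>2)"
proof -
  assume J: "J \<in> imag_sphere"
  have "J \<bullet> J = (norm J)\<^sup>2" by (rule power2_norm_eq_inner[symmetric])
  with J have JJ: "J \<bullet> J = 1" by (simp add: imag_sphere_def)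
  from J have "axis {} x \<bullet> J = 0"
    by (simp add: imag_sphere_def inner_axis')
  with JJ have "slice J x y \<bullet> slice J x y = x\<^sup>2 + y\<^sup>2"
    unfolding slice_def inner_add_left inner_add_right inner_scaleR_left inner_scaleR_right inner_axis_axis
      inner_commute[of J "axis {} x"] by (simp add: power2_eq_square)
  then show ?thesis by (simp add: norm_eq_sqrt_inner)
qed

lemma norm_cslice: "J \<in> imag_sphere \<Longrightarrow> norm (cslice J z) = cmod z"
  by (simp add: cslice_def norm_slice cmod_def)

lemma pv_conj_slice: "J \<in> imag_sphere \<Longrightarrow> pv_conj (slice J x y) = slice J x (- y)"
  by (auto simp: pv_conj_def slice_def vec_eq_iff axis_def imag_sphere_def)

lemma pv_conj_cslice: "J \<in> imag_sphere \<Longrightarrow> pv_conj (cslice J z) = cslice J (cnj z)"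
  by (simp add: cslice_def pv_conj_slice)

lemma pv_inverse_cslice: "J \<in> imag_sphere \<Longrightarrow> pv_inverse (cslice J z) = cslice J (1 / z)"
proof -
  assume J: "J \<in> imag_sphere"
  have "1 / z = (1 / (cmod z)\<^sup>2) *\<^sub>R cnj z"
    by (subst complex_div_cnj) (simp add: scaleR_conv_of_real)
  then show ?thesis
    by (simp only: pv_inverse_def pv_conj_cslice[OF J] norm_cslice[OF J] cslice_scaleR)
qed

section \<open>Double sectors in paravectors and in the complex plane\<close>

lemma expi_cslice: "expi J \<phi> = cslice J (cis \<phi>)"
  by (simp add: expi_def cslice_def)

text \<open>The polar form of a point may use a unit \<open>K\<close> other than \<open>J\<close>,
  for instance \<open>- J\<close>, or any unit for a real point. The forward direction therefore
  compares only scalar part and norm, neither of which involves the unit.\<close>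

lemma dsector_slice:
  assumes J: "J \<in> imag_sphere" and \<omega>: "0 < \<omega>" "\<omega> < pi / 2"
  shows "slice J x y \<in> dsector \<omega> \<longleftrightarrow> x \<noteq> 0 \<and> \<bar>y\<bar> < \<bar>x\<bar> * tan \<omega>"
proof
  assume "slice J x y \<in> dsector \<omega>"
  then obtain r K \<phi> where r: "r > 0" and K: "K \<in> imag_sphere" and \<phi>: "\<phi> \<in> angles \<omega>"
    and eq: "slice J x y = r *\<^sub>R expi K \<phi>"
    by (auto simp: dsector_def)
  have eq: "slice J x y = slice K (r * cos \<phi>) (r * sin \<phi>)"
    unfolding eq by (simp add: expi_def slice_def axis_mult scaleR_add_right)
  then have x: "x = r * cos \<phi>"
    using slice_nth_empty[OF J, of x y] slice_nth_empty[OF K, of "r * cos \<phi>" "r * sin \<phi>"] by simp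
  have "sqrt (x\<^sup>2 + y\<^sup>2) = sqrt ((r * cos \<phi>)\<^sup>2 + (r * sin \<phi>)\<^sup>2)"
    using norm_slice[OF J, of x y] norm_slice[OF K, of "r * cos \<phi>" "r * sin \<phi>"] eq by simp
  then have "y\<^sup>2 = (r * sin \<phi>)\<^sup>2"
    by (simp add: x)
  then have y: "\<bar>y\<bar> = r * \<bar>sin \<phi>\<bar>"
    using r by (metis abs_mult abs_of_pos power2_eq_iff abs_minus_cancel)
  have c: "cos \<omega> > 0" "sin \<omega> > 0" using \<omega> by (auto intro!: cos_gt_zero sin_gt_zero)
  have *: "cos a > 0 \<and> \<bar>sin a\<bar> * cos \<omega> < cos a * sin \<omega>" if "\<bar>a\<bar> < \<omega>" for a
  proof
    show "cos a > 0" using that \<omega> by (intro cos_gt_zero_pi) auto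
    have "sin (\<omega> - a) > 0" "sin (\<omega> + a) > 0" using that \<omega> by (auto intro!: sin_gt_zero)
    then show "\<bar>sin a\<bar> * cos \<omega> < cos a * sin \<omega>"
      by (auto simp: sin_diff sin_add abs_if algebra_simps)
  qed
  have "cos \<phi> \<noteq> 0 \<and> \<bar>sin \<phi>\<bar> * cos \<omega> < \<bar>cos \<phi>\<bar> * sin \<omega>"
  proof (cases "\<bar>\<phi>\<bar> < \<omega>")
    case True
    then show ?thesis using *[OF True] by simp
  next
    case False
    then have "\<bar>\<phi> - pi\<bar> < \<omega>" using \<phi> by (auto simp: angles_def)
    from *[OF this] show ?thesis by simp
  qed
  then have "cos \<phi> \<noteq> 0" "\<bar>sin \<phi>\<bar> < \<bar>cos \<phi>\<bar> * tan \<omega>"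
    using c by (auto simp: tan_def field_simps)
  then show "x \<noteq> 0 \<and> \<bar>y\<bar> < \<bar>x\<bar> * tan \<omega>"
    using r unfolding y x by (auto simp: abs_mult mult.assoc)
next
  assume xy: "x \<noteq> 0 \<and> \<bar>y\<bar> < \<bar>x\<bar> * tan \<omega>"
  define u where "u = y / x"
  \<comment> \<open>The polar angle is the arctangent of the slope, shifted by \<open>pi\<close>
    when \<open>x\<close> is negative.\<close>
  define \<alpha> where "\<alpha> = arctan u"
  have y: "y = x * u" using xy by (simp add: u_def)
  have "\<bar>u\<bar> < tan \<omega>"
    using xy by (simp add: u_def abs_div field_simps)
  then have "arctan u < arctan (tan \<omega>)" "arctan (- u) < arctan (tan \<omega>)"
    by (auto simp: arctan_less_iff)
  then have a: "\<bar>\<alpha>\<bar> < \<omega>"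
    using \<omega> by (simp add: \<alpha>_def arctan_minus arctan_tan)
  define q where "q = sqrt (1 + u\<^sup>2)"
  have q: "q > 0" by (simp add: q_def add_pos_nonneg)
  have cs: "cos \<alpha> = 1 / q" "sin \<alpha> = u / q"
    by (simp_all add: \<alpha>_def q_def cos_arctan sin_arctan)
  show "slice J x y \<in> dsector \<omega>"
  proof (cases "x > 0")
    case True
    have "slice J x y = (x * q) *\<^sub>R expi J \<alpha>"
      using q by (simp add: expi_def slice_def scaleR_add_right axis_mult[symmetric] cs y)
    moreover have "\<alpha> \<in> angles \<omega>" using a by (auto simp: angles_def)
    ultimately show ?thesis
      unfolding dsector_def using J True q by (intro CollectI exI[of _ "x * q"] exI[of _ J] exI[of _ \<alpha>]) simp
  next
    case False
    have "slice J x y = (- x * q) *\<^sub>R expi J (pi + \<alpha>)"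
      using q by (simp add: expi_def slice_def scaleR_diff_right axis_mult[symmetric] cs y)
    moreover have "pi + \<alpha> \<in> angles \<omega>" using a by (auto simp: angles_def)
    moreover have "- x * q > 0" using False xy q by (intro mult_pos_pos) auto
    ultimately show ?thesis
      unfolding dsector_def using J by (intro CollectI exI[of _ "- x * q"] exI[of _ J] exI[of _ "pi + \<alpha>"]) simp
  qed
qed

lemma cslice_nth_empty: "J \<in> imag_sphere \<Longrightarrow> cslice J z $ {} = Re z"
  by (simp add: cslice_def slice_nth_empty)

definition plane_sector :: "real \<Rightarrow> complex set" where
  "plane_sector \<theta> = {z. Re z \<noteq> 0 \<and> \<bar>Im z\<bar> < \<bar>Re z\<bar> * tan \<theta>}"

lemma dsector_cslice:
  "J \<in> imag_sphere \<Longrightarrow> 0 < \<theta> \<Longrightarrow> \<theta> < pi / 2 \<Longrightarrow> cslice J z \<in> dsector \<theta> \<longleftrightarrow> z \<in> plane_sector \<theta>"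
  by (simp add: cslice_def dsector_slice plane_sector_def)

lemma dsectorE:
  assumes "s \<in> dsector \<theta>" "0 < \<theta>" "\<theta> < pi / 2"
  obtains J z where "J \<in> imag_sphere" "z \<in> plane_sector \<theta>" "s = cslice J z"
proof -
  obtain r J \<phi> where r: "r > 0" and J: "J \<in> imag_sphere" and eq: "s = r *\<^sub>R expi J \<phi>"
    using assms(1) by (auto simp: dsector_def)
  then have "s = cslice J (r *\<^sub>R cis \<phi>)" by (simp add: expi_cslice cslice_scaleR)
  then show ?thesis using that[OF J] assms dsector_cslice[OF J assms(2,3)] by metis
qed

lemma dcone_not_dsector:
  assumes "z \<in> dcone \<phi>" "J \<in> imag_sphere" "0 < \<phi>" "\<phi> < pi / 2"
  shows "cslice J z \<in> paravectors - (dsector \<phi> \<union> {0})"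
proof -
  have "cslice J z \<noteq> 0" using norm_cslice[OF assms(2), of z] dcone_nonzero[OF assms(1)] by auto
  then show ?thesis
    using assms by (auto simp: dsector_cslice plane_sector_def dcone_def)
      (simp add: cslice_def slice_paravector)
qed

text \<open>The double cone of slope at most \<open>tan \<omega>\<close> is closed and contains the
  sector, while points of \<open>dcone \<phi>\<close> have slope at least
  \<open>tan \<phi> > tan \<omega>\<close>. With the spectral inclusion in
  \<open>bisectorial\<close>, this places \<open>dcone \<phi>\<close> in the S-resolvent
  set.\<close>

lemma dcone_not_closure_dsector:
  assumes z: "z \<in> dcone \<phi>" and J: "J \<in> imag_sphere" and \<omega>: "0 < \<omega>" "\<omega> < \<phi>" "\<phi> < pi / 2"
  shows "cslice J z \<notin> closure (dsector \<omega>)"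
proof -
  have "closed {s :: 'a clifford. norm (s - axis {} (s $ {})) \<le> \<bar>s $ {}\<bar> * tan \<omega>}"
    unfolding axis_mult[of _ "_ $ {}" 1, simplified]
    by (intro closed_Collect_le continuous_intros)
  moreover have "dsector \<omega> \<subseteq> {s :: 'a clifford. norm (s - axis {} (s $ {})) \<le> \<bar>s $ {}\<bar> * tan \<omega>}"
  proof
    fix s :: "'a clifford" assume "s \<in> dsector \<omega>"
    then obtain K w where K: "K \<in> imag_sphere" "w \<in> plane_sector \<omega>" "s = cslice K w"
      using \<omega> by (auto elim!: dsectorE[of s \<omega>])
    then show "s \<in> {s. norm (s - axis {} (s $ {})) \<le> \<bar>s $ {}\<bar> * tan \<omega>}"
      by (simp add: plane_sector_def cslice_def slice_nth_empty) (simp add: slice_def imag_sphere_def)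
  qed
  ultimately have "closure (dsector \<omega>) \<subseteq> {s :: 'a clifford. norm (s - axis {} (s $ {})) \<le> \<bar>s $ {}\<bar> * tan \<omega>}"
    by (rule closure_minimal[rotated])
  moreover have "\<not> \<bar>Im z\<bar> \<le> \<bar>Re z\<bar> * tan \<omega>"
  proof (cases "Re z = 0")
    case True
    then show ?thesis using dcone_nonzero[OF z] by (auto simp: complex_eq_iff)
  next
    case False
    have "tan \<omega> < tan \<phi>" using \<omega> by (intro tan_monotone) auto
    then have "\<bar>Re z\<bar> * tan \<omega> < \<bar>Re z\<bar> * tan \<phi>" using False by simp
    then show ?thesis using z by (simp add: dcone_def)
  qed
  moreover have "norm (cslice J z - axis {} (cslice J z $ {})) = \<bar>Im z\<bar>" "cslice J z $ {} = Re z"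
    using J by (simp_all add: cslice_def slice_nth_empty) (simp add: slice_def imag_sphere_def)
  ultimately show ?thesis by (metis (no_types, lifting) in_mono mem_Collect_eq)
qed

lemma bounded_inverse_eq:
  assumes "is_bounded_inverse A R"
  shows "bounded_inverse A = R"
  unfolding bounded_inverse_def
proof (rule the_equality)
  fix R' assume R': "is_bounded_inverse A R'"
  have "blinfun_apply R' w = blinfun_apply R w" for w
    using assms R' unfolding is_bounded_inverse_def by metis
  then show "R' = R" by (rule blinfun_eqI)
qed fact

section \<open>The complex resolvent of a bisectorial operator\<close>

locale bisectorial_operator =
  fixes T :: "('v::banach, 'n::{finite,linorder}) op" and \<omega> \<phi> :: real
  assumes T: "T \<in> closed_ops" and bis: "bisectorial \<omega> T"
    and omega: "0 < \<omega>" "\<omega> < \<phi>" and phi: "0 < \<phi>" "\<phi> < pi / 2"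
begin

text \<open>Any generator serves; \<open>undefined\<close> just names some index.\<close>

definition unit :: "'n clifford" where "unit = axis {undefined} 1"

lemma unit: "unit \<in> imag_sphere"
  by (simp add: unit_def generator_imag_sphere)

lemma T_add: "T v = Some x \<Longrightarrow> T w = Some y \<Longrightarrow> T (v + w) = Some (x + y)"
  and T_rmul: "T v = Some x \<Longrightarrow> T (rmul v a) = Some (rmul x a)"
  using T by (auto simp: closed_ops_def)

lemma T_scaleR: "T v = Some x \<Longrightarrow> T (r *\<^sub>R v) = Some (r *\<^sub>R x)"
  using T_rmul[of v x "axis {} r"] by (simp add: rmul_real_scalar)

lemma T_diff: "T v = Some x \<Longrightarrow> T w = Some y \<Longrightarrow> T (v - w) = Some (x - y)"
  using T_add[of v x "(-1) *\<^sub>R w" "(-1) *\<^sub>R y"] T_scaleR[of w y "-1"] by simp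

lemma T_zero: "T 0 = Some 0"
proof -
  obtain x where "T 0 = Some x" using T by (auto simp: closed_ops_def)
  from T_scaleR[OF this, of 0] show ?thesis by simp
qed

definition cs :: "complex \<Rightarrow> ('v, 'n) cmodule \<Rightarrow> ('v, 'n) cmodule" where
  "cs z v = Re z *\<^sub>R v + Im z *\<^sub>R rmul v unit"

lemma rmul_unit_linear: "linear (\<lambda>v :: ('v, 'n) cmodule. rmul v unit)"
  unfolding unit_def by (rule bounded_linear.linear[OF bounded_linear_rmul_generator])

lemma rmul_unit_twice: "rmul (rmul v unit) unit = - v" for v :: "('v, 'n) cmodule"
  unfolding unit_def by (rule rmul_generator_twice)

lemmas rmul_unit_simps = linear_add[OF rmul_unit_linear] linear_diff[OF rmul_unit_linear]
  linear_scale[OF rmul_unit_linear] linear_neg[OF rmul_unit_linear] linear_0[OF rmul_unit_linear]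
  rmul_unit_twice

lemma cs_simps: "cs z (v + w) = cs z v + cs z w" "cs z (v - w) = cs z v - cs z w"
  "cs z (cs z' v) = cs (z * z') v" "cs (z + z') v = cs z v + cs z' v" "cs (z - z') v = cs z v - cs z' v"
  "cs (- z) v = - cs z v" "cs (of_real r) v = r *\<^sub>R v" "cs z (r *\<^sub>R v) = r *\<^sub>R cs z v"
  by (simp_all add: cs_def rmul_unit_simps algebra_simps)

lemma T_cs: "T v = Some x \<Longrightarrow> T (cs z v) = Some (cs z x)"
  unfolding cs_def by (intro T_add T_scaleR T_rmul)

text \<open>\<open>Qi z\<close> is \<open>Q\<^sub>s[T]\<^sup>-\<^sup>1\<close> for \<open>s = x + J y\<close>, \<open>z = x + i y\<close>; it does not depend on \<open>J\<close>.\<close>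

definition Qi :: "complex \<Rightarrow> ('v, 'n) cmodule \<Rightarrow>\<^sub>L ('v, 'n) cmodule" where
  "Qi z = bounded_inverse (Q_op (cslice unit z) T)"

lemma Q_op_cslice: "J \<in> imag_sphere \<Longrightarrow> Q_op (cslice J z) T = Q_op (cslice unit z) T"
  unfolding Q_op_def by (simp only: norm_cslice cslice_nth_empty unit cong: if_cong)

lemma Qi_cnj: "Qi (cnj z) = Qi z"
  unfolding Qi_def Q_op_def by (simp only: norm_cslice cslice_nth_empty unit complex_mod_cnj cnj.simps cong: if_cong)

lemma is_inverse_Qi:
  assumes z: "z \<in> dcone \<phi>"
  shows "is_bounded_inverse (Q_op (cslice unit z) T) (Qi z)"
proof -
  have "cslice unit z \<in> paravectors" using dcone_not_dsector[OF z unit phi] by blast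
  then have "cslice unit z \<in> S_resolvent_set T"
    using bis dcone_not_closure_dsector[OF z unit omega phi(2)]
    by (auto simp: bisectorial_def S_spectrum_def)
  then obtain R where "is_bounded_inverse (Q_op (cslice unit z) T) R"
    by (auto simp: S_resolvent_set_def)
  then show ?thesis by (simp add: Qi_def bounded_inverse_eq)
qed

lemma Q_op_eq:
  "Q_op (cslice unit z) T v = Some w \<longleftrightarrow>
    (\<exists>x y. T v = Some x \<and> T x = Some y \<and> w = y - (2 * Re z) *\<^sub>R x + (cmod z)\<^sup>2 *\<^sub>R v)"
  unfolding Q_op_def by (auto simp: norm_cslice unit map_comp_Some_iff dom_def split: if_splits)
    (auto simp: cslice_def slice_nth_empty unit map_comp_Some_iff dom_def)

lemma Qi_inverse_left:
  assumes "z \<in> dcone \<phi>" "T v = Some x" "T x = Some y"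
  shows "Qi z (y - (2 * Re z) *\<^sub>R x + (cmod z)\<^sup>2 *\<^sub>R v) = v"
  using is_inverse_Qi[OF assms(1)] assms(2,3) Q_op_eq unfolding is_bounded_inverse_def by metis

text \<open>For \<open>z\<close> in \<open>dcone \<phi>\<close> the range of \<open>Qi z\<close>
  lies in the domain of \<open>T^2\<close>, so \<open>the\<close> never meets \<open>None\<close>
  there.\<close>

definition TQi :: "complex \<Rightarrow> ('v, 'n) cmodule \<Rightarrow> ('v, 'n) cmodule" where
  "TQi z v = the (T (Qi z v))"

lemma T_Qi:
  assumes "z \<in> dcone \<phi>"
  shows "T (Qi z v) = Some (TQi z v)"
    and "T (TQi z v) = Some (v + (2 * Re z) *\<^sub>R TQi z v - (cmod z)\<^sup>2 *\<^sub>R Qi z v)"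
proof -
  have "Q_op (cslice unit z) T (Qi z v) = Some v"
    using is_inverse_Qi[OF assms] by (simp add: is_bounded_inverse_def)
  then obtain x y where xy: "T (Qi z v) = Some x" "T x = Some y"
    "v = y - (2 * Re z) *\<^sub>R x + (cmod z)\<^sup>2 *\<^sub>R Qi z v"
    unfolding Q_op_eq by auto
  then have x: "TQi z v = x" by (simp add: TQi_def)
  show "T (Qi z v) = Some (TQi z v)" using xy x by simp
  have "y = v + (2 * Re z) *\<^sub>R x - (cmod z)\<^sup>2 *\<^sub>R Qi z v"
    by (subst xy(3)) simp
  then show "T (TQi z v) = Some (v + (2 * Re z) *\<^sub>R TQi z v - (cmod z)\<^sup>2 *\<^sub>R Qi z v)"
    using xy x by simp
qed

text \<open>For \<open>v\<close> in the domain of \<open>T\<close>, the vector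
  \<open>TQi z v\<close> lies in the domain of \<open>T^2\<close> and solves the equation whose
  solution is \<open>Qi z x\<close>.\<close>

lemma Qi_commute_T:
  assumes z: "z \<in> dcone \<phi>" and v: "T v = Some x"
  shows "Qi z x = TQi z v"
proof -
  let ?y = "v + (2 * Re z) *\<^sub>R TQi z v - (cmod z)\<^sup>2 *\<^sub>R Qi z v"
  have "T ?y = Some (x + (2 * Re z) *\<^sub>R ?y - (cmod z)\<^sup>2 *\<^sub>R TQi z v)"
    by (intro T_diff T_add T_scaleR v T_Qi z)
  from Qi_inverse_left[OF z T_Qi(2)[OF z] this] show ?thesis by simp
qed

lemma Qi_rmul: "z \<in> dcone \<phi> \<Longrightarrow> Qi z (rmul v a) = rmul (Qi z v) a"
  using is_inverse_Qi[of z] by (simp add: is_bounded_inverse_def bounded_ops_def)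

lemma Qi_cs: "z \<in> dcone \<phi> \<Longrightarrow> Qi z (cs w v) = cs w (Qi z v)"
  by (simp add: cs_def blinfun.bilinear_simps Qi_rmul)

lemma TQi_simps:
  assumes z: "z \<in> dcone \<phi>"
  shows "TQi z (v + w) = TQi z v + TQi z w" "TQi z (v - w) = TQi z v - TQi z w"
    "TQi z (r *\<^sub>R v) = r *\<^sub>R TQi z v" "TQi z (cs c v) = cs c (TQi z v)"
  using T_add[OF T_Qi(1) T_Qi(1), OF z z] T_diff[OF T_Qi(1) T_Qi(1), OF z z] T_scaleR[OF T_Qi(1), OF z]
    T_cs[OF T_Qi(1), OF z]
  by (simp_all add: TQi_def[of z "_ + _"] TQi_def[of z "_ - _"] TQi_def[of z "_ *\<^sub>R _"] TQi_def[of z "cs _ _"]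
      blinfun.bilinear_simps Qi_cs z)

text \<open>\<open>Rf z = (z - T)\<^sup>-\<^sup>1\<close>, with \<open>z\<close> acting by right multiplication.\<close>

definition Rf :: "complex \<Rightarrow> ('v, 'n) cmodule \<Rightarrow> ('v, 'n) cmodule" where
  "Rf z v = cs (cnj z) (Qi z v) - TQi z v"

text \<open>With scalars acting from the right, \<open>Q = (z - T) (cnj z - T)\<close>, so
  \<open>(cnj z - T) Q^-1\<close> is a right inverse of \<open>z - T\<close>.\<close>

lemma Rf_right:
  assumes z: "z \<in> dcone \<phi>"
  shows "T (Rf z v) = Some (cs z (Rf z v) - v)"
proof -
  have "T (Rf z v) = Some (cs (cnj z) (TQi z v) - (v + (2 * Re z) *\<^sub>R TQi z v - (cmod z)\<^sup>2 *\<^sub>R Qi z v))"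
    unfolding Rf_def by (intro T_diff T_cs T_Qi z)
  also have "cs (cnj z) (TQi z v) - (v + (2 * Re z) *\<^sub>R TQi z v - (cmod z)\<^sup>2 *\<^sub>R Qi z v) = cs z (Rf z v) - v"
  proof -
    have 1: "(2 * Re z) *\<^sub>R w = cs z w + cs (cnj z) w" for w
      by (simp add: cs_def scaleR_2[symmetric] flip: scaleR_add_left)
    have 2: "(cmod z)\<^sup>2 *\<^sub>R w = cs z (cs (cnj z) w)" for w
      by (simp add: cs_simps complex_norm_square[symmetric] flip: of_real_power)
    show ?thesis unfolding 1 2 Rf_def by (simp add: cs_simps)
  qed
  finally show ?thesis .
qed

text \<open>The same factorization gives a left inverse once \<open>T\<close> has been moved past
  \<open>Q^-1\<close> by \<open>Qi_commute_T\<close>.\<close>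

lemma Rf_left:
  assumes z: "z \<in> dcone \<phi>" and v: "T v = Some x"
  shows "Rf z (cs z v - x) = v"
proof -
  have Qx: "Qi z x = TQi z v" by (rule Qi_commute_T[OF z v])
  have "TQi z x = v + (2 * Re z) *\<^sub>R TQi z v - (cmod z)\<^sup>2 *\<^sub>R Qi z v"
    using T_Qi(2)[OF z, of v] by (simp add: TQi_def[of z x] Qx)
  moreover have 1: "(2 * Re z) *\<^sub>R w = cs z w + cs (cnj z) w" for w
    by (simp add: cs_def scaleR_2[symmetric] flip: scaleR_add_left)
  moreover have 2: "(cmod z)\<^sup>2 *\<^sub>R w = cs (cnj z) (cs z w)" for w
    by (simp add: cs_simps complex_norm_square[symmetric] mult.commute[of "cnj z"] flip: of_real_power)
  ultimately show ?thesis
    by (simp add: Rf_def blinfun.bilinear_simps Qi_cs TQi_simps z Qx cs_simps(2))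
qed

lemma SL_inv_cslice:
  "J \<in> imag_sphere \<Longrightarrow> SL_inv (cslice J z) T v = Qi z (cslice J (cnj z) \<odot> v) - TQi z v"
  by (simp add: SL_inv_def Q_op_cslice pv_conj_cslice Qi_def TQi_def Let_def)

end

section \<open>From the bound on the S-resolvent to bounds on the complex resolvent\<close>

lemma lmul_norm_bound:
  obtains K where "K > 0"
    "\<And>(a :: 'n::{finite,linorder} clifford) (v :: ('v::real_normed_vector, 'n) cmodule). norm (a \<odot> v) \<le> norm a * norm v * K"
  using bounded_bilinear.pos_bounded[OF bounded_bilinear_lmul] by blast

lemma dcone_Im_bound:
  assumes "z \<in> dcone \<phi>" "0 < \<phi>" "\<phi> < pi / 2"
  shows "cmod z * sin \<phi> \<le> \<bar>Im z\<bar>"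
proof (rule power2_le_imp_le)
  have c: "cos \<phi> > 0" "sin \<phi> > 0" using assms by (auto intro!: cos_gt_zero sin_gt_zero)
  then have "\<bar>Re z\<bar> * sin \<phi> \<le> \<bar>Im z\<bar> * cos \<phi>"
    using assms(1) by (simp add: dcone_def tan_def field_simps)
  then have "(\<bar>Re z\<bar> * sin \<phi>)\<^sup>2 \<le> (\<bar>Im z\<bar> * cos \<phi>)\<^sup>2"
    using c by (intro power_mono) auto
  moreover have "(Im z)\<^sup>2 * (cos \<phi>)\<^sup>2 = (Im z)\<^sup>2 - (Im z)\<^sup>2 * (sin \<phi>)\<^sup>2"
    by (simp add: cos_squared_eq algebra_simps)
  ultimately show "(cmod z * sin \<phi>)\<^sup>2 \<le> \<bar>Im z\<bar>\<^sup>2"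
    by (simp add: power_mult_distrib cmod_power2 distrib_right)
qed simp

lemma dcone_Im_nonzero:
  assumes "z \<in> dcone \<phi>" "0 < \<phi>" "\<phi> < pi / 2"
  shows "Im z \<noteq> 0"
proof -
  have "0 < cmod z * sin \<phi>"
    using assms dcone_nonzero[OF assms(1)] by (intro mult_pos_pos sin_gt_zero) auto
  then show ?thesis using dcone_Im_bound[OF assms] by auto
qed

context bisectorial_operator begin

lemma TQi_cnj: "TQi (cnj z) = TQi z"
  by (simp add: TQi_def fun_eq_iff Qi_cnj)

text \<open>In the sum over \<open>s\<close> and its conjugate only real combinations of \<open>Q\<^sub>s[T]\<^sup>-\<^sup>1\<close> and \<open>T Q\<^sub>s[T]\<^sup>-\<^sup>1\<close>
  remain, so left scalars may be replaced by right scalars.\<close>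

lemma SL_inv_pair:
  assumes z: "z \<in> dcone \<phi>" and J: "J \<in> imag_sphere"
  shows "SL_inv (cslice J z) T (cslice J c \<odot> v) + SL_inv (cslice J (cnj z)) T (cslice J (cnj c) \<odot> v)
    = cs c (Rf z v) + cs (cnj c) (Rf (cnj z) v)"
proof -
  have r: "w + cnj w = of_real (2 * Re w)" for w by (simp add: complex_eq_iff)
  have r2: "z * cnj c = cnj (cnj z * c)" "cnj c * z = cnj (cnj z * c)" "c * cnj z = cnj z * c" by simp_all
  have "SL_inv (cslice J z) T (cslice J c \<odot> v) + SL_inv (cslice J (cnj z)) T (cslice J (cnj c) \<odot> v)
      = Qi z (cslice J (cnj z * c) \<odot> v + cslice J (cnj (cnj z * c)) \<odot> v)
        - TQi z (cslice J c \<odot> v + cslice J (cnj c) \<odot> v)"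
    using z by (simp add: SL_inv_cslice J Qi_cnj TQi_cnj cslice_mult_action TQi_simps blinfun.add_right)
  also have "\<dots> = (2 * Re (cnj z * c)) *\<^sub>R Qi z v - (2 * Re c) *\<^sub>R TQi z v"
    unfolding lmul.add_left[symmetric] cslice_add[symmetric] r cslice_of_real lmul_scalar
    using z by (simp add: blinfun.scaleR_right TQi_simps)
  also have "\<dots> = cs (cnj z * c + cnj (cnj z * c)) (Qi z v) - cs (c + cnj c) (TQi z v)"
    unfolding r by (simp only: cs_simps)
  also have "\<dots> = cs c (Rf z v) + cs (cnj c) (Rf (cnj z) v)"
    by (simp only: Rf_def Qi_cnj TQi_cnj cs_simps(1,2,3,4) complex_cnj_cnj r2) simp
  finally show ?thesis .
qed

text \<open>In the difference of the S-resolvents at \<open>s\<close> and its conjugate the term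
  \<open>T Q^-1\<close> cancels, and \<open>Q^-1\<close> remains with a left factor
  \<open>- 2 Im z J\<close>. On the cone \<open>\<bar>Im z\<bar>\<close> is at least
  \<open>cmod z * sin \<phi>\<close>, which yields the second power of \<open>cmod z\<close>. The
  bound for \<open>T Q^-1\<close> follows by solving the definition of the S-resolvent for
  it.\<close>

lemma Qi_TQi_bound:
  obtains C where "C \<ge> 0"
    "\<And>z v. z \<in> dcone \<phi> \<Longrightarrow> norm (Qi z v) \<le> C / (cmod z)\<^sup>2 * norm v"
    "\<And>z v. z \<in> dcone \<phi> \<Longrightarrow> norm (TQi z v) \<le> C / cmod z * norm v"
proof -
  obtain K where K: "K > 0" "\<And>(a :: 'n clifford) (v :: ('v, 'n) cmodule). norm (a \<odot> v) \<le> norm a * norm v * K"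
    using lmul_norm_bound by blast
  obtain C0 where C0: "C0 \<ge> 0"
    "\<And>s v. s \<in> paravectors - (dsector \<phi> \<union> {0}) \<Longrightarrow> norm (SL_inv s T v) \<le> C0 / norm s * norm v"
    using bis omega phi unfolding bisectorial_def by (metis greaterThanLessThan_iff)
  have SL: "norm (SL_inv (cslice unit z) T v) \<le> C0 / cmod z * norm v" if "z \<in> dcone \<phi>" for z v
    using C0(2)[OF dcone_not_dsector[OF that unit phi]] by (simp add: norm_cslice unit)
  define C1 where "C1 = C0 * K / sin \<phi>"
  have s: "sin \<phi> > 0" using phi by (intro sin_gt_zero) auto
  have C1: "C1 \<ge> 0" using s C0 K by (simp add: C1_def)
  have Q: "norm (Qi z v) \<le> C1 / (cmod z)\<^sup>2 * norm v" if z: "z \<in> dcone \<phi>" for z v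
  proof -
    have n: "cmod z > 0" using dcone_nonzero[OF z] by simp
    \<comment> \<open>Chosen with \<open>unit \<odot> w = v\<close>, to undo the left multiplication
      in the difference of the two S-resolvents.\<close>
    define w where "w = - (unit \<odot> v)"
    have nw: "norm w \<le> norm v * K"
      using K(2)[of unit v] unit by (simp add: w_def imag_sphere_def)
    have uw: "unit \<odot> w = v"
      by (simp add: w_def lmul.minus_right imag_sphere_square_action unit)
    have "SL_inv (cslice unit z) T w - SL_inv (cslice unit (cnj z)) T w = Qi z (cslice unit (cnj z - z) \<odot> w)"
      by (simp add: SL_inv_cslice unit Qi_cnj TQi_cnj cslice_diff lmul.diff_left blinfun.diff_right)
    also have "\<dots> = - (2 * Im z) *\<^sub>R Qi z v"
      by (simp add: cslice_lmul uw blinfun.bilinear_simps)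
    finally have "2 * \<bar>Im z\<bar> * norm (Qi z v) = norm (SL_inv (cslice unit z) T w - SL_inv (cslice unit (cnj z)) T w)"
      by (simp add: abs_mult)
    also have "\<dots> \<le> C0 / cmod z * norm w + C0 / cmod z * norm w"
      using SL[OF z, of w] SL[of "cnj z" w] z by (intro order_trans[OF norm_triangle_ineq4 add_mono]) auto
    finally have "\<bar>Im z\<bar> * norm (Qi z v) \<le> C0 / cmod z * norm w" by simp
    also have "\<dots> \<le> C0 / cmod z * (norm v * K)"
      using nw C0 by (intro mult_left_mono) auto
    finally have "\<bar>Im z\<bar> * norm (Qi z v) \<le> C0 / cmod z * (norm v * K)" .
    moreover have "cmod z * sin \<phi> * norm (Qi z v) \<le> \<bar>Im z\<bar> * norm (Qi z v)"
      by (intro mult_right_mono dcone_Im_bound z phi) auto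
    ultimately have "cmod z * sin \<phi> * norm (Qi z v) \<le> C0 / cmod z * (norm v * K)" by linarith
    then show ?thesis using n s by (simp add: C1_def field_simps power2_eq_square)
  qed
  have TQ: "norm (TQi z v) \<le> (C1 * K + C0) / cmod z * norm v" if z: "z \<in> dcone \<phi>" for z v
  proof -
    have n: "cmod z > 0" using dcone_nonzero[OF z] by simp
    have "TQi z v = Qi z (cslice unit (cnj z) \<odot> v) - SL_inv (cslice unit z) T v"
      by (simp add: SL_inv_cslice unit)
    also have "norm \<dots> \<le> C1 / (cmod z)\<^sup>2 * norm (cslice unit (cnj z) \<odot> v) + C0 / cmod z * norm v"
      by (intro order_trans[OF norm_triangle_ineq4 add_mono] Q SL z)
    also have "\<dots> \<le> C1 / (cmod z)\<^sup>2 * (cmod z * norm v * K) + C0 / cmod z * norm v"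
      using K(2)[of "cslice unit (cnj z)" v] C1 by (intro add_mono mult_left_mono order_refl) (auto simp: norm_cslice unit)
    also have "\<dots> = (C1 * K + C0) / cmod z * norm v"
      using n by (simp add: field_simps power2_eq_square)
    finally show ?thesis .
  qed
  show ?thesis
  proof (rule that[of "C1 + (C1 * K + C0)"])
    fix z v assume z: "z \<in> dcone \<phi>"
    show "norm (Qi z v) \<le> (C1 + (C1 * K + C0)) / (cmod z)\<^sup>2 * norm v"
      by (rule order_trans[OF Q[OF z]]) (use C0 C1 K in \<open>auto intro!: mult_right_mono divide_right_mono\<close>)
    show "norm (TQi z v) \<le> (C1 + (C1 * K + C0)) / cmod z * norm v"
      by (rule order_trans[OF TQ[OF z]]) (use C0 C1 K in \<open>auto intro!: mult_right_mono divide_right_mono\<close>)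
  qed (use C0 C1 K in auto)
qed

definition Jo :: "('v, 'n) cmodule \<Rightarrow>\<^sub>L ('v, 'n) cmodule" where "Jo = Blinfun (\<lambda>v. rmul v unit)"

definition TQo :: "complex \<Rightarrow> ('v, 'n) cmodule \<Rightarrow>\<^sub>L ('v, 'n) cmodule" where "TQo z = Blinfun (TQi z)"

lemma bounded_linear_TQi:
  assumes z: "z \<in> dcone \<phi>" shows "bounded_linear (TQi z)"
proof -
  obtain C where "\<And>v. norm (TQi z v) \<le> C / cmod z * norm v"
    using Qi_TQi_bound z by metis
  then show ?thesis
    by (intro bounded_linear_intro[where K = "C / cmod z"]) (auto simp: TQi_simps z mult.commute)
qed

lemma TQo_apply: "z \<in> dcone \<phi> \<Longrightarrow> blinfun_apply (TQo z) v = TQi z v"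
  by (simp add: TQo_def bounded_linear_Blinfun_apply bounded_linear_TQi)

lemma Jo_apply: "blinfun_apply Jo v = rmul v unit"
  unfolding Jo_def unit_def by (subst bounded_linear_Blinfun_apply) (rule bounded_linear_rmul_generator, simp)

definition Ro :: "complex \<Rightarrow> ('v, 'n) cmodule \<Rightarrow>\<^sub>L ('v, 'n) cmodule" where
  "Ro z = (Re z *\<^sub>R Qi z - Im z *\<^sub>R (Jo \<star> Qi z)) - TQo z"

lemma Ro_apply: "z \<in> dcone \<phi> \<Longrightarrow> blinfun_apply (Ro z) v = Rf z v"
  by (simp add: Ro_def Rf_def cs_def blinfun.bilinear_simps Jo_apply TQo_apply)

lemma Ro_bound_exists: "\<exists>C. \<forall>z\<in>dcone \<phi>. norm (Ro z) \<le> C / cmod z"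
proof -
  obtain C where C: "C \<ge> 0"
    "\<And>z v. z \<in> dcone \<phi> \<Longrightarrow> norm (Qi z v) \<le> C / (cmod z)\<^sup>2 * norm v"
    "\<And>z v. z \<in> dcone \<phi> \<Longrightarrow> norm (TQi z v) \<le> C / cmod z * norm v"
    using Qi_TQi_bound by blast
  have "norm (Ro z) \<le> (C + norm Jo * C + C) / cmod z" if z: "z \<in> dcone \<phi>" for z
  proof -
    have n: "cmod z > 0" using dcone_nonzero[OF z] by simp
    have Q: "norm (Qi z) \<le> C / (cmod z)\<^sup>2"
      by (rule norm_blinfun_bound) (use C z in auto)
    have TQ: "norm (TQo z) \<le> C / cmod z"
      by (rule norm_blinfun_bound) (use C z in \<open>auto simp: TQo_apply\<close>)
    have "norm (Ro z) \<le> norm (Re z *\<^sub>R Qi z) + norm (Im z *\<^sub>R (Jo \<star> Qi z)) + norm (TQo z)"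
      unfolding Ro_def by (intro order_trans[OF norm_triangle_ineq4] add_mono norm_triangle_ineq4 order_refl)
    also have "\<dots> \<le> cmod z * (C / (cmod z)\<^sup>2) + cmod z * (norm Jo * (C / (cmod z)\<^sup>2)) + C / cmod z"
      unfolding norm_scaleR
      by (intro add_mono mult_mono TQ order_trans[OF norm_blinfun_compose])
        (use Q abs_Re_le_cmod abs_Im_le_cmod C in auto)
    also have "\<dots> = (C + norm Jo * C + C) / cmod z"
      using n by (simp add: field_simps power2_eq_square)
    finally show ?thesis .
  qed
  then show ?thesis by blast
qed

text \<open>The bound needs a name because the locale parameter \<open>C\<close> must be
  instantiated by a term.\<close>

definition Rconst :: real where "Rconst = (SOME C. \<forall>z\<in>dcone \<phi>. norm (Ro z) \<le> C / cmod z)"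

lemma Rf_cs: "z \<in> dcone \<phi> \<Longrightarrow> Rf z (cs c v) = cs c (Rf z v)"
  by (simp add: Rf_def Qi_cs TQi_simps cs_simps mult.commute)

lemma Rf_add: "z \<in> dcone \<phi> \<Longrightarrow> Rf z (v + w) = Rf z v + Rf z w"
  by (simp add: Rf_def TQi_simps cs_simps blinfun.bilinear_simps)

lemma Rf_resolvent:
  assumes l: "l \<in> dcone \<phi>" and m: "m \<in> dcone \<phi>"
  shows "Rf l v - Rf m v = cs (m - l) (Rf l (Rf m v))"
proof -
  have "Rf m v = Rf l (cs l (Rf m v) - (cs m (Rf m v) - v))"
    by (rule Rf_left[OF l Rf_right[OF m], symmetric])
  also have "cs l (Rf m v) - (cs m (Rf m v) - v) = cs (l - m) (Rf m v) + v"
    by (simp add: cs_simps)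
  also have "Rf l (cs (l - m) (Rf m v) + v) = cs (l - m) (Rf l (Rf m v)) + Rf l v"
    by (simp only: Rf_add[OF l] Rf_cs[OF l])
  finally have 1: "Rf m v = cs (l - m) (Rf l (Rf m v)) + Rf l v" .
  have 2: "cs (m - l) (Rf l (Rf m v)) = - cs (l - m) (Rf l (Rf m v))"
    by (simp flip: cs_simps(6))
  have "b - a = c" if "a = d + b" "c = - d" for a b c d :: "('v, 'n) cmodule"
    using that by simp
  from this[OF 1 2] show ?thesis .
qed

sublocale pseudo_resolvent Jo Ro \<phi> Rconst
proof
  show "Jo \<star> Jo = - id_blinfun"
    by (rule blinfun_eqI) (simp add: Jo_apply rmul_unit_twice blinfun.bilinear_simps)
  show "Ro l \<star> Jo = Jo \<star> Ro l" if l: "l \<in> dcone \<phi>" for l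
  proof (rule blinfun_eqI)
    fix v show "blinfun_apply (Ro l \<star> Jo) v = blinfun_apply (Jo \<star> Ro l) v"
      using Rf_cs[OF l, of \<i> v] by (simp add: Jo_apply Ro_apply l cs_def)
  qed
  show "Ro l - Ro m = Re (m - l) *\<^sub>R (Ro l \<star> Ro m) + Im (m - l) *\<^sub>R (Jo \<star> (Ro l \<star> Ro m))"
    if l: "l \<in> dcone \<phi>" and m: "m \<in> dcone \<phi>" for l m
  proof (rule blinfun_eqI)
    fix v show "blinfun_apply (Ro l - Ro m) v = blinfun_apply (Re (m - l) *\<^sub>R (Ro l \<star> Ro m) + Im (m - l) *\<^sub>R (Jo \<star> (Ro l \<star> Ro m))) v"
      using Rf_resolvent[OF l m, of v] by (simp add: blinfun.bilinear_simps Jo_apply Ro_apply l m cs_def)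
  qed
  show "norm (Ro l) \<le> Rconst / cmod l" if "l \<in> dcone \<phi>" for l
    using someI_ex[OF Ro_bound_exists] that unfolding Rconst_def by blast
qed (use phi in auto)

lemma sc_apply: "blinfun_apply (sc z X) v = cs z (X v)"
  by (simp add: sc_def cs_def blinfun.bilinear_simps Jo_apply)

text \<open>Here \<open>Rf (- \<i>)\<close> is \<open>(i - T) (1 + T^2)^-1\<close>, and
  \<open>Rf \<i>\<close> removes the factor \<open>i - T\<close>.\<close>

lemma A_eq: "A = Qi \<i>"
proof (rule blinfun_eqI)
  fix v
  have "Qi (- \<i>) = Qi \<i>" "TQi (- \<i>) = TQi \<i>"
    using Qi_cnj[of \<i>] TQi_cnj[of \<i>] by simp_all
  then have "Rf (- \<i>) v = cs \<i> (Qi \<i> v) - TQi \<i> v"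
    by (simp add: Rf_def)
  moreover have "Rf \<i> (cs \<i> (Qi \<i> v) - TQi \<i> v) = Qi \<i> v"
    by (rule Rf_left[OF _ T_Qi(1)]) simp_all
  ultimately show "blinfun_apply A v = blinfun_apply (Qi \<i>) v"
    by (simp add: A_def Ro_apply)
qed

text \<open>Transfers continuity from \<open>Ro\<close>, where it comes from the resolvent identity,
  to \<open>Qi\<close>. The terms \<open>TQi\<close> cancel in the difference, and
  \<open>Im z\<close> does not vanish on the cone.\<close>

lemma Qi_eq_Ro:
  assumes z: "z \<in> dcone \<phi>"
  shows "Qi z = sc (\<i> / (2 * of_real (Im z))) (Ro z - Ro (cnj z))"
proof (rule blinfun_eqI)
  fix v
  have "Im z \<noteq> 0" by (rule dcone_Im_nonzero[OF z phi])
  have "Rf z v - Rf (cnj z) v = cs (cnj z - z) (Qi z v)"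
    by (simp add: Rf_def Qi_cnj TQi_cnj cs_simps)
  moreover have "\<i> / (2 * of_real (Im z)) * (cnj z - z) = 1"
    using \<open>Im z \<noteq> 0\<close> by (simp add: complex_eq_iff)
  moreover have "cs 1 w = w" for w by (simp add: cs_def)
  ultimately have "cs (\<i> / (2 * of_real (Im z))) (Rf z v - Rf (cnj z) v) = Qi z v"
    by (simp only: cs_simps(3))
  then show "blinfun_apply (Qi z) v = blinfun_apply (sc (\<i> / (2 * of_real (Im z))) (Ro z - Ro (cnj z))) v"
    using z by (simp only: sc_apply blinfun.diff_left Ro_apply dcone_cnj)
qed

lemma continuous_on_Qi: "continuous_on (dcone \<phi>) Qi"
proof -
  have "continuous_on (dcone \<phi>) (\<lambda>z. sc (\<i> / (2 * of_real (Im z))) (Ro z - Ro (cnj z)))"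
    by (intro sc.continuous_on continuous_intros continuous_on_R continuous_on_compose2[OF continuous_on_R])
      (use dcone_Im_nonzero phi in auto)
  then show ?thesis
    by (rule continuous_on_eq) (simp add: Qi_eq_Ro)
qed

lemma continuous_on_TQo: "continuous_on (dcone \<phi>) TQo"
proof -
  have "continuous_on (dcone \<phi>) (\<lambda>z. sc (cnj z) (Qi z) - Ro z)"
    by (intro sc.continuous_on continuous_intros continuous_on_R continuous_on_Qi)
  then show ?thesis
    by (rule continuous_on_eq) (simp add: Ro_def sc_def)
qed


section \<open>The contour integral of the functional calculus\<close>

definition left_act :: "'n clifford \<Rightarrow> complex \<Rightarrow> ('v, 'n) cmodule \<Rightarrow>\<^sub>L ('v, 'n) cmodule" where
  "left_act J c = Re c *\<^sub>R id_blinfun + Im c *\<^sub>R Blinfun (lmul J)"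

lemma left_act_apply: "blinfun_apply (left_act J c) v = cslice J c \<odot> v"
  by (simp add: left_act_def cslice_lmul blinfun.bilinear_simps bounded_linear_Blinfun_apply lmul.bounded_linear_right)

text \<open>The contour integrand as an explicit combination of operator families that are
  continuous in operator norm; the coefficient \<open>c\<close> acts by left multiplication before
  the S-resolvent.\<close>

definition SL_op :: "'n clifford \<Rightarrow> complex \<Rightarrow> complex \<Rightarrow> ('v, 'n) cmodule \<Rightarrow>\<^sub>L ('v, 'n) cmodule" where
  "SL_op J z c = Qi z \<star> left_act J (cnj z * c) - TQo z \<star> left_act J c"

lemma SL_op_apply:
  assumes "z \<in> dcone \<phi>" "J \<in> imag_sphere"
  shows "blinfun_apply (SL_op J z c) v = SL_inv (cslice J z) T (cslice J c \<odot> v)"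
  using assms by (simp add: SL_op_def left_act_apply blinfun.bilinear_simps TQo_apply SL_inv_cslice cslice_mult_action)

lemma SL_op_eq_Blinfun:
  assumes "z \<in> dcone \<phi>" "J \<in> imag_sphere"
  shows "Blinfun (\<lambda>v. SL_inv (cslice J z) T (cslice J c \<odot> v)) = SL_op J z c"
  unfolding SL_op_apply[OF assms, symmetric] by (rule blinfun_apply_inverse)

lemma SL_op_pair:
  assumes z: "z \<in> dcone \<phi>" and J: "J \<in> imag_sphere"
  shows "SL_op J z c + SL_op J (cnj z) (cnj c) = sc c (Ro z) + sc (cnj c) (Ro (cnj z))"
  using SL_inv_pair[OF assms, of c] z J
  by (intro blinfun_eqI) (simp add: blinfun.add_left SL_op_apply sc_apply Ro_apply)

lemma continuous_on_left_act:
  "continuous_on S c \<Longrightarrow> continuous_on S (\<lambda>t. left_act J (c t))"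
  unfolding left_act_def by (intro continuous_intros)

lemma continuous_on_SL_op:
  assumes "continuous_on S z" "continuous_on S c" "\<And>t. t \<in> S \<Longrightarrow> z t \<in> dcone \<phi>"
  shows "continuous_on S (\<lambda>t. SL_op J (z t) (c t))"
  unfolding SL_op_def
  by (intro continuous_intros bounded_bilinear.continuous_on[OF bounded_bilinear_blinfun_compose]
      continuous_on_left_act assms continuous_on_compose2[OF continuous_on_Qi] continuous_on_compose2[OF continuous_on_TQo])
    (use assms in auto)

lemma SL_op_bound:
  obtains C where "C \<ge> 0"
    "\<And>J z c. z \<in> dcone \<phi> \<Longrightarrow> J \<in> imag_sphere \<Longrightarrow> norm (SL_op J z c) \<le> C * cmod c / cmod z"
proof -
  obtain C0 where C0: "C0 \<ge> 0"
    "\<And>s v. s \<in> paravectors - (dsector \<phi> \<union> {0}) \<Longrightarrow> norm (SL_inv s T v) \<le> C0 / norm s * norm v"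
    using bis omega phi unfolding bisectorial_def by (metis greaterThanLessThan_iff)
  obtain K where K: "K > 0" "\<And>(a :: 'n clifford) (v :: ('v, 'n) cmodule). norm (a \<odot> v) \<le> norm a * norm v * K"
    using lmul_norm_bound by blast
  show ?thesis
  proof (rule that[of "C0 * K"])
    fix J :: "'n clifford" and z c assume z: "z \<in> dcone \<phi>" and J: "J \<in> imag_sphere"
    show "norm (SL_op J z c) \<le> C0 * K * cmod c / cmod z"
    proof (rule norm_blinfun_bound)
      fix v
      have "norm (SL_op J z c v) \<le> C0 / cmod z * norm (cslice J c \<odot> v)"
        using C0(2)[OF dcone_not_dsector[OF z J phi]] by (simp add: SL_op_apply z J norm_cslice)
      also have "\<dots> \<le> C0 / cmod z * (cmod c * norm v * K)"
        using K(2)[of "cslice J c" v] C0 J by (intro mult_left_mono) (auto simp: norm_cslice)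
      finally show "norm (SL_op J z c v) \<le> C0 * K * cmod c / cmod z * norm v" by (simp add: mult_ac)
    qed (use C0 K in auto)
  qed (use C0 K in auto)
qed

text \<open>The right-hand side is the sum of the contour integrand over the four points \<open>\<plusminus>l\<close>, \<open>\<plusminus>cnj l\<close>.\<close>

lemma H_scaled:
  assumes "t > 0"
  shows "sc \<i> (H g t) =
    sc (\<i> * cis \<phi> * g (ray_u t)) (Ro (ray_point t) - Ro (- ray_point t))
    + sc (cnj (\<i> * cis \<phi> * g (ray_u t))) (Ro (cnj (ray_point t)) - Ro (- cnj (ray_point t)))"
proof -
  have l: "ray_point t \<in> dcone \<phi>" "cnj (ray_point t) \<in> dcone \<phi>" using ray_point_dcone[OF assms] by simp_all
  have w: "\<i> * cis \<phi> * g (ray_u t) * (2 * ray_point t) = \<i> * (ray_weight t * g (ray_u t))"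
    "cnj (\<i> * cis \<phi> * g (ray_u t)) * (2 * cnj (ray_point t)) = - (\<i> * cnj (ray_weight t * g (ray_u t)))"
    by (simp_all add: ray_point_def ray_weight_def power2_eq_square)
  show ?thesis
    unfolding R_diff_minus[OF l(1)] R_diff_minus[OF l(2)] sc_sc w H_def
    by (simp add: sc.diff_right sc_sc sc.minus_left)
qed

lemma bisector_path_cslice:
  "t \<noteq> 0 \<Longrightarrow> bisector_path \<phi> J \<epsilon> t = cslice J (of_real \<epsilon> * (if t > 0 then cnj (ray_point t) else ray_point (- t)))"
  by (auto simp: bisector_path_def expi_cslice ray_point_def sgn_if simp flip: cslice_scaleR)
    (simp_all add: scaleR_conv_of_real cis_cnj mult_ac)

lemma bisector_path_derivative:
  assumes "t \<noteq> 0"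
  shows "vector_derivative (bisector_path \<phi> J \<epsilon>) (at t) = cslice J (of_real \<epsilon> * (if t > 0 then cnj (cis \<phi>) else - cis \<phi>))"
proof (rule vector_derivative_at)
  define c where "c = (if t > 0 then cnj (cis \<phi>) else - cis \<phi>)"
  have "((\<lambda>x. x *\<^sub>R cslice J (of_real \<epsilon> * c)) has_vector_derivative cslice J (of_real \<epsilon> * c)) (at t)"
    by (auto intro!: derivative_eq_intros)
  then show "(bisector_path \<phi> J \<epsilon> has_vector_derivative cslice J (of_real \<epsilon> * c)) (at t)"
  proof (rule has_vector_derivative_transform_within_open)
    show "open (if t > 0 then {0<..} else {..<0 :: real})"
      by simp
    show "t \<in> (if t > 0 then {0<..} else {..<0})"
      using assms by auto
    fix x :: real assume "x \<in> (if t > 0 then {0<..} else {..<0})"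
    then show "x *\<^sub>R cslice J (of_real \<epsilon> * c) = bisector_path \<phi> J \<epsilon> x"
      by (subst bisector_path_cslice) (auto simp: c_def ray_point_def simp flip: cslice_scaleR split: if_splits,
          simp_all add: scaleR_conv_of_real mult_ac)
  qed
qed

text \<open>Evaluates the integral for every admissible unit and angle, as required for whichever
  pair \<open>omega_calculus\<close> selects. Only the values of \<open>f\<close> on the slice of
  \<open>J\<close> enter, because the contour lies there.\<close>

theorem omega_integral_fcalc:
  assumes g: "fcalc A g G" and J: "J \<in> imag_sphere" and \<theta>: "\<phi> < \<theta>" "\<theta> < pi / 2"
    and f: "\<And>z. z \<in> plane_sector \<theta> \<Longrightarrow> f (cslice J z) = cslice J (g (1 / (1 + z\<^sup>2)))"
  shows "omega_integral \<phi> J T f = G"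
proof -
  \<comment> \<open>On the branch \<open>t < 0\<close> with sign 1 the path has derivative
    \<open>- cis \<phi>\<close>, and division by the unit gives the factor
    \<open>\<i> * cis \<phi>\<close>; the branch \<open>t > 0\<close> carries the conjugate.\<close>
  define c where "c t = \<i> * cis \<phi> * g (ray_u t)" for t
  define z where "z t = (if t > 0 then cnj (ray_point t) else ray_point (- t))" for t
  define d where "d t = (if t > 0 then cnj (c t) else c (- t))" for t
  define p where "p \<epsilon> t = Blinfun (\<lambda>v. SL_inv (bisector_path \<phi> J \<epsilon> t) T
       ((vector_derivative (bisector_path \<phi> J \<epsilon>) (at t) \<odot> pv_inverse J) \<odot> f (bisector_path \<phi> J \<epsilon> t) \<odot> v))" for \<epsilon> t
  have J_eq: "J = cslice J \<i>"
    by (simp add: cslice_def slice_def)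
  have sector: "of_real \<epsilon> * ray_point t \<in> plane_sector \<theta>" "of_real \<epsilon> * cnj (ray_point t) \<in> plane_sector \<theta>"
    if "t > 0" "\<epsilon> \<in> {1, -1}" for \<epsilon> t
  proof -
    have cc: "cos \<phi> > 0" "sin \<phi> > 0" using phi by (auto intro!: cos_gt_zero sin_gt_zero)
    have "tan \<phi> < tan \<theta>" using phi \<theta> by (intro tan_monotone) auto
    moreover have "sin \<phi> = cos \<phi> * tan \<phi>" using cc by (simp add: tan_def)
    ultimately have "sin \<phi> < cos \<phi> * tan \<theta>" using cc by simp
    then have "t * sin \<phi> < t * (cos \<phi> * tan \<theta>)" using that by simp
    then show "of_real \<epsilon> * ray_point t \<in> plane_sector \<theta>" "of_real \<epsilon> * cnj (ray_point t) \<in> plane_sector \<theta>"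
      using that cc by (auto simp: plane_sector_def ray_point_def abs_mult mult_ac)
  qed
  have cone: "of_real \<epsilon> * ray_point t \<in> dcone \<phi>" "of_real \<epsilon> * cnj (ray_point t) \<in> dcone \<phi>"
    if "t > 0" "\<epsilon> \<in> {1, -1}" for \<epsilon> t
    using ray_point_dcone[OF that(1)] that(2) by auto
  have sq: "(of_real \<epsilon> * z)\<^sup>2 = z\<^sup>2" if "\<epsilon> \<in> {1, -1 :: real}" for \<epsilon> and z :: complex
    using that by auto
  have val: "p \<epsilon> t = SL_op J (of_real \<epsilon> * z t) (of_real \<epsilon> * d t)" if t: "t \<noteq> 0" and \<epsilon>: "\<epsilon> \<in> {1, -1}" for \<epsilon> t
  proof -
    have zs: "of_real \<epsilon> * z t \<in> plane_sector \<theta>" "of_real \<epsilon> * z t \<in> dcone \<phi>"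
      using sector[of "\<bar>t\<bar>" \<epsilon>] cone[of "\<bar>t\<bar>" \<epsilon>] t \<epsilon> by (auto simp: z_def abs_if)
    have path: "bisector_path \<phi> J \<epsilon> t = cslice J (of_real \<epsilon> * z t)"
      unfolding z_def by (rule bisector_path_cslice[OF t])
    define w where "w = 1 / (1 + (z t)\<^sup>2)"
    have w: "w = (if t > 0 then cnj (ray_u t) else ray_u (- t))"
      by (simp add: w_def z_def ray_u_def)
    have 1: "f (bisector_path \<phi> J \<epsilon> t) = cslice J (g w)"
      unfolding path f[OF zs(1)] sq[OF \<epsilon>] w_def ..
    have 2: "vector_derivative (bisector_path \<phi> J \<epsilon>) (at t) \<odot> pv_inverse J
        = cslice J (of_real \<epsilon> * (if t > 0 then cnj (cis \<phi>) else - cis \<phi>) * (1 / \<i>))"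
      using J by (subst (2) J_eq) (simp add: bisector_path_derivative[OF t] pv_inverse_cslice cslice_mult)
    have 3: "(vector_derivative (bisector_path \<phi> J \<epsilon>) (at t) \<odot> pv_inverse J) \<odot> f (bisector_path \<phi> J \<epsilon> t) \<odot> v
        = cslice J (of_real \<epsilon> * d t) \<odot> v" for v :: "('v, 'n) cmodule"
      unfolding 1 2 cslice_mult_action[OF J] w by (simp add: c_def d_def fcalc_cnj[OF g] mult_ac)
    show ?thesis
      unfolding p_def 3 unfolding path by (rule SL_op_eq_Blinfun[OF zs(2) J])
  qed
  have pos: "p \<epsilon> t = SL_op J (of_real \<epsilon> * cnj (ray_point t)) (of_real \<epsilon> * cnj (c t))"
    and neg: "p \<epsilon> (- t) = SL_op J (of_real \<epsilon> * ray_point t) (of_real \<epsilon> * c t)" if "t > 0" "\<epsilon> \<in> {1, -1}" for \<epsilon> t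
    using val[of t \<epsilon>] val[of "- t" \<epsilon>] that by (simp_all add: z_def d_def)
  have cont_c: "continuous_on {0<..} c"
    unfolding c_def[abs_def]
    by (intro continuous_intros continuous_on_compose2[OF fcalc_continuous[OF g]]) auto
  \<comment> \<open>On the ray \<open>u (1 - u) = l^2 u^2\<close>, and \<open>u\<close> is at most
    \<open>1 / (cos \<phi> * (1 + t^2))\<close>; the constant \<open>E\<close> is taken for the disc
    of radius \<open>1 / cos \<phi>\<close>, which contains all values of \<open>u\<close>.\<close>
  obtain D where D: "D \<ge> 0" "\<And>t. t > 0 \<Longrightarrow> cmod (c t) \<le> D * (t\<^sup>2 / (1 + t\<^sup>2)\<^sup>2)"
  proof -
    have cc: "cos \<phi> > 0" using phi by (intro cos_gt_zero) auto
    obtain E where E: "E \<ge> 0" "\<And>z. cmod z \<le> 1 / cos \<phi> \<Longrightarrow> cmod (g z) \<le> E * cmod (z * (1 - z))"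
      using fcalc_bound[OF g] by blast
    show ?thesis
    proof (rule that[of "E * (1 / (cos \<phi>)\<^sup>2)"])
      fix t :: real assume t: "t > 0"
      have "cmod (ray_u t) \<le> 1 / (cos \<phi> * (1 + t\<^sup>2))" by (rule ray_u_bound[OF t])
      also have "\<dots> \<le> 1 / (cos \<phi> * 1)"
        using cc t by (intro divide_left_mono mult_left_mono mult_pos_pos) (auto simp: add_pos_nonneg)
      finally have "cmod (ray_u t) \<le> 1 / cos \<phi>" by simp
      then have "cmod (c t) \<le> E * cmod (ray_u t * (1 - ray_u t))"
        using E(2) by (simp add: c_def norm_mult)
      also have "cmod (ray_u t * (1 - ray_u t)) = (cmod (ray_u t))\<^sup>2 * t\<^sup>2"
        unfolding ray_one_minus_u[OF t] using t
        by (simp add: norm_mult norm_power ray_point_def power_mult_distrib power2_eq_square)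
      also have "E * ((cmod (ray_u t))\<^sup>2 * t\<^sup>2) \<le> E * ((1 / (cos \<phi> * (1 + t\<^sup>2)))\<^sup>2 * t\<^sup>2)"
        using ray_u_bound[OF t] E by (intro mult_left_mono mult_right_mono power_mono) auto
      also have "\<dots> = E * (1 / (cos \<phi>)\<^sup>2) * (t\<^sup>2 / (1 + t\<^sup>2)\<^sup>2)"
        by (simp add: power_divide power_mult_distrib)
      finally show "cmod (c t) \<le> E * (1 / (cos \<phi>)\<^sup>2) * (t\<^sup>2 / (1 + t\<^sup>2)\<^sup>2)" .
    qed (use E cc in auto)
  qed
  obtain C where C: "C \<ge> 0"
    "\<And>J z c. z \<in> dcone \<phi> \<Longrightarrow> J \<in> imag_sphere \<Longrightarrow> norm (SL_op J z c) \<le> C * cmod c / cmod z"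
    using SL_op_bound by blast
  \<comment> \<open>The S-resolvent costs one factor \<open>1 / \<bar>t\<bar>\<close>, which leaves
    the decay assumed in \<open>integral_line_limit\<close>.\<close>
  have bound: "norm (SL_op J z d) \<le> C * D * \<bar>t\<bar> / (1 + t\<^sup>2)\<^sup>2"
    if "z \<in> dcone \<phi>" "cmod z = \<bar>t\<bar>" "cmod d = cmod (c \<bar>t\<bar>)" "t \<noteq> 0" for z d t
  proof -
    have "norm (SL_op J z d) \<le> C * cmod d / cmod z" by (rule C(2)[OF that(1) J])
    also have "\<dots> \<le> C * (D * (t\<^sup>2 / (1 + t\<^sup>2)\<^sup>2)) / \<bar>t\<bar>"
      unfolding that(2,3) using D(2)[of "\<bar>t\<bar>"] that(4) C(1) by (intro divide_right_mono mult_left_mono) auto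
    also have "\<dots> = C * D * \<bar>t\<bar> / (1 + t\<^sup>2)\<^sup>2"
    proof -
      have "t\<^sup>2 / \<bar>t\<bar> = \<bar>t\<bar>"
        using that(4) by (subst power2_abs[symmetric]) (simp add: power2_eq_square del: abs_mult_self_eq power2_abs)
      moreover have "C * (D * (t\<^sup>2 / (1 + t\<^sup>2)\<^sup>2)) / \<bar>t\<bar> = C * D * (t\<^sup>2 / \<bar>t\<bar>) / (1 + t\<^sup>2)\<^sup>2"
        by (simp add: mult_ac)
      ultimately show ?thesis by simp
    qed
    finally show ?thesis .
  qed
  have line: "(\<lambda>n. trunc_integral n (\<lambda>t. p \<epsilon> t + p \<epsilon> (- t))) \<longlonglongrightarrow> integral UNIV (p \<epsilon>)"
    if \<epsilon>: "\<epsilon> \<in> {1, -1}" for \<epsilon>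
  proof (rule integral_line_limit(2))
    have "continuous_on {0<..} (\<lambda>t. SL_op J (of_real \<epsilon> * cnj (ray_point t)) (of_real \<epsilon> * cnj (c t)))"
      by (intro continuous_on_SL_op continuous_intros cont_c cone(2)[OF _ \<epsilon>]) auto
    then show "continuous_on {0<..} (p \<epsilon>)"
      by (rule continuous_on_eq) (simp add: pos[OF _ \<epsilon>])
    have "continuous_on {..<0} (\<lambda>t. SL_op J (of_real \<epsilon> * ray_point (- t)) (of_real \<epsilon> * c (- t)))"
      by (intro continuous_on_SL_op continuous_intros continuous_on_compose2[OF cont_c]
          continuous_on_compose2[OF continuous_on_ray(1)[of UNIV]] cone(1)[OF _ \<epsilon>]) auto
    then show "continuous_on {..<0} (p \<epsilon>)"
      by (rule continuous_on_eq) (simp add: neg[of "- _", OF _ \<epsilon>, simplified])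
    fix t :: real assume t: "t \<noteq> 0"
    show "norm (p \<epsilon> t) \<le> C * D * \<bar>t\<bar> / (1 + t\<^sup>2)\<^sup>2"
    proof (cases "t > 0")
      case True
      show ?thesis
        unfolding pos[OF True \<epsilon>] by (rule bound[OF cone(2)[OF True \<epsilon>] _ _ t])
          (use True \<epsilon> in \<open>auto simp: norm_mult ray_point_def\<close>)
    next
      case False
      then have t': "- t > 0" using t by simp
      show ?thesis
        using neg[OF t' \<epsilon>] bound[OF cone(1)[OF t' \<epsilon>] _ _ t, of "of_real \<epsilon> * c (- t)"] t' \<epsilon>
        by (auto simp: norm_mult ray_point_def)
    qed
  qed
  have pair: "p 1 t + p 1 (- t) + (p (-1) t + p (-1) (- t)) = sc \<i> (H g t)" if t: "t > 0" for t
  proof -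
    have "p 1 t + p 1 (- t) + (p (-1) t + p (-1) (- t)) =
        (SL_op J (ray_point t) (c t) + SL_op J (cnj (ray_point t)) (cnj (c t)))
        + (SL_op J (- ray_point t) (- c t) + SL_op J (cnj (- ray_point t)) (cnj (- c t)))"
      by (simp add: pos[OF t] neg[OF t] add_ac)
    also have "SL_op J (ray_point t) (c t) + SL_op J (cnj (ray_point t)) (cnj (c t))
      = sc (c t) (Ro (ray_point t)) + sc (cnj (c t)) (Ro (cnj (ray_point t)))"
      by (rule SL_op_pair[OF ray_point_dcone[OF t] J])
    also have "SL_op J (- ray_point t) (- c t) + SL_op J (cnj (- ray_point t)) (cnj (- c t))
      = sc (- c t) (Ro (- ray_point t)) + sc (cnj (- c t)) (Ro (cnj (- ray_point t)))"
      using ray_point_dcone[OF t] by (intro SL_op_pair J) simp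
    finally show ?thesis
      unfolding H_scaled[OF t] c_def[symmetric]
      by (simp add: sc.diff_right sc.minus_left algebra_simps)
  qed
  have int: "(\<lambda>t. p \<epsilon> t + p \<epsilon> (- t)) integrable_on {1 / real (Suc n)..real (Suc n)}" if \<epsilon>: "\<epsilon> \<in> {1, -1}" for \<epsilon> n
  proof (rule integrable_continuous_real)
    have "continuous_on {0<..} (\<lambda>t. SL_op J (of_real \<epsilon> * cnj (ray_point t)) (of_real \<epsilon> * cnj (c t))
        + SL_op J (of_real \<epsilon> * ray_point t) (of_real \<epsilon> * c t))"
      by (intro continuous_on_SL_op continuous_intros cont_c cone[OF _ \<epsilon>]) auto
    then have "continuous_on {0<..} (\<lambda>t. p \<epsilon> t + p \<epsilon> (- t))"
      by (rule continuous_on_eq) (simp add: pos[OF _ \<epsilon>] neg[OF _ \<epsilon>])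
    then show "continuous_on {1 / real (Suc n)..real (Suc n)} (\<lambda>t. p \<epsilon> t + p \<epsilon> (- t))"
      by (rule continuous_on_subset) (use trunc_pos in auto)
  qed
  have "trunc_integral n (\<lambda>t. p 1 t + p 1 (- t))
      + trunc_integral n (\<lambda>t. p (-1) t + p (-1) (- t))
      = sc \<i> (trunc_integral n (H g))" for n
  proof -
    have "trunc_integral n (\<lambda>t. p 1 t + p 1 (- t))
      + trunc_integral n (\<lambda>t. p (-1) t + p (-1) (- t))
      = trunc_integral n (\<lambda>t. p 1 t + p 1 (- t) + (p (-1) t + p (-1) (- t)))"
      by (rule integral_add[symmetric]; rule int) auto
    also have "\<dots> = trunc_integral n (\<lambda>t. sc \<i> (H g t))"
      by (rule integral_cong) (rule pair[OF trunc_pos])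
    also have "\<dots> = sc \<i> (trunc_integral n (H g))"
      using integral_linear[OF integrable_continuous_real[OF continuous_on_H[OF fcalc_continuous[OF g] trunc_pos]] sc.bounded_linear_right[of "\<i>"]]
      by (simp add: o_def)
    finally show ?thesis .
  qed
  then have "(\<lambda>n. sc \<i> (trunc_integral n (H g))) \<longlonglongrightarrow> integral UNIV (p 1) + integral UNIV (p (-1))"
    using tendsto_add[OF line[of 1] line[of "-1"]] by simp
  moreover have "(\<lambda>n. sc \<i> (trunc_integral n (H g))) \<longlonglongrightarrow> sc \<i> (sc (- (2 * pi * \<i>)) G)"
    by (intro sc.tendsto tendsto_const fcalc_limit[OF g])
  ultimately have "integral UNIV (p 1) + integral UNIV (p (-1)) = sc \<i> (sc (- (2 * pi * \<i>)) G)"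
    by (rule LIMSEQ_unique)
  \<comment> \<open>The product \<open>i * (- 2 pi i)\<close> equals \<open>2 pi\<close>, the
    reciprocal of the normalizing factor.\<close>
  also have "\<dots> = sc (of_real (2 * pi)) G"
    unfolding sc_sc by (simp add: mult_ac)
  also have "\<dots> = (2 * pi) *\<^sub>R G"
    by (rule sc_of_real)
  finally show ?thesis
    unfolding omega_integral_def p_def[symmetric] by simp
qed

end

section \<open>Slice hyperholomorphic functions on double sectors\<close>

text \<open>The intrinsic slice function \<open>x + J y \<mapsto> Re g(x + i y) + J Im g(x + i y)\<close>; it is well defined when
  \<open>g\<close> commutes with conjugation, and division by \<open>0\<close> then only occurs for \<open>Im (g z) = 0\<close>.\<close>

definition lift :: "(complex \<Rightarrow> complex) \<Rightarrow> 'n::finite clifford \<Rightarrow> 'n clifford" where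
  "lift g s = (let v = s - axis {} (s $ {}); z = Complex (s $ {}) (norm v)
     in axis {} (Re (g z)) + (Im (g z) / Im z) *\<^sub>R v)"

lemma lift_cslice:
  assumes J: "J \<in> imag_sphere" and g: "\<And>z. g (cnj z) = cnj (g z)"
  shows "lift g (cslice J z) = cslice J (g z)"
proof -
  have v: "cslice J z - axis {} (Re z) = Im z *\<^sub>R J"
    by (simp add: cslice_def slice_def)
  have n: "norm (Im z *\<^sub>R J) = \<bar>Im z\<bar>" using J by (simp add: imag_sphere_def)
  have z: "Complex (Re z) \<bar>Im z\<bar> = (if Im z < 0 then cnj z else z)"
    by (simp add: complex_eq_iff)
  show ?thesis
  proof (cases "Im z = 0")
    case True
    then have "cnj z = z" by (simp add: complex_eq_iff)
    then have "Im (g z) = 0" using g[of z] by (metis cnj.simps(2) add.inverse_unique equal_neg_zero)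
    moreover have "Complex (Re z) 0 = z" using True by (simp add: complex_eq_iff)
    ultimately show ?thesis
      unfolding lift_def Let_def v n cslice_nth_empty[OF J] using True by (simp add: cslice_def slice_def)
  next
    case False
    then show ?thesis
      unfolding lift_def Let_def v n cslice_nth_empty[OF J] z by (auto simp: g cslice_def slice_def)
  qed
qed

lemma slice_dom_dsector:
  "0 < \<theta> \<Longrightarrow> \<theta> < pi / 2 \<Longrightarrow> p \<in> slice_dom (dsector \<theta> :: 'n::{finite,linorder} clifford set) \<longleftrightarrow>
    Complex (fst p) (snd p) \<in> plane_sector \<theta>"
  using generator_imag_sphere[where 'n = 'n] by (cases p) (auto simp: slice_dom_def dsector_slice plane_sector_def)

text \<open>Works with two continuous partial derivatives in place of operator-valued derivatives,
  so that sums and products can be handled by the ordinary derivative rules.\<close>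

definition slice_partials ::
    "'n::{finite,linorder} clifford set \<Rightarrow> ('n clifford \<Rightarrow> 'n clifford) \<Rightarrow> (real \<times> real \<Rightarrow> 'n clifford) \<Rightarrow>
     (real \<times> real \<Rightarrow> 'n clifford) \<Rightarrow> (real \<times> real \<Rightarrow> 'n clifford) \<Rightarrow> (real \<times> real \<Rightarrow> 'n clifford) \<Rightarrow> bool" where
  "slice_partials U f f0 f1 P Q \<longleftrightarrow>
    (\<forall>x y. (x, y) \<in> slice_dom U \<longrightarrow> (\<forall>J\<in>imag_sphere. f (slice J x y) = f0 (x, y) + J \<odot> f1 (x, y)) \<and>
      f0 (x, - y) = f0 (x, y) \<and> f1 (x, - y) = - f1 (x, y)) \<and>
    continuous_on (slice_dom U) P \<and> continuous_on (slice_dom U) Q \<and>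
    (\<forall>p\<in>slice_dom U. (f0 has_derivative (\<lambda>h. fst h *\<^sub>R P p + snd h *\<^sub>R Q p)) (at p) \<and>
      (f1 has_derivative (\<lambda>h. snd h *\<^sub>R P p - fst h *\<^sub>R Q p)) (at p))"

lemma slice_partialsD:
  assumes "slice_partials U f f0 f1 P Q"
  shows "(x, y) \<in> slice_dom U \<Longrightarrow> J \<in> imag_sphere \<Longrightarrow> f (slice J x y) = f0 (x, y) + J \<odot> f1 (x, y)"
    and "(x, y) \<in> slice_dom U \<Longrightarrow> f0 (x, - y) = f0 (x, y)" "(x, y) \<in> slice_dom U \<Longrightarrow> f1 (x, - y) = - f1 (x, y)"
    and "continuous_on (slice_dom U) P" "continuous_on (slice_dom U) Q"
    and "p \<in> slice_dom U \<Longrightarrow> (f0 has_derivative (\<lambda>h. fst h *\<^sub>R P p + snd h *\<^sub>R Q p)) (at p)"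
    and "p \<in> slice_dom U \<Longrightarrow> (f1 has_derivative (\<lambda>h. snd h *\<^sub>R P p - fst h *\<^sub>R Q p)) (at p)"
  using assms unfolding slice_partials_def by simp_all

text \<open>By the Cauchy--Riemann equations the partial derivatives \<open>P\<close>, \<open>Q\<close> of \<open>f0\<close> determine those of \<open>f1\<close>.\<close>

lemma slice_components_iff:
  fixes U :: "'n::{finite,linorder} clifford set"
  shows "slice_components U f f0 f1 \<longleftrightarrow> (\<exists>P Q. slice_partials U f f0 f1 P Q)"
proof
  assume *: "slice_components U f f0 f1"
  then obtain f0' f1' :: "real \<times> real \<Rightarrow> (real \<times> real) \<Rightarrow>\<^sub>L 'n clifford"
    where c: "continuous_on (slice_dom U) f0'" "continuous_on (slice_dom U) f1'"
      and d: "\<forall>p\<in>slice_dom U. (f0 has_derivative blinfun_apply (f0' p)) (at p) \<and>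
           (f1 has_derivative blinfun_apply (f1' p)) (at p) \<and>
           blinfun_apply (f0' p) (1, 0) = blinfun_apply (f1' p) (0, 1) \<and>
           blinfun_apply (f0' p) (0, 1) = - blinfun_apply (f1' p) (1, 0)"
    unfolding slice_components_def by blast
  have dec: "blinfun_apply L h = fst h *\<^sub>R blinfun_apply L (1, 0) + snd h *\<^sub>R blinfun_apply L (0, 1)"
    for L :: "(real \<times> real) \<Rightarrow>\<^sub>L 'n clifford" and h
  proof -
    have "h = fst h *\<^sub>R (1, 0) + snd h *\<^sub>R (0, 1)" by (simp add: prod_eq_iff)
    then show ?thesis by (metis blinfun.add_right blinfun.scaleR_right)
  qed
  define P Q where "P p = blinfun_apply (f0' p) (1, 0)" and "Q p = blinfun_apply (f0' p) (0, 1)" for p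
  have "(f0 has_derivative (\<lambda>h. fst h *\<^sub>R P p + snd h *\<^sub>R Q p)) (at p)"
    "(f1 has_derivative (\<lambda>h. snd h *\<^sub>R P p - fst h *\<^sub>R Q p)) (at p)" if p: "p \<in> slice_dom U" for p
  proof -
    show "(f0 has_derivative (\<lambda>h. fst h *\<^sub>R P p + snd h *\<^sub>R Q p)) (at p)"
      unfolding P_def Q_def using d p by (subst dec[symmetric]) simp
    have "(f1 has_derivative (\<lambda>h. fst h *\<^sub>R blinfun_apply (f1' p) (1, 0) + snd h *\<^sub>R blinfun_apply (f1' p) (0, 1))) (at p)"
      using d p by (subst dec[symmetric]) simp
    then show "(f1 has_derivative (\<lambda>h. snd h *\<^sub>R P p - fst h *\<^sub>R Q p)) (at p)"
      using d p by (simp add: P_def Q_def add.commute)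
  qed
  moreover have "continuous_on (slice_dom U) P" "continuous_on (slice_dom U) Q"
    unfolding P_def[abs_def] Q_def[abs_def] by (intro continuous_intros c)+
  ultimately have "slice_partials U f f0 f1 P Q"
    using * unfolding slice_components_def slice_partials_def by auto
  then show "\<exists>P Q. slice_partials U f f0 f1 P Q" by blast
next
  assume "\<exists>P Q. slice_partials U f f0 f1 P Q"
  then obtain P Q where PQ: "slice_partials U f f0 f1 P Q" by blast
  define L where "L x y = (blinfun_scaleR_left x o\<^sub>L fst_blinfun) + (blinfun_scaleR_left y o\<^sub>L snd_blinfun)" for x y :: "'n clifford"
  have L: "blinfun_apply (L x y) h = fst h *\<^sub>R x + snd h *\<^sub>R y" for x y h
    by (simp add: L_def blinfun.bilinear_simps)
  have cL: "continuous_on (slice_dom U) (\<lambda>p. L (X p) (Y p))"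
    if "continuous_on (slice_dom U) X" "continuous_on (slice_dom U) Y" for X Y
    unfolding L_def using that
    by (intro continuous_intros bounded_bilinear.continuous_on[OF bounded_bilinear_blinfun_compose]
      bounded_linear.continuous_on[OF bounded_linear_blinfun_scaleR_left])
  have "\<exists>f0' f1'. continuous_on (slice_dom U) f0' \<and> continuous_on (slice_dom U) f1' \<and>
        (\<forall>p \<in> slice_dom U. (f0 has_derivative blinfun_apply (f0' p)) (at p) \<and>
           (f1 has_derivative blinfun_apply (f1' p)) (at p) \<and>
           blinfun_apply (f0' p) (1, 0) = blinfun_apply (f1' p) (0, 1) \<and>
           blinfun_apply (f0' p) (0, 1) = - blinfun_apply (f1' p) (1, 0))"
    using slice_partialsD(4-7)[OF PQ]
    by (rule_tac exI[of _ "\<lambda>p. L (P p) (Q p)"], rule_tac exI[of _ "\<lambda>p. L (- Q p) (P p)"])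
      (auto simp: L[abs_def] add.commute intro!: cL continuous_intros)
  then show "slice_components U f f0 f1"
    unfolding slice_components_def using slice_partialsD(1-3)[OF PQ] by auto
qed

section \<open>Closure properties and regularity of slice hyperholomorphic functions\<close>

lemma slice_components_const: "slice_components U (\<lambda>_. a) (\<lambda>_. a) (\<lambda>_. 0)"
  unfolding slice_components_iff slice_partials_def
  by (auto intro!: exI[of _ "\<lambda>_. 0"] simp: lmul.zero_right)

lemma slice_components_diff:
  assumes "slice_components U f f0 f1" "slice_components U k k0 k1"
  shows "slice_components U (\<lambda>s. f s - k s) (\<lambda>p. f0 p - k0 p) (\<lambda>p. f1 p - k1 p)"
proof -
  obtain P Q P' Q' where "slice_partials U f f0 f1 P Q" "slice_partials U k k0 k1 P' Q'"
    using assms by (auto simp: slice_components_iff)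
  note 1 = slice_partialsD[OF this(1)] and 2 = slice_partialsD[OF this(2)]
  have "slice_partials U (\<lambda>s. f s - k s) (\<lambda>p. f0 p - k0 p) (\<lambda>p. f1 p - k1 p) (\<lambda>p. P p - P' p) (\<lambda>p. Q p - Q' p)"
    unfolding slice_partials_def
  proof (intro conjI allI impI ballI)
    fix p assume p: "p \<in> slice_dom U"
    show "((\<lambda>p. f0 p - k0 p) has_derivative (\<lambda>h. fst h *\<^sub>R (P p - P' p) + snd h *\<^sub>R (Q p - Q' p))) (at p)"
      using has_derivative_diff[OF 1(6)[OF p] 2(6)[OF p]] by (simp add: algebra_simps)
    show "((\<lambda>p. f1 p - k1 p) has_derivative (\<lambda>h. snd h *\<^sub>R (P p - P' p) - fst h *\<^sub>R (Q p - Q' p))) (at p)"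
      using has_derivative_diff[OF 1(7)[OF p] 2(7)[OF p]] by (simp add: algebra_simps)
  qed (auto simp: 1(1-3) 2(1-3) lmul.diff_right intro!: continuous_intros 1(4,5) 2(4,5))
  then show ?thesis unfolding slice_components_iff by blast
qed

text \<open>The left factor has real components, which commute with every unit and with all Clifford
  coefficients. Hence the components multiply as real and imaginary parts do, and the Cauchy-Riemann
  equations survive.\<close>

lemma slice_components_lift_mult:
  fixes f :: "'n::{finite,linorder} clifford \<Rightarrow> 'n clifford"
  assumes f: "slice_components (dsector \<theta>) f f0 f1" and \<theta>: "0 < \<theta>" "\<theta> < pi / 2"
    and g: "\<And>z. g (cnj z) = cnj (g z)" "continuous_on (plane_sector \<theta>) g'"
      "\<And>z. z \<in> plane_sector \<theta> \<Longrightarrow> (g has_field_derivative g' z) (at z)"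
  defines "c \<equiv> \<lambda>p. Complex (fst p) (snd p)"
  shows "slice_components (dsector \<theta>) (\<lambda>s. lift g s \<odot> f s)
    (\<lambda>p. Re (g (c p)) *\<^sub>R f0 p - Im (g (c p)) *\<^sub>R f1 p) (\<lambda>p. Re (g (c p)) *\<^sub>R f1 p + Im (g (c p)) *\<^sub>R f0 p)"
proof -
  let ?U = "slice_dom (dsector \<theta> :: 'n clifford set)"
  obtain P Q where "slice_partials (dsector \<theta>) f f0 f1 P Q"
    using f by (auto simp: slice_components_iff)
  note v = slice_partialsD(1-3)[OF this] and PQ = slice_partialsD(4,5)[OF this] and d = slice_partialsD(6,7)[OF this]
  have U: "c p \<in> plane_sector \<theta>" if "p \<in> ?U" for p
    using that by (simp only: slice_dom_dsector[OF \<theta>] c_def)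
  have bl: "bounded_linear c"
    unfolding c_def Complex_eq
    by (intro bounded_linear_add bounded_linear_const_mult bounded_linear_compose[OF bounded_linear_of_real]
        bounded_linear_fst bounded_linear_snd)
  have dg: "((\<lambda>p. g (c p)) has_derivative (\<lambda>h. g' (c p) * c h)) (at p)" if "p \<in> ?U" for p
    using has_derivative_compose[OF bounded_linear_imp_has_derivative[OF bl] g(3)[OF U[OF that], unfolded has_field_derivative_def]] .
  have dRe: "((\<lambda>p. Re (g (c p))) has_derivative (\<lambda>h. fst h * Re (g' (c p)) - snd h * Im (g' (c p)))) (at p)" if "p \<in> ?U" for p
    using has_derivative_Re[OF dg[OF that]] by (simp add: c_def mult.commute)
  have dIm: "((\<lambda>p. Im (g (c p))) has_derivative (\<lambda>h. fst h * Im (g' (c p)) + snd h * Re (g' (c p)))) (at p)" if "p \<in> ?U" for p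
    using has_derivative_Im[OF dg[OF that]] by (simp add: c_def mult.commute)
  have cont: "continuous_on ?U f0" "continuous_on ?U f1" "continuous_on ?U (\<lambda>p. g (c p))"
    using d dg by (meson continuous_at_imp_continuous_on has_derivative_continuous)+
  have cg': "continuous_on ?U (\<lambda>p. g' (c p))"
    by (intro continuous_on_compose2[OF g(2)] linear_continuous_on bl) (use U in auto)
  \<comment> \<open>\<open>P'\<close> and \<open>Q'\<close> are the partial derivatives in
    \<open>x\<close> and \<open>y\<close> of the first component of the product, computed with the
    Cauchy-Riemann equations of \<open>g\<close> and of \<open>f\<close>.\<close>
  define P' where "P' p = Re (g' (c p)) *\<^sub>R f0 p + Re (g (c p)) *\<^sub>R P p - Im (g' (c p)) *\<^sub>R f1 p + Im (g (c p)) *\<^sub>R Q p" for p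
  define Q' where "Q' p = - Im (g' (c p)) *\<^sub>R f0 p + Re (g (c p)) *\<^sub>R Q p - Re (g' (c p)) *\<^sub>R f1 p - Im (g (c p)) *\<^sub>R P p" for p
  have cnj: "g (c (x, - y)) = cnj (g (c (x, y)))" for x y
  proof -
    have "c (x, - y) = cnj (c (x, y))" by (simp add: c_def complex_eq_iff)
    then show ?thesis by (simp add: g(1))
  qed
  have "slice_partials (dsector \<theta>) (\<lambda>s. lift g s \<odot> f s) (\<lambda>p. Re (g (c p)) *\<^sub>R f0 p - Im (g (c p)) *\<^sub>R f1 p)
      (\<lambda>p. Re (g (c p)) *\<^sub>R f1 p + Im (g (c p)) *\<^sub>R f0 p) P' Q'"
    unfolding slice_partials_def
  proof (intro conjI allI impI ballI)
    fix p assume p: "p \<in> ?U"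
    show "((\<lambda>p. Re (g (c p)) *\<^sub>R f0 p - Im (g (c p)) *\<^sub>R f1 p) has_derivative (\<lambda>h. fst h *\<^sub>R P' p + snd h *\<^sub>R Q' p)) (at p)"
      by (rule has_derivative_eq_rhs[OF has_derivative_diff[OF has_derivative_scaleR[OF dRe[OF p] d(1)[OF p]]
          has_derivative_scaleR[OF dIm[OF p] d(2)[OF p]]]])
        (simp add: fun_eq_iff P'_def Q'_def algebra_simps)
    show "((\<lambda>p. Re (g (c p)) *\<^sub>R f1 p + Im (g (c p)) *\<^sub>R f0 p) has_derivative (\<lambda>h. snd h *\<^sub>R P' p - fst h *\<^sub>R Q' p)) (at p)"
      by (rule has_derivative_eq_rhs[OF has_derivative_add[OF has_derivative_scaleR[OF dRe[OF p] d(2)[OF p]]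
          has_derivative_scaleR[OF dIm[OF p] d(1)[OF p]]]])
        (simp add: fun_eq_iff P'_def Q'_def algebra_simps)
  next
    show "continuous_on ?U P'" "continuous_on ?U Q'"
      unfolding P'_def[abs_def] Q'_def[abs_def] by (intro continuous_intros PQ cont cg')+
  next
    fix x y and J :: "'n clifford" assume xy: "(x, y) \<in> ?U" and J: "J \<in> imag_sphere"
    have "slice J x y = cslice J (c (x, y))" by (simp add: cslice_def c_def)
    then have "lift g (slice J x y) = cslice J (g (c (x, y)))"
      by (simp add: lift_cslice J g(1))
    then show "lift g (slice J x y) \<odot> f (slice J x y) =
      Re (g (c (x, y))) *\<^sub>R f0 (x, y) - Im (g (c (x, y))) *\<^sub>R f1 (x, y)
      + J \<odot> (Re (g (c (x, y))) *\<^sub>R f1 (x, y) + Im (g (c (x, y))) *\<^sub>R f0 (x, y))"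
      by (simp add: v(1)[OF xy J] cslice_lmul lmul.add_right lmul.scaleR_right imag_sphere_square_action[OF J] algebra_simps)
  qed (simp_all add: cnj v(2,3))
  then show ?thesis unfolding slice_components_iff by blast
qed

lemma SH_L_continuous_ray:
  fixes f :: "'n::{finite,linorder} clifford \<Rightarrow> 'n clifford"
  assumes f: "f \<in> SH_L (dsector \<theta>)" and \<theta>: "0 < \<theta>" "\<theta> < pi / 2"
    and J: "J \<in> imag_sphere" and \<phi>: "\<phi> \<in> angles \<theta>"
  shows "continuous_on {0<..} (\<lambda>t. f (t *\<^sub>R expi J \<phi>))"
proof -
  let ?U = "slice_dom (dsector \<theta> :: 'n clifford set)"
  obtain f0 f1 where f': "slice_components (dsector \<theta>) f f0 f1" using f by (auto simp: SH_L_def)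
  obtain P Q where "slice_partials (dsector \<theta>) f f0 f1 P Q"
    using f' by (auto simp: slice_components_iff)
  note v = slice_partialsD(1)[OF this] and d = slice_partialsD(6,7)[OF this]
  have cont: "continuous_on ?U f0" "continuous_on ?U f1"
    using d by (meson continuous_at_imp_continuous_on has_derivative_continuous)+
  have eq: "t *\<^sub>R expi J \<phi> = slice J (t * cos \<phi>) (t * sin \<phi>)" for t
    by (simp add: expi_def slice_def scaleR_add_right axis_mult)
  have U: "(t * cos \<phi>, t * sin \<phi>) \<in> ?U" if "t > 0" for t
  proof -
    have "t *\<^sub>R expi J \<phi> \<in> dsector \<theta>" using that J \<phi> by (auto simp: dsector_def)
    then show ?thesis
      using J \<theta> by (simp add: eq dsector_slice slice_dom_dsector plane_sector_def)
  qed
  have "continuous_on {0<..} (\<lambda>t. f0 (t * cos \<phi>, t * sin \<phi>) + J \<odot> f1 (t * cos \<phi>, t * sin \<phi>))"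
    by (intro continuous_intros lmul.continuous_on continuous_on_compose2[OF cont(1)] continuous_on_compose2[OF cont(2)])
      (use U in auto)
  then show ?thesis
    by (rule continuous_on_eq) (simp add: eq v U J)
qed

text \<open>Measurability allows nonnegative integrals of sums to be split; it follows from
  continuity along the ray, away from 0.\<close>

lemma SH_L_ray_measurable:
  assumes "f \<in> SH_L (dsector \<theta>)" "0 < \<theta>" "\<theta> < pi / 2" "J \<in> imag_sphere" "\<phi> \<in> angles \<theta>"
    and S: "open S" "S \<subseteq> {0<..}"
  shows "(\<lambda>t. ennreal (norm (f (t *\<^sub>R expi J \<phi>) - a) / t) * indicator S t) \<in> borel_measurable lborel"
proof -
  have "continuous_on S (\<lambda>t. norm (f (t *\<^sub>R expi J \<phi>) - a) / t)"
    by (intro continuous_intros continuous_on_subset[OF SH_L_continuous_ray[OF assms(1-5)] S(2)]) (use S in auto)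
  then have "(\<lambda>t. indicator S t *\<^sub>R (norm (f (t *\<^sub>R expi J \<phi>) - a) / t)) \<in> borel_measurable borel"
    by (rule borel_measurable_continuous_on_indicator[rotated]) (use S in auto)
  then have "(\<lambda>t. ennreal (indicator S t *\<^sub>R (norm (f (t *\<^sub>R expi J \<phi>) - a) / t))) \<in> borel_measurable lborel"
    by simp
  then show ?thesis
    by (rule measurable_cong[THEN iffD1, rotated]) (auto simp: indicator_def)
qed

section \<open>Decay on double sectors\<close>

definition quad_inv :: "complex \<Rightarrow> complex" where "quad_inv z = 1 / (1 + z\<^sup>2)"

lemma quad_inv_cnj: "quad_inv (cnj z) = cnj (quad_inv z)"
  by (simp add: quad_inv_def)

lemma plane_sector_nonzero: "z \<in> plane_sector \<theta> \<Longrightarrow> 1 + z\<^sup>2 \<noteq> 0"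
  by (auto simp: plane_sector_def complex_eq_iff power2_eq_square add_nonneg_eq_0_iff)

text \<open>On the sector \<open>\<bar>Re z\<bar>\<close> is at least
  \<open>cmod z * cos \<theta>\<close>, after which \<open>norm_one_plus_square\<close>
  applies.\<close>

lemma quad_inv_bound:
  assumes z: "z \<in> plane_sector \<theta>" and \<theta>: "0 < \<theta>" "\<theta> < pi / 2"
  shows "cmod (quad_inv z) \<le> 1 / (cos \<theta> * (1 + (cmod z)\<^sup>2))"
proof -
  have c: "cos \<theta> > 0" "sin \<theta> > 0" using \<theta> by (auto intro!: cos_gt_zero sin_gt_zero)
  have "cmod z * cos \<theta> \<le> \<bar>Re z\<bar>"
  proof (rule power2_le_imp_le)
    have "\<bar>Im z\<bar> * cos \<theta> \<le> \<bar>Re z\<bar> * sin \<theta>"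
      using z c by (simp add: plane_sector_def tan_def field_simps)
    then have "(\<bar>Im z\<bar> * cos \<theta>)\<^sup>2 \<le> (\<bar>Re z\<bar> * sin \<theta>)\<^sup>2"
      using c by (intro power_mono) auto
    moreover have "(Re z)\<^sup>2 * (sin \<theta>)\<^sup>2 = (Re z)\<^sup>2 - (Re z)\<^sup>2 * (cos \<theta>)\<^sup>2"
      by (simp add: sin_squared_eq algebra_simps)
    ultimately show "(cmod z * cos \<theta>)\<^sup>2 \<le> \<bar>Re z\<bar>\<^sup>2"
      by (simp add: power_mult_distrib cmod_power2 distrib_right)
  qed simp
  moreover have nz: "cmod z > 0" using z by (auto simp: plane_sector_def)
  ultimately have "cos \<theta> \<le> \<bar>Re z\<bar> / cmod z" by (simp add: field_simps)
  then have "cos \<theta> * (1 + (cmod z)\<^sup>2) \<le> \<bar>Re z\<bar> / cmod z * (1 + (cmod z)\<^sup>2)"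
    by (rule mult_right_mono) simp
  also have "\<dots> \<le> cmod (1 + z\<^sup>2)"
    using nz by (intro norm_one_plus_square) auto
  finally show ?thesis
    unfolding quad_inv_def norm_divide norm_one
    by (intro divide_left_mono mult_pos_pos) (use c plane_sector_nonzero[OF z] in \<open>auto simp: add_pos_nonneg\<close>)
qed

lemma quad_inv_bounded:
  assumes "z \<in> plane_sector \<theta>" "0 < \<theta>" "\<theta> < pi / 2"
  shows "cmod (quad_inv z) \<le> 1 / cos \<theta>"
proof -
  have c: "cos \<theta> > 0" using assms by (intro cos_gt_zero) auto
  have "1 / (cos \<theta> * (1 + (cmod z)\<^sup>2)) \<le> 1 / (cos \<theta> * 1)"
    using c by (intro divide_left_mono mult_left_mono mult_pos_pos) (auto simp: add_pos_nonneg)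
  then show ?thesis using quad_inv_bound[OF assms] by simp
qed

lemma one_minus_quad_inv: "z \<in> plane_sector \<theta> \<Longrightarrow> 1 - quad_inv z = z\<^sup>2 * quad_inv z"
  using plane_sector_nonzero[of z \<theta>] by (simp add: quad_inv_def field_simps)

lemma ray_cslice: "t *\<^sub>R expi J \<phi> = cslice J (of_real t * cis \<phi>)"
  by (simp only: expi_cslice cslice_scaleR[symmetric] scaleR_conv_of_real[of t "cis \<phi>"])

lemma ray_dsector: "t > 0 \<Longrightarrow> J \<in> imag_sphere \<Longrightarrow> \<phi> \<in> angles \<theta> \<Longrightarrow> t *\<^sub>R expi J \<phi> \<in> dsector \<theta>"
  by (auto simp: dsector_def)

lemma norm_ray: "t > 0 \<Longrightarrow> J \<in> imag_sphere \<Longrightarrow> norm (t *\<^sub>R expi J \<phi>) = t"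
  by (simp add: expi_cslice norm_cslice)

lemma lift_dsector:
  assumes "s \<in> dsector \<theta>" "0 < \<theta>" "\<theta> < pi / 2" and g: "\<And>z. g (cnj z) = cnj (g z)"
  obtains J z where "J \<in> imag_sphere" "z \<in> plane_sector \<theta>" "s = cslice J z" "norm s = cmod z"
    "lift (\<lambda>z. g (quad_inv z)) s = cslice J (g (quad_inv z))"
    "norm (lift (\<lambda>z. g (quad_inv z)) s) = cmod (g (quad_inv z))"
    "pv_inverse (axis {} 1 + s \<odot> s) = cslice J (quad_inv z)"
proof -
  obtain J z where Jz: "J \<in> imag_sphere" "z \<in> plane_sector \<theta>" "s = cslice J z"
    using dsectorE[OF assms(1-3)] by blast
  have "lift (\<lambda>z. g (quad_inv z)) s = cslice J (g (quad_inv z))"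
    unfolding Jz(3) by (rule lift_cslice[OF Jz(1)]) (simp add: quad_inv_cnj g)
  moreover have "axis {} 1 + s \<odot> s = cslice J (1 + z\<^sup>2)"
    unfolding Jz(3) cslice_mult[OF Jz(1)] cslice_add power2_eq_square
    using cslice_of_real[of J 1] by simp
  then have "pv_inverse (axis {} 1 + s \<odot> s) = cslice J (quad_inv z)"
    by (simp add: pv_inverse_cslice Jz(1) quad_inv_def)
  ultimately show ?thesis
    using that[OF Jz] Jz by (simp add: norm_cslice)
qed

lemma lift_mult_components:
  fixes f :: "'n::{finite,linorder} clifford \<Rightarrow> 'n clifford"
  assumes f: "slice_components (dsector \<theta>) f f0 f1" and \<theta>: "0 < \<theta>" "\<theta> < pi / 2"
    and g: "\<And>z. g (cnj z) = cnj (g z)" "continuous_on UNIV g'" "\<And>z. (g has_field_derivative g' z) (at z)"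
  defines "c \<equiv> \<lambda>p. g (quad_inv (Complex (fst p) (snd p)))"
  shows "slice_components (dsector \<theta>) (\<lambda>s. lift (\<lambda>z. g (quad_inv z)) s \<odot> f s)
    (\<lambda>p. Re (c p) *\<^sub>R f0 p - Im (c p) *\<^sub>R f1 p) (\<lambda>p. Re (c p) *\<^sub>R f1 p + Im (c p) *\<^sub>R f0 p)"
  unfolding c_def
proof (rule slice_components_lift_mult[OF f \<theta>, where g' = "\<lambda>z. g' (quad_inv z) * - (2 * z * (quad_inv z)\<^sup>2)"])
  show "g (quad_inv (cnj z)) = cnj (g (quad_inv z))" for z by (simp add: quad_inv_cnj g)
  have q: "continuous_on (plane_sector \<theta>) quad_inv"
    unfolding quad_inv_def[abs_def] by (intro continuous_intros) (auto dest: plane_sector_nonzero)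
  then show "continuous_on (plane_sector \<theta>) (\<lambda>z. g' (quad_inv z) * - (2 * z * (quad_inv z)\<^sup>2))"
    by (intro continuous_intros continuous_on_compose2[OF g(2) q]) auto
  fix z assume z: "z \<in> plane_sector \<theta>"
  have "(quad_inv has_field_derivative - (2 * z * (quad_inv z)\<^sup>2)) (at z)"
    unfolding quad_inv_def[abs_def] using plane_sector_nonzero[OF z]
    by (auto intro!: derivative_eq_intros simp: power2_eq_square)
  from DERIV_chain[OF g(3) this]
  show "((\<lambda>z. g (quad_inv z)) has_field_derivative g' (quad_inv z) * - (2 * z * (quad_inv z)\<^sup>2)) (at z)"
    by (simp add: o_def)
qed

lemma lift_mult_SH_L:
  fixes f :: "'n::{finite,linorder} clifford \<Rightarrow> 'n clifford"
  assumes "f \<in> SH_L (dsector \<theta>)" and \<theta>: "0 < \<theta>" "\<theta> < pi / 2"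
    and "\<And>z. g (cnj z) = cnj (g z)" "continuous_on UNIV g'" "\<And>z. (g has_field_derivative g' z) (at z)"
  shows "(\<lambda>s. lift (\<lambda>z. g (quad_inv z)) s \<odot> f s) \<in> SH_L (dsector \<theta>)"
  using assms lift_mult_components[OF _ \<theta> assms(4-6)] unfolding SH_L_def by blast

lemma SH_L_diff: "f \<in> SH_L U \<Longrightarrow> k \<in> SH_L U \<Longrightarrow> (\<lambda>s. f s - k s) \<in> SH_L U"
  unfolding SH_L_def using slice_components_diff by blast

lemma lift_intrinsic:
  assumes \<theta>: "0 < \<theta>" "\<theta> < pi / 2"
    and g: "\<And>z. g (cnj z) = cnj (g z)" "continuous_on UNIV g'" "\<And>z. (g has_field_derivative g' z) (at z)"
  shows "lift (\<lambda>z. g (quad_inv z)) \<in> (SH_intrinsic (dsector \<theta>) :: ('n::{finite,linorder} clifford \<Rightarrow> _) set)"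
proof -
  let ?c = "\<lambda>p. g (quad_inv (Complex (fst p) (snd p)))"
  have "slice_components (dsector \<theta>) (lift (\<lambda>z. g (quad_inv z)) :: 'n clifford \<Rightarrow> _)
      (\<lambda>p. Re (?c p) *\<^sub>R axis {} 1 - Im (?c p) *\<^sub>R 0) (\<lambda>p. Re (?c p) *\<^sub>R 0 + Im (?c p) *\<^sub>R axis {} 1)"
    using lift_mult_components[OF slice_components_const[of "dsector \<theta>" "axis {} 1"] \<theta> g] by (simp only: lmul_one_right)
  moreover have "r *\<^sub>R axis {} 1 \<in> range (axis {} :: real \<Rightarrow> 'n clifford)" for r
    using axis_mult[of "{}" r 1] by (metis rangeI)
  ultimately show ?thesis
    unfolding SH_intrinsic_def by auto
qed

lemma nn_integral_inverse_square: "(\<integral>\<^sup>+t\<in>{0<..}. ennreal (C / (1 + t\<^sup>2)) \<partial>lborel) < \<infinity>" if "C \<ge> 0"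
proof -
  have "(\<integral>\<^sup>+t\<in>{0..}. ennreal (C / (1 + t\<^sup>2)) \<partial>lborel) = ennreal (C * (pi / 2) - C * arctan 0)"
    using that
    by (intro nn_integral_FTC_atLeast tendsto_mult tendsto_const tendsto_arctan_at_top)
      (auto intro!: derivative_eq_intros simp: divide_inverse add_nonneg_eq_0_iff)
  moreover have "(\<integral>\<^sup>+t\<in>{0<..}. ennreal (C / (1 + t\<^sup>2)) \<partial>lborel) \<le> (\<integral>\<^sup>+t\<in>{0..}. ennreal (C / (1 + t\<^sup>2)) \<partial>lborel)"
    by (intro nn_integral_mono) (auto simp: indicator_def)
  ultimately show ?thesis by (simp add: order_le_less_trans)
qed

text \<open>Divided by \<open>t\<close>, the bound on a ray becomes \<open>C / (1 + t^2)\<close>,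
  which is integrable.\<close>

lemma SH_L0I:
  assumes f: "f \<in> SH_L (dsector \<theta>)" and C: "C \<ge> 0"
    and bd: "\<And>s. s \<in> dsector \<theta> \<Longrightarrow> norm (f s) \<le> C * norm s / (1 + (norm s)\<^sup>2)"
  shows "f \<in> SH_L0 \<theta>"
proof -
  have le: "r / (1 + r\<^sup>2) \<le> 1" for r :: real
    using le_one_plus_square[of r] by (simp add: divide_le_eq add_pos_nonneg)
  have "norm (f s) \<le> C" if "s \<in> dsector \<theta>" for s
    using bd[OF that] mult_left_mono[OF le C, of "norm s"] by simp
  then have "bounded (f ` dsector \<theta>)" unfolding bounded_iff by blast
  moreover have "(\<integral>\<^sup>+t\<in>{0<..}. ennreal (norm (f (t *\<^sub>R expi J \<phi>)) / t) \<partial>lborel) < \<infinity>"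
    if J: "J \<in> imag_sphere" and \<phi>: "\<phi> \<in> angles \<theta>" for J \<phi>
  proof -
    have "norm (f (t *\<^sub>R expi J \<phi>)) / t \<le> C / (1 + t\<^sup>2)" if t: "t > 0" for t
      using divide_right_mono[OF bd[OF ray_dsector[OF t J \<phi>]], of t] t unfolding norm_ray[OF t J] by simp
    then have "(\<integral>\<^sup>+t\<in>{0<..}. ennreal (norm (f (t *\<^sub>R expi J \<phi>)) / t) \<partial>lborel)
        \<le> (\<integral>\<^sup>+t\<in>{0<..}. ennreal (C / (1 + t\<^sup>2)) \<partial>lborel)"
      by (intro nn_integral_mono) (auto simp: indicator_def intro: ennreal_leI)
    then show ?thesis
      using nn_integral_inverse_square[OF C] by (rule order_le_less_trans)
  qed
  ultimately show ?thesis using f by (simp add: SH_L0_def)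
qed

text \<open>Combines \<open>fcalc_bound\<close> on the disc of radius
  \<open>1 / cos \<theta>\<close> with \<open>u (1 - u) = z^2 u^2\<close>.\<close>

lemma fcalc_lift_bound:
  assumes g: "fcalc A g G" and \<theta>: "0 < \<theta>" "\<theta> < pi / 2"
  obtains C where "C \<ge> 0"
    "\<And>s :: 'n::{finite,linorder} clifford. s \<in> dsector \<theta> \<Longrightarrow> norm (lift (\<lambda>z. g (quad_inv z)) s) \<le> C * (norm s)\<^sup>2 / (1 + (norm s)\<^sup>2)\<^sup>2"
proof -
  obtain E where E: "E \<ge> 0" "\<And>z. cmod z \<le> 1 / cos \<theta> \<Longrightarrow> cmod (g z) \<le> E * cmod (z * (1 - z))"
    using fcalc_bound[OF g] by blast
  show ?thesis
  proof (rule that[of "E / (cos \<theta>)\<^sup>2"])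
    fix s :: "'n clifford" assume s: "s \<in> dsector \<theta>"
    obtain J z where z: "z \<in> plane_sector \<theta>" "norm s = cmod z"
        "norm (lift (\<lambda>z. g (quad_inv z)) s) = cmod (g (quad_inv z))"
      using lift_dsector[OF s \<theta>, of g] fcalc_cnj[OF g] by metis
    have "cmod (g (quad_inv z)) \<le> E * cmod (quad_inv z * (1 - quad_inv z))"
      by (rule E(2)[OF quad_inv_bounded[OF z(1) \<theta>]])
    also have "cmod (quad_inv z * (1 - quad_inv z)) = (cmod (quad_inv z))\<^sup>2 * (cmod z)\<^sup>2"
      unfolding one_minus_quad_inv[OF z(1)] by (simp add: norm_mult norm_power power2_eq_square)
    also have "E * \<dots> \<le> E * ((1 / (cos \<theta> * (1 + (cmod z)\<^sup>2)))\<^sup>2 * (cmod z)\<^sup>2)"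
      using quad_inv_bound[OF z(1) \<theta>] E by (intro mult_left_mono mult_right_mono power_mono) auto
    also have "\<dots> = E / (cos \<theta>)\<^sup>2 * (cmod z)\<^sup>2 / (1 + (cmod z)\<^sup>2)\<^sup>2"
      by (simp add: power_divide power_mult_distrib)
    finally show "norm (lift (\<lambda>z. g (quad_inv z)) s) \<le> E / (cos \<theta>)\<^sup>2 * (norm s)\<^sup>2 / (1 + (norm s)\<^sup>2)\<^sup>2"
      unfolding z(2,3) .
  qed (use E in simp)
qed

lemma square_quotient_le: "r\<^sup>2 / (1 + r\<^sup>2)\<^sup>2 \<le> r / (1 + r\<^sup>2)" if "r \<ge> 0" for r :: real
proof -
  have "r * r \<le> r * (1 + r\<^sup>2)"
    using that le_one_plus_square[of r] by (intro mult_left_mono) auto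
  then have "r\<^sup>2 / (1 + r\<^sup>2)\<^sup>2 \<le> r * (1 + r\<^sup>2) / (1 + r\<^sup>2)\<^sup>2"
    by (intro divide_right_mono) (auto simp: power2_eq_square)
  then show ?thesis
    using add_pos_nonneg[OF zero_less_one zero_le_power2[of r]] by (simp add: power2_eq_square[of "1 + r\<^sup>2"])
qed

lemma fcalc_intrinsic0:
  assumes g: "fcalc A g G" and \<theta>: "0 < \<theta>" "\<theta> < pi / 2"
  shows "lift (\<lambda>z. g (quad_inv z)) \<in> (intrinsic0 \<theta> :: ('n::{finite,linorder} clifford \<Rightarrow> _) set)"
proof -
  obtain g' where g': "continuous_on UNIV g'" "\<And>z. (g has_field_derivative g' z) (at z)"
    using fcalc_differentiable[OF g] by blast
  have i: "lift (\<lambda>z. g (quad_inv z)) \<in> (SH_intrinsic (dsector \<theta>) :: ('n clifford \<Rightarrow> _) set)"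
    by (rule lift_intrinsic[OF \<theta> fcalc_cnj[OF g] g'])
  obtain C where C: "C \<ge> 0"
    "\<And>s :: 'n clifford. s \<in> dsector \<theta> \<Longrightarrow> norm (lift (\<lambda>z. g (quad_inv z)) s) \<le> C * (norm s)\<^sup>2 / (1 + (norm s)\<^sup>2)\<^sup>2"
    using fcalc_lift_bound[OF g \<theta>] by blast
  have "lift (\<lambda>z. g (quad_inv z)) \<in> (SH_L0 \<theta> :: ('n clifford \<Rightarrow> _) set)"
  proof (rule SH_L0I[OF _ C(1)])
    show "lift (\<lambda>z. g (quad_inv z)) \<in> (SH_L (dsector \<theta>) :: ('n clifford \<Rightarrow> _) set)"
      using i by (auto simp: SH_intrinsic_def SH_L_def)
    show "norm (lift (\<lambda>z. g (quad_inv z)) s) \<le> C * norm s / (1 + (norm s)\<^sup>2)" if "s \<in> dsector \<theta>" for s :: "'n clifford"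
      using C(2)[OF that] mult_left_mono[OF square_quotient_le[of "norm s"] C(1)] by simp
  qed
  with i show ?thesis by (simp add: intrinsic0_def)
qed

text \<open>With respect to \<open>dt / t\<close> the interval from \<open>x\<close> to
  \<open>x * exp N\<close> has length \<open>N\<close>, so the integral is at least
  \<open>N * \<delta>\<close> for every \<open>N\<close>.\<close>

lemma nn_integral_log_divergent:
  fixes h :: "real \<Rightarrow> real"
  assumes \<delta>: "\<delta> > 0" and big: "\<And>N :: nat. \<exists>x>0. \<forall>t. x \<le> t \<and> t \<le> x * exp (real N) \<longrightarrow> \<delta> \<le> h t"
  shows "(\<integral>\<^sup>+t\<in>{0<..}. ennreal (h t / t) \<partial>lborel) = \<infinity>"
proof -
  have "ennreal (real N * \<delta>) \<le> (\<integral>\<^sup>+t\<in>{0<..}. ennreal (h t / t) \<partial>lborel)" for N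
  proof -
    obtain x where x: "x > 0" "\<And>t. x \<le> t \<Longrightarrow> t \<le> x * exp (real N) \<Longrightarrow> \<delta> \<le> h t"
      using big by blast
    have "(\<integral>\<^sup>+t\<in>{x..x * exp (real N)}. ennreal (\<delta> / t) \<partial>lborel) = ennreal (\<delta> * ln (x * exp (real N)) - \<delta> * ln x)"
      using x \<delta> by (intro nn_integral_FTC_Icc) (auto intro!: derivative_eq_intros simp: divide_inverse)
    also have "\<delta> * ln (x * exp (real N)) - \<delta> * ln x = real N * \<delta>"
      using x by (simp add: ln_mult algebra_simps)
    finally have "ennreal (real N * \<delta>) = (\<integral>\<^sup>+t\<in>{x..x * exp (real N)}. ennreal (\<delta> / t) \<partial>lborel)" ..
    also have "\<dots> \<le> (\<integral>\<^sup>+t\<in>{0<..}. ennreal (h t / t) \<partial>lborel)"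
      using x by (intro nn_integral_mono) (auto simp: indicator_def intro!: ennreal_leI divide_right_mono)
    finally show ?thesis .
  qed
  moreover have "\<exists>N. c < ennreal (real N * \<delta>)" if "c < \<infinity>" for c
  proof -
    obtain N :: nat where "enn2real c / \<delta> < real N" using reals_Archimedean2 by blast
    then have "enn2real c < real N * \<delta>" using \<delta> by (simp add: field_simps)
    then show ?thesis using that by (intro exI[of _ N]) (metis ennreal_enn2real ennreal_lessI enn2real_nonneg infinity_ennreal_def order_le_less_trans)
  qed
  ultimately show ?thesis
    by (metis infinity_ennreal_def leD top.not_eq_extremum)
qed

text \<open>Makes the choice in \<open>ext_calculus\<close> harmless. On the positive real axis two
  decompositions differ by \<open>\<beta> + \<gamma> / (1 + t^2)\<close>, which must be integrable
  against \<open>dt / t\<close>: a nonzero \<beta> contradicts this at infinity, and then a nonzero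
  \<gamma> contradicts it at 0.\<close>

lemma bnd_components_unique:
  fixes f :: "'n::{finite,linorder} clifford \<Rightarrow> 'n clifford"
  assumes \<theta>: "0 < \<theta>" "\<theta> < pi / 2"
    and 1: "bnd_components \<theta> f a b k" and 2: "bnd_components \<theta> f a' b' k'"
  shows "a = a'" "b = b'" "\<And>s. s \<in> dsector \<theta> \<Longrightarrow> k s = k' s"
proof -
  define J :: "'n clifford" where "J = axis {undefined} 1"
  have J: "J \<in> imag_sphere" by (simp add: J_def generator_imag_sphere)
  have 0: "0 \<in> angles \<theta>" using \<theta> by (simp add: angles_def)
  define h where "h t = norm (k (t *\<^sub>R expi J 0) - k' (t *\<^sub>R expi J 0))" for t
  have fin: "(\<integral>\<^sup>+t\<in>{0<..}. ennreal (h t / t) \<partial>lborel) < \<infinity>"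
  proof -
    have kk: "k \<in> SH_L0 \<theta>" "k' \<in> SH_L0 \<theta>" using 1 2 by (auto simp: bnd_components_def)
    have meas: "(\<lambda>t. ennreal (norm (k (t *\<^sub>R expi J 0)) / t) * indicator {0<..} t) \<in> borel_measurable lborel"
      if "k \<in> SH_L0 \<theta>" for k :: "'n clifford \<Rightarrow> 'n clifford"
      using SH_L_ray_measurable[OF _ \<theta> J 0, of k "{0<..}" 0] that by (simp add: SH_L0_def)
    have "(\<integral>\<^sup>+t\<in>{0<..}. ennreal (h t / t) \<partial>lborel)
        \<le> (\<integral>\<^sup>+t. ennreal (norm (k (t *\<^sub>R expi J 0)) / t) * indicator {0<..} t
              + ennreal (norm (k' (t *\<^sub>R expi J 0)) / t) * indicator {0<..} t \<partial>lborel)"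
    proof (intro nn_integral_mono)
      fix t :: real
      have "h t / t \<le> norm (k (t *\<^sub>R expi J 0)) / t + norm (k' (t *\<^sub>R expi J 0)) / t" if "t > 0"
        unfolding add_divide_distrib[symmetric] h_def using that
        by (intro divide_right_mono norm_triangle_ineq4) auto
      then show "ennreal (h t / t) * indicator {0<..} t \<le> ennreal (norm (k (t *\<^sub>R expi J 0)) / t) * indicator {0<..} t
              + ennreal (norm (k' (t *\<^sub>R expi J 0)) / t) * indicator {0<..} t"
        by (auto simp: indicator_def ennreal_plus[symmetric] simp del: ennreal_plus intro!: ennreal_leI)
    qed
    also have "\<dots> = (\<integral>\<^sup>+t\<in>{0<..}. ennreal (norm (k (t *\<^sub>R expi J 0)) / t) \<partial>lborel)
        + (\<integral>\<^sup>+t\<in>{0<..}. ennreal (norm (k' (t *\<^sub>R expi J 0)) / t) \<partial>lborel)"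
      by (intro nn_integral_add meas kk)
    also have "\<dots> < \<infinity>"
      using kk J 0 by (auto simp: SH_L0_def)
    finally show ?thesis .
  qed
  define \<beta> where "\<beta> = b' - b"
  define \<gamma> where "\<gamma> = (a' - b') - (a - b)"
  have heq: "h t = norm (\<beta> + (1 / (1 + t\<^sup>2)) *\<^sub>R \<gamma>)" if t: "t > 0" for t
  proof -
    define s where "s = t *\<^sub>R expi J 0"
    have s: "s \<in> dsector \<theta>" unfolding s_def by (rule ray_dsector[OF t J 0])
    have eq: "s = cslice J (of_real t)"
      by (simp add: s_def ray_cslice)
    have "axis {} 1 + s \<odot> s = cslice J (of_real (1 + t\<^sup>2))"
      unfolding eq cslice_mult[OF J] using cslice_add[of J 1 "of_real t * of_real t"] cslice_of_real[of J 1]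
      by (simp add: power2_eq_square)
    then have "pv_inverse (axis {} 1 + s \<odot> s) = cslice J (of_real (1 / (1 + t\<^sup>2)))"
      by (simp add: pv_inverse_cslice J)
    then have p: "pv_inverse (axis {} 1 + s \<odot> s) \<odot> x = (1 / (1 + t\<^sup>2)) *\<^sub>R x" for x :: "'n clifford"
      by (simp only: cslice_of_real lmul_scalar)
    have "b + (1 / (1 + t\<^sup>2)) *\<^sub>R (a - b) + k s = b' + (1 / (1 + t\<^sup>2)) *\<^sub>R (a' - b') + k' s"
      using 1 2 s unfolding bnd_components_def p[symmetric] by metis
    moreover have "x - y = \<beta> + c *\<^sub>R \<gamma>" if "b + c *\<^sub>R (a - b) + x = b' + c *\<^sub>R (a' - b') + y" for x y c
    proof -
      have "x - y = (b + c *\<^sub>R (a - b) + x) - (b + c *\<^sub>R (a - b) + y)" by simp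
      also have "\<dots> = \<beta> + c *\<^sub>R \<gamma>" unfolding that \<beta>_def \<gamma>_def by (simp add: scaleR_diff_right)
      finally show ?thesis .
    qed
    ultimately have "k s - k' s = \<beta> + (1 / (1 + t\<^sup>2)) *\<^sub>R \<gamma>" by blast
    then show ?thesis by (simp add: h_def s_def)
  qed
  have \<beta>: "\<beta> = 0"
  proof (rule ccontr)
    assume nz: "\<beta> \<noteq> 0"
    have "((\<lambda>t. norm (\<beta> + (1 / (1 + t\<^sup>2)) *\<^sub>R \<gamma>)) \<longlongrightarrow> norm (\<beta> + 0 *\<^sub>R \<gamma>)) at_top"
      by (intro tendsto_intros) real_asymp
    then have "\<forall>\<^sub>F t in at_top. norm \<beta> / 2 < norm (\<beta> + (1 / (1 + t\<^sup>2)) *\<^sub>R \<gamma>)"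
      using nz by (intro order_tendstoD(1)) auto
    then obtain x where x: "\<And>t. t \<ge> x \<Longrightarrow> norm \<beta> / 2 < norm (\<beta> + (1 / (1 + t\<^sup>2)) *\<^sub>R \<gamma>)"
      unfolding eventually_at_top_linorder by blast
    have "(\<integral>\<^sup>+t\<in>{0<..}. ennreal (h t / t) \<partial>lborel) = \<infinity>"
    proof (rule nn_integral_log_divergent[of "norm \<beta> / 2"])
      show "\<exists>y>0. \<forall>t. y \<le> t \<and> t \<le> y * exp (real N) \<longrightarrow> norm \<beta> / 2 \<le> h t" for N
      proof (intro exI[of _ "max x 1"] conjI allI impI)
        fix t assume "max x 1 \<le> t \<and> t \<le> max x 1 * exp (real N)"
        then show "norm \<beta> / 2 \<le> h t" using x[of t] heq[of t] by simp
      qed simp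
    qed (use nz in simp)
    then show False using fin by simp
  qed
  have \<gamma>: "\<gamma> = 0"
  proof (rule ccontr)
    assume nz: "\<gamma> \<noteq> 0"
    have "((\<lambda>t. norm (\<beta> + (1 / (1 + t\<^sup>2)) *\<^sub>R \<gamma>)) \<longlongrightarrow> norm (\<beta> + (1 / (1 + 0\<^sup>2)) *\<^sub>R \<gamma>)) (at_right 0)"
      by (intro tendsto_intros) auto
    then have "\<forall>\<^sub>F t in at_right 0. norm \<gamma> / 2 < norm (\<beta> + (1 / (1 + t\<^sup>2)) *\<^sub>R \<gamma>)"
      using nz by (intro order_tendstoD(1)) (auto simp: \<beta>)
    then obtain x where x: "x > 0" "\<And>t. 0 < t \<Longrightarrow> t < x \<Longrightarrow> norm \<gamma> / 2 < norm (\<beta> + (1 / (1 + t\<^sup>2)) *\<^sub>R \<gamma>)"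
      unfolding eventually_at_right_field by blast
    have "(\<integral>\<^sup>+t\<in>{0<..}. ennreal (h t / t) \<partial>lborel) = \<infinity>"
    proof (rule nn_integral_log_divergent[of "norm \<gamma> / 2"])
      show "\<exists>y>0. \<forall>t. y \<le> t \<and> t \<le> y * exp (real N) \<longrightarrow> norm \<gamma> / 2 \<le> h t" for N
      \<comment> \<open>The interval of logarithmic length \<open>N\<close> is placed so that it
        ends at \<open>x / 2\<close>, inside the range where the lower bound holds.\<close>
      proof (intro exI[of _ "x / 2 * exp (- real N)"] conjI allI impI)
        fix t assume t: "x / 2 * exp (- real N) \<le> t \<and> t \<le> x / 2 * exp (- real N) * exp (real N)"
        moreover have "x / 2 * exp (- real N) > 0" using x by simp
        moreover have "x / 2 * exp (- real N) * exp (real N) = x / 2"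
          by (simp add: exp_minus)
        ultimately have "0 < t" "t < x" using x(1) by linarith+
        then show "norm \<gamma> / 2 \<le> h t" using x(2)[of t] heq[of t] by simp
      qed (use x in simp)
    qed (use nz in simp)
    then show False using fin by simp
  qed
  show b: "b = b'" using \<beta> by (simp add: \<beta>_def)
  show a: "a = a'" using \<gamma> by (simp add: \<gamma>_def b)
  show "k s = k' s" if "s \<in> dsector \<theta>" for s
    using 1 2 that unfolding bnd_components_def a b by (metis add_left_cancel)
qed

section \<open>Regularizers\<close>

text \<open>A power of \<open>u\<close> is not divisible by \<open>1 - u\<close>; subtracting
  \<open>u\<close> repairs this. The subtracted term reappears as \<open>A\<close>, so that
  \<open>A + G\<close> is the corresponding power of \<open>A\<close>.\<close>

lemma fcalc_power:
  "\<exists>G. fcalc A (\<lambda>u. u ^ Suc m - u) G \<and> (\<forall>v. A v + G v = ((blinfun_apply A) ^^ Suc m) v)"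
proof (induction m)
  case 0
  \<comment> \<open>The zero function is obtained as a difference of two base functions.\<close>
  have "fcalc A (\<lambda>u. u * (1 - u) - u * (1 - u)) ((A - A \<star> A) - (A - A \<star> A))"
    by (intro fcalc.intros)
  then show ?case by (intro exI[of _ 0]) simp
next
  case (Suc m)
  then obtain G where G: "fcalc A (\<lambda>u. u ^ Suc m - u) G" "\<And>v. A v + G v = ((blinfun_apply A) ^^ Suc m) v"
    by blast
  have "fcalc A (\<lambda>u. u * (u ^ Suc m - u) - u * (1 - u)) (A \<star> G - (A - A \<star> A))"
    by (intro fcalc.intros G)
  moreover have "(\<lambda>u :: complex. u * (u ^ Suc m - u) - u * (1 - u)) = (\<lambda>u. u ^ Suc (Suc m) - u)"
    by (simp add: fun_eq_iff algebra_simps)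
  moreover have "A v + (A \<star> G - (A - A \<star> A)) v = ((blinfun_apply A) ^^ Suc (Suc m)) v" for v
  proof -
    have "A v + (A \<star> G - (A - A \<star> A)) v = A (A v + G v)"
      by (simp add: blinfun.bilinear_simps)
    then show ?thesis by (simp add: G(2))
  qed
  ultimately show ?case by (metis (no_types, lifting))
qed

text \<open>The rules only multiply by \<open>u\<close>, so multiplication by
  \<open>u (1 - u)\<close> is written as \<open>u g - u (u g)\<close>.\<close>

lemma fcalc_base_power:
  "\<exists>G. fcalc A (\<lambda>u. (u * (1 - u)) ^ Suc m) G \<and> blinfun_apply G = (\<lambda>v. A (v - A v)) ^^ Suc m"
proof (induction m)
  case 0
  have "fcalc A (\<lambda>u. u * (1 - u)) (A - A \<star> A)" by (rule fcalc.base)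
  then show ?case
    by (intro exI[of _ "A - A \<star> A"]) (simp add: fun_eq_iff blinfun.bilinear_simps)
next
  case (Suc m)
  then obtain G where G: "fcalc A (\<lambda>u. (u * (1 - u)) ^ Suc m) G" "blinfun_apply G = (\<lambda>v. A (v - A v)) ^^ Suc m"
    by blast
  have "fcalc A (\<lambda>u. u * (u * (1 - u)) ^ Suc m - u * (u * (u * (1 - u)) ^ Suc m)) (A \<star> G - A \<star> (A \<star> G))"
    by (intro fcalc.intros G)
  moreover have "(\<lambda>u :: complex. u * (u * (1 - u)) ^ Suc m - u * (u * (u * (1 - u)) ^ Suc m)) = (\<lambda>u. (u * (1 - u)) ^ Suc (Suc m))"
    by (simp add: fun_eq_iff algebra_simps)
  moreover have "blinfun_apply (A \<star> G - A \<star> (A \<star> G)) = (\<lambda>v. A (v - A v)) ^^ Suc (Suc m)"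
    by (rule ext) (simp add: blinfun.bilinear_simps G(2))
  ultimately show ?case by metis
qed

text \<open>A name for \<open>(1 + T^2)^-1\<close> that makes sense outside the locale and does not
  involve the angle \<phi>, which is known only after the choice inside
  \<open>omega_calculus\<close>.\<close>

definition square_resolvent ::
    "('v::banach, 'n::{finite,linorder}) op \<Rightarrow> ('v, 'n) cmodule \<Rightarrow>\<^sub>L ('v, 'n) cmodule" where
  "square_resolvent T = bounded_inverse (\<lambda>w. map_option (\<lambda>u. w + u) ((T \<circ>\<^sub>m T) w))"

context bisectorial_operator begin

lemma square_resolvent_eq: "square_resolvent T = A"
proof -
  have "Q_op (cslice unit \<i>) T = (\<lambda>w. map_option (\<lambda>u. w + u) ((T \<circ>\<^sub>m T) w))"
    unfolding Q_op_def norm_cslice[OF unit] cslice_nth_empty[OF unit]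
    by (rule ext) (auto simp: add.commute dom_def)
  then show ?thesis
    by (simp add: square_resolvent_def A_eq Qi_def)
qed

text \<open>The vector \<open>v\<close> is recovered as \<open>(1 + T^2) A v\<close>.\<close>

lemma A_eq_zero: "A v = 0 \<Longrightarrow> v = 0"
proof -
  assume 0: "A v = 0"
  then have "TQi \<i> v = 0" using T_Qi(1)[of \<i> v] T_zero by (simp add: A_eq)
  then show "v = 0" using T_Qi(2)[of \<i> v] T_zero 0 by (simp add: A_eq)
qed

lemma inj_A: "inj (blinfun_apply A)"
proof (rule injI)
  fix v w assume "A v = A w"
  then have "A (v - w) = 0" by (simp add: blinfun.bilinear_simps)
  then show "v = w" using A_eq_zero by fastforce
qed

text \<open>After cancelling the outer \<open>A\<close>, a vector \<open>x\<close> in the kernel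
  satisfies \<open>A x = x\<close>, that is \<open>T (T (A x)) = 0\<close>; injectivity of
  \<open>T\<close> is applied twice.\<close>

lemma inj_base:
  assumes "inj_on T (dom T)"
  shows "inj (\<lambda>v. A (v - A v))"
proof (rule injI)
  fix v w assume "A (v - A v) = A (w - A w)"
  moreover have "A ((v - w) - A (v - w)) = A (v - A v) - A (w - A w)"
    by (simp add: blinfun.bilinear_simps)
  ultimately have "A ((v - w) - A (v - w)) = 0" by simp
  then have *: "v - w = A (v - w)" using A_eq_zero by fastforce
  define x where "x = v - w"
  have x: "A x = x" using * by (simp add: x_def)
  have zero: "y = 0" if "T y = Some 0" for y
    using inj_onD[OF assms, of y 0] that T_zero by (auto simp: dom_def)
  have "T (TQi \<i> x) = Some 0" using T_Qi(2)[of \<i> x] x by (simp add: A_eq)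
  then have "TQi \<i> x = 0" by (rule zero)
  then have "T (A x) = Some 0" using T_Qi(1)[of \<i> x] by (simp add: A_eq)
  then have "A x = 0" by (rule zero)
  then show "v = w" using x by (simp add: x_def)
qed

end

text \<open>Resolves the two choices hidden in \<open>ext_calculus\<close>: the components are fixed
  by uniqueness, and the contour is arbitrary because \<open>omega_integral_fcalc\<close> covers
  every admissible pair.\<close>

lemma ext_calculus_fcalc:
  fixes T :: "('v::banach, 'n::{finite,linorder}) op" and a b :: real
  assumes TT: "T \<in> closed_ops" "bisectorial \<omega> T" and \<omega>: "0 < \<omega>" "\<omega> < \<theta>" "\<theta> < pi / 2"
    and g: "fcalc (square_resolvent T) g G"
    and e: "bnd_components \<theta> e (axis {} a) (axis {} b) (lift (\<lambda>z. g (quad_inv z)))"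
  shows "ext_calculus \<omega> \<theta> T e v = b *\<^sub>R v + (a - b) *\<^sub>R square_resolvent T v + G v"
proof -
  have \<theta>: "0 < \<theta>" "\<theta> < pi / 2" using \<omega> by auto
  define X where "X = (SOME (f0, finf, ft). bnd_components \<theta> e f0 finf ft)"
  obtain a' b' k where X: "X = (a', b', k)" by (cases X)
  have "\<exists>x. case x of (f0, finf, ft) \<Rightarrow> bnd_components \<theta> e f0 finf ft" using e by auto
  from someI_ex[OF this] have k: "bnd_components \<theta> e a' b' k"
    using X unfolding X_def by simp
  note u = bnd_components_unique[OF \<theta> k e]
  define Y where "Y = (SOME (\<phi>, J). \<phi> \<in> {\<omega> <..< \<theta>} \<and> (J :: 'n clifford) \<in> imag_sphere)"
  obtain \<phi> J where Y: "Y = (\<phi>, J)" by (cases Y)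
  have "\<exists>x. case x of (\<phi>, J) \<Rightarrow> \<phi> \<in> {\<omega> <..< \<theta>} \<and> (J :: 'n clifford) \<in> imag_sphere"
    using \<omega> generator_imag_sphere by (intro exI[of _ "((\<omega> + \<theta>) / 2, axis {undefined} 1)"]) simp
  from someI_ex[OF this] have \<phi>: "\<omega> < \<phi>" "\<phi> < \<theta>" and J: "J \<in> imag_sphere"
    using Y unfolding Y_def by simp_all
  interpret bisectorial_operator T \<omega> \<phi>
    using TT \<omega> \<phi> by unfold_locales auto
  have "omega_calculus \<omega> \<theta> T k = omega_integral \<phi> J T k"
    unfolding omega_calculus_def Y_def[symmetric] Y by simp
  also have "\<dots> = G"
  proof (rule omega_integral_fcalc[OF g[unfolded square_resolvent_eq] J \<phi>(2) \<theta>(2)])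
    fix z assume z: "z \<in> plane_sector \<theta>"
    \<comment> \<open>The chosen remainder is determined only on the double sector, which suffices
      because the contour angle is below \<theta>.\<close>
    have "k (cslice J z) = lift (\<lambda>z. g (quad_inv z)) (cslice J z)"
      by (rule u(3)) (use z in \<open>simp only: dsector_cslice[OF J \<theta>]\<close>)
    also have "\<dots> = cslice J (g (quad_inv z))"
      by (rule lift_cslice[OF J]) (simp add: quad_inv_cnj fcalc_cnj[OF g])
    finally show "k (cslice J z) = cslice J (g (1 / (1 + z\<^sup>2)))"
      by (simp add: quad_inv_def)
  qed
  finally have "omega_calculus \<omega> \<theta> T k = G" .
  then show ?thesis
    unfolding ext_calculus_def X_def[symmetric] X square_resolvent_def[symmetric]
    by (simp add: u(1,2) lmul_scalar blinfun.scaleR_right flip: axis_linear(2))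
qed

lemma quad_inv_power_bound:
  assumes "z \<in> plane_sector \<theta>" "0 < \<theta>" "\<theta> < pi / 2"
  shows "(cmod (quad_inv z)) ^ m \<le> (1 / cos \<theta>) ^ m / (1 + (cmod z)\<^sup>2) ^ m"
  using power_mono[OF quad_inv_bound[OF assms], of m] by (simp add: power_divide power_mult_distrib)

lemma power_le_one_plus_square:
  fixes r :: real
  assumes "r \<ge> 0" "k \<le> 2 * m"
  shows "r ^ k \<le> (1 + r\<^sup>2) ^ m"
proof (cases "r \<le> 1")
  case True
  have "r ^ k \<le> 1" using True assms by (simp add: power_le_one)
  also have "1 \<le> (1 + r\<^sup>2) ^ m" by (simp add: one_le_power)
  finally show ?thesis .
next
  case False
  have "r ^ k \<le> r ^ (2 * m)" using False assms by (intro power_increasing) auto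
  also have "\<dots> \<le> (1 + r\<^sup>2) ^ m" unfolding power_mult using assms by (intro power_mono) auto
  finally show ?thesis .
qed

text \<open>The regularizer is \<open>u^(k+1)\<close>: \<open>k\<close> of its factors absorb the
  growth of \<open>f\<close>, and the last one leaves decay of order
  \<open>1 / (1 + \<bar>s\<bar>^2)\<close>. It equals 1 at the origin, so the product with
  \<open>f\<close> keeps the value \<open>f0\<close> there.\<close>

lemma SH_Lreg_regular_at_zero:
  fixes T :: "('v::banach, 'n::{finite,linorder}) op"
  assumes TT: "T \<in> closed_ops" "bisectorial \<omega> T" and \<omega>: "0 < \<omega>" "\<omega> < \<theta>" "\<theta> < pi / 2"
    and f: "f \<in> SH_L (dsector \<theta>)" and r: "r > 0"
    and int: "\<And>J \<phi>. J \<in> imag_sphere \<Longrightarrow> \<phi> \<in> angles \<theta> \<Longrightarrow>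
       (\<integral>\<^sup>+t\<in>{0<..<r}. ennreal (norm (f (t *\<^sub>R expi J \<phi>) - f0) / t) \<partial>lborel) < \<infinity>"
    and C: "C \<ge> 0" "\<And>s. s \<in> dsector \<theta> \<Longrightarrow> norm (f s) \<le> C * (1 + norm s ^ k)"
  shows "f \<in> SH_Lreg \<omega> \<theta> T"
proof -
  have \<theta>: "0 < \<theta>" "\<theta> < pi / 2" using \<omega> by auto
  have c: "cos \<theta> > 0" using \<theta> by (intro cos_gt_zero) auto
  obtain K where K: "K > 0" "\<And>a b :: 'n clifford. norm (a \<odot> b) \<le> norm a * norm b * K"
    using lmul_norm_bound by blast
  define p where "p u = u ^ Suc k" for u :: complex
  obtain G where G: "fcalc (square_resolvent T) (\<lambda>u. u ^ Suc k - u) G"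
    "\<And>v. square_resolvent T v + G v = ((blinfun_apply (square_resolvent T)) ^^ Suc k) v"
    using fcalc_power by blast
  obtain g' where g': "continuous_on UNIV g'" "\<And>z. ((\<lambda>u. u ^ Suc k - u) has_field_derivative g' z) (at (z :: complex))"
    using fcalc_differentiable[OF G(1)] by blast
  have p: "p (cnj z) = cnj (p z)" "continuous_on UNIV (\<lambda>z. g' z + 1)"
    "(p has_field_derivative g' z + 1) (at z)" for z
  proof -
    show "(p has_field_derivative g' z + 1) (at z)"
      using DERIV_add[OF g'(2)[of z] DERIV_ident] by (simp add: p_def[abs_def])
  qed (auto simp: p_def intro!: continuous_intros g')
  define e where "e = (lift (\<lambda>z. p (quad_inv z)) :: 'n clifford \<Rightarrow> 'n clifford)"
  define q where "q = (lift (\<lambda>z. quad_inv z) :: 'n clifford \<Rightarrow> 'n clifford)"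
  define d where "d = (lift (\<lambda>z. (quad_inv z) ^ Suc k - quad_inv z) :: 'n clifford \<Rightarrow> 'n clifford)"
  have d0: "d \<in> intrinsic0 \<theta>"
    using fcalc_intrinsic0[OF G(1) \<theta>] by (simp add: d_def)
  obtain D where D: "D \<ge> 0" "\<And>s. s \<in> dsector \<theta> \<Longrightarrow> norm (d s) \<le> D * (norm s)\<^sup>2 / (1 + (norm s)\<^sup>2)\<^sup>2"
    using fcalc_lift_bound[OF G(1) \<theta>] unfolding d_def by blast
  have point: "norm (e s) \<le> (1 / cos \<theta>) ^ Suc k / (1 + (norm s)\<^sup>2) ^ Suc k"
    "norm (q s) \<le> 1 / cos \<theta> / (1 + (norm s)\<^sup>2)" "e s = q s + d s" "pv_inverse (axis {} 1 + s \<odot> s) = q s"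
    if s: "s \<in> dsector \<theta>" for s
  proof -
    obtain J z where J: "J \<in> imag_sphere" and z: "z \<in> plane_sector \<theta>" and sz: "s = cslice J z" "norm s = cmod z"
      and pv: "pv_inverse (axis {} 1 + s \<odot> s) = cslice J (quad_inv z)"
      using lift_dsector[OF s \<theta>, of "\<lambda>z. z"] by (metis (no_types, lifting))
    have e: "e s = cslice J (p (quad_inv z))" and q: "q s = cslice J (quad_inv z)"
      and d: "d s = cslice J ((quad_inv z) ^ Suc k - quad_inv z)"
      unfolding e_def q_def d_def sz(1) by (intro lift_cslice[OF J]; simp add: quad_inv_cnj p)+
    show "norm (e s) \<le> (1 / cos \<theta>) ^ Suc k / (1 + (norm s)\<^sup>2) ^ Suc k"
      using quad_inv_power_bound[OF z \<theta>, of "Suc k"] unfolding e norm_cslice[OF J] sz(2) p_def norm_power .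
    show "norm (q s) \<le> 1 / cos \<theta> / (1 + (norm s)\<^sup>2)"
      using quad_inv_bound[OF z \<theta>] unfolding q norm_cslice[OF J] sz(2) by simp
    show "e s = q s + d s" unfolding e q d p_def cslice_add[symmetric] by simp
    show "pv_inverse (axis {} 1 + s \<odot> s) = q s" unfolding pv q ..
  qed
  \<comment> \<open>The splitting \<open>u + (u^(k+1) - u)\<close>: value 1 at 0, value 0 at
    infinity, remainder \<open>d\<close>.\<close>
  have comp: "bnd_components \<theta> e (axis {} 1) (axis {} 0) d"
    unfolding bnd_components_def using d0 point(3,4)
    by (auto simp: intrinsic0_def lmul_one_right)
  have "e \<in> intrinsic_bnd \<theta>"
    unfolding intrinsic_bnd_def using comp d0 by blast
  moreover have "inj (ext_calculus \<omega> \<theta> T e)"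
  proof -
    have \<phi>: "\<omega> < (\<omega> + \<theta>) / 2" "(\<omega> + \<theta>) / 2 < pi / 2" using \<omega> by auto
    interpret bisectorial_operator T \<omega> "(\<omega> + \<theta>) / 2"
      using TT \<omega> \<phi> by unfold_locales auto
    have "ext_calculus \<omega> \<theta> T e = (blinfun_apply A) ^^ Suc k"
      using ext_calculus_fcalc[OF TT \<omega> G(1) comp[unfolded d_def]] G(2) by (simp add: fun_eq_iff square_resolvent_eq)
    then show ?thesis by (simp only: inj_fn[OF inj_A])
  qed
  moreover have "(\<lambda>s. e s \<odot> f s) \<in> SH_Lbnd \<theta>"
  proof -
    \<comment> \<open>The product \<open>e f\<close> has the value \<open>f0\<close> at 0 and 0 at
      infinity, so \<open>q f0\<close> is its explicit part and \<open>h\<close> the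
      remainder.\<close>
    define h where "h s = e s \<odot> f s - q s \<odot> f0" for s
    have "h \<in> SH_L0 \<theta>"
    proof -
      have hL: "h \<in> SH_L (dsector \<theta>)"
      proof -
        have "(\<lambda>_. f0) \<in> SH_L (dsector \<theta>)"
          unfolding SH_L_def using slice_components_const by blast
        from lift_mult_SH_L[OF this \<theta>, of "\<lambda>z. z" "\<lambda>_. 1"]
        have "(\<lambda>s. q s \<odot> f0) \<in> SH_L (dsector \<theta>)"
          unfolding q_def by simp
        moreover have "(\<lambda>s. e s \<odot> f s) \<in> SH_L (dsector \<theta>)"
          unfolding e_def by (rule lift_mult_SH_L[OF f \<theta> p])
        ultimately show ?thesis
          unfolding h_def[abs_def] by (intro SH_L_diff)
      qed
      define M where "M = 2 * K * C * (1 / cos \<theta>) ^ Suc k"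
      define M' where "M' = 1 / cos \<theta> * norm f0 * K"
      have M: "M \<ge> 0" "M' \<ge> 0" using K C c by (simp_all add: M_def M'_def)
      have ef: "norm (e s \<odot> f s) \<le> M / (1 + (norm s)\<^sup>2)" if s: "s \<in> dsector \<theta>" for s
      proof -
        define w where "w = 1 + (norm s)\<^sup>2"
        have w: "w \<ge> 1" by (simp add: w_def)
        have "norm s ^ k \<le> w ^ k" "1 \<le> w ^ k"
          using power_le_one_plus_square[of "norm s" k k] one_le_power[OF w, of k] by (simp_all add: w_def)
        then have "1 + norm s ^ k \<le> 2 * w ^ k" by linarith
        then have "norm (f s) \<le> C * (2 * w ^ k)"
          using C(2)[OF s] mult_left_mono[OF _ C(1)] by (meson order_trans)
        moreover have "norm (e s) \<le> (1 / cos \<theta>) ^ Suc k / w ^ Suc k"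
          using point(1)[OF s] by (simp only: w_def)
        ultimately have "norm (e s) * norm (f s) * K \<le> (1 / cos \<theta>) ^ Suc k / w ^ Suc k * (C * (2 * w ^ k)) * K"
          using K c w C(1) by (intro mult_right_mono mult_mono) auto
        also have "\<dots> = M / w" using w by (simp add: M_def)
        finally show ?thesis using K(2)[of "e s" "f s"] by (simp add: w_def)
      qed
      have qf: "norm (q s \<odot> f0) \<le> M' / (1 + (norm s)\<^sup>2)" if s: "s \<in> dsector \<theta>" for s
      proof -
        have "norm (q s) * norm f0 * K \<le> 1 / cos \<theta> / (1 + (norm s)\<^sup>2) * norm f0 * K"
          using point(2)[OF s] K by (intro mult_right_mono) auto
        then show ?thesis using K(2)[of "q s" f0] by (simp add: M'_def)
      qed
      have hb: "norm (h s) \<le> (M + M') / (1 + (norm s)\<^sup>2)" if s: "s \<in> dsector \<theta>" for s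
        unfolding h_def add_divide_distrib by (intro order_trans[OF norm_triangle_ineq4 add_mono] ef qf s)
      have "norm (h s) \<le> M + M'" if s: "s \<in> dsector \<theta>" for s
      proof -
        have "(M + M') / (1 + (norm s)\<^sup>2) \<le> (M + M') / 1"
          using M by (intro divide_left_mono) (auto simp: add_pos_nonneg)
        then show ?thesis using hb[OF s] by simp
      qed
      then have bdd: "bounded (h ` dsector \<theta>)" unfolding bounded_iff by blast
      define L where "L = (1 / cos \<theta>) ^ Suc k * K"
      have L: "L \<ge> 0" using c K by (simp add: L_def)
      \<comment> \<open>One constant for both ranges: the first summand serves for
        \<open>t < r\<close>, the second for \<open>t \<ge> r\<close>, where \<open>1 / t\<close> is
        at most \<open>1 / r\<close>.\<close>
      define M'' where "M'' = D * norm f0 * K + (M + M') / r"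
      have M'': "M'' \<ge> 0" using D K M r by (simp add: M''_def)
      have near: "norm (h s) \<le> L * norm (f s - f0) + D * norm f0 * K * ((norm s)\<^sup>2 / (1 + (norm s)\<^sup>2)\<^sup>2)" if s: "s \<in> dsector \<theta>" for s
      proof -
        \<comment> \<open>Separates \<open>f - f0\<close>, which is integrable near 0 by assumption,
          from \<open>d f0\<close>, which vanishes quadratically at 0.\<close>
        have "h s = e s \<odot> (f s - f0) + d s \<odot> f0"
          unfolding h_def lmul.diff_right point(3)[OF s] lmul.add_left by simp
        also have "norm \<dots> \<le> norm (e s) * norm (f s - f0) * K + norm (d s) * norm f0 * K"
          by (intro norm_triangle_mono K)
        also have "\<dots> \<le> (1 / cos \<theta>) ^ Suc k * norm (f s - f0) * K + D * (norm s)\<^sup>2 / (1 + (norm s)\<^sup>2)\<^sup>2 * norm f0 * K"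
        proof (intro add_mono mult_right_mono D(2)[OF s])
          have "(1 / cos \<theta>) ^ Suc k / (1 + (norm s)\<^sup>2) ^ Suc k \<le> (1 / cos \<theta>) ^ Suc k / 1"
            using c by (intro divide_left_mono) (auto simp: one_le_power add_pos_nonneg simp del: power_Suc)
          then show "norm (e s) \<le> (1 / cos \<theta>) ^ Suc k" using point(1)[OF s] by simp
        qed (use K in auto)
        also have "\<dots> = L * norm (f s - f0) + D * norm f0 * K * ((norm s)\<^sup>2 / (1 + (norm s)\<^sup>2)\<^sup>2)"
          by (simp add: L_def mult_ac)
        finally show ?thesis .
      qed
      have "(\<integral>\<^sup>+t\<in>{0<..}. ennreal (norm (h (t *\<^sub>R expi J \<phi>)) / t) \<partial>lborel) < \<infinity>"
        if J: "J \<in> imag_sphere" and \<phi>: "\<phi> \<in> angles \<theta>" for J \<phi>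
      proof -
        let ?s = "\<lambda>t. t *\<^sub>R expi J \<phi>"
        let ?F = "\<lambda>t. ennreal (norm (f (?s t) - f0) / t) * indicator {0<..<r} t"
        let ?E = "\<lambda>t. ennreal (M'' / (1 + t\<^sup>2)) * indicator {0<..} t"
        have meas: "?F \<in> borel_measurable lborel"
          by (rule SH_L_ray_measurable[OF f \<theta> J \<phi>]) auto
        have "(\<integral>\<^sup>+t\<in>{0<..}. ennreal (norm (h (?s t)) / t) \<partial>lborel) \<le> (\<integral>\<^sup>+t. ennreal L * ?F t + ?E t \<partial>lborel)"
        proof (intro nn_integral_mono)
          fix t :: real
          show "ennreal (norm (h (?s t)) / t) * indicator {0<..} t \<le> ennreal L * ?F t + ?E t"
          proof (cases "t > 0")
            case t: True
            have s: "?s t \<in> dsector \<theta>" and n: "norm (?s t) = t"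
              by (rule ray_dsector[OF t J \<phi>]) (rule norm_ray[OF t J])
            have pos: "1 + t\<^sup>2 > 0" by (simp add: add_pos_nonneg)
            show ?thesis
            proof (cases "t < r")
              case True
              have "t\<^sup>2 / (1 + t\<^sup>2)\<^sup>2 / t \<le> t / (1 + t\<^sup>2) / t"
                using square_quotient_le[of t] t by (intro divide_right_mono) auto
              then have sq: "t\<^sup>2 / (1 + t\<^sup>2)\<^sup>2 / t \<le> 1 / (1 + t\<^sup>2)" using t by simp
              have "norm (h (?s t)) / t \<le> (L * norm (f (?s t) - f0) + D * norm f0 * K * (t\<^sup>2 / (1 + t\<^sup>2)\<^sup>2)) / t"
                using divide_right_mono[OF near[OF s], of t] t unfolding n by simp
              also have "\<dots> = L * (norm (f (?s t) - f0) / t) + D * norm f0 * K * (t\<^sup>2 / (1 + t\<^sup>2)\<^sup>2 / t)"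
                by (simp add: add_divide_distrib)
              also have "\<dots> \<le> L * (norm (f (?s t) - f0) / t) + D * norm f0 * K * (1 / (1 + t\<^sup>2))"
                using D K by (intro add_left_mono mult_left_mono sq) auto
              also have "\<dots> \<le> L * (norm (f (?s t) - f0) / t) + M'' * (1 / (1 + t\<^sup>2))"
                using M r pos by (intro add_left_mono mult_right_mono) (auto simp: M''_def)
              finally have "ennreal (norm (h (?s t)) / t) \<le> ennreal (L * (norm (f (?s t) - f0) / t) + M'' / (1 + t\<^sup>2))"
                by (intro ennreal_leI) simp
              also have "\<dots> = ennreal L * ennreal (norm (f (?s t) - f0) / t) + ennreal (M'' / (1 + t\<^sup>2))"
              proof -
                have "ennreal (L * (norm (f (?s t) - f0) / t)) = ennreal L * ennreal (norm (f (?s t) - f0) / t)"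
                  using t L by (intro ennreal_mult) auto
                then show ?thesis
                  using t L M'' pos by (metis divide_nonneg_pos ennreal_plus mult_nonneg_nonneg norm_ge_zero)
              qed
              finally show ?thesis using t True by simp
            next
              case False
              have "norm (h (?s t)) / t \<le> (M + M') / (1 + t\<^sup>2) / r"
                using hb[OF s] False r M pos unfolding n by (intro frac_le) auto
              also have "\<dots> = (M + M') / r / (1 + t\<^sup>2)" by (simp add: mult.commute)
              also have "\<dots> \<le> M'' / (1 + t\<^sup>2)"
                using D K pos by (intro divide_right_mono) (auto simp: M''_def)
              finally show ?thesis using t False by (auto intro: ennreal_leI)
            qed
          qed simp
        qed
        also have "\<dots> = ennreal L * (\<integral>\<^sup>+t. ?F t \<partial>lborel) + (\<integral>\<^sup>+t. ?E t \<partial>lborel)"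
          using meas by (simp add: nn_integral_add nn_integral_cmult)
        also have "\<dots> < \<infinity>"
          using int[OF J \<phi>] nn_integral_inverse_square[OF M''] by (simp add: ennreal_mult_less_top)
        finally show ?thesis .
      qed
      then show ?thesis using hL bdd by (simp add: SH_L0_def)
    qed
    then have "bnd_components \<theta> (\<lambda>s. e s \<odot> f s) f0 0 h"
      unfolding bnd_components_def using point(4) by (auto simp: h_def)
    then show ?thesis unfolding SH_Lbnd_def by blast
  qed
  ultimately show ?thesis
    unfolding SH_Lreg_def using f by blast
qed

text \<open>The regularizer is \<open>(u (1 - u))^(k+1)\<close>. Since \<open>u (1 - u)\<close> is
  of order \<open>\<bar>s\<bar>^2\<close> at 0 and \<open>\<bar>s\<bar>^-2\<close> at infinity, it
  absorbs growth of order \<open>k\<close> at both ends and leaves decay of the form required by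
  \<open>SH_L0I\<close>.\<close>

lemma SH_Lreg_injective:
  fixes T :: "('v::banach, 'n::{finite,linorder}) op"
  assumes TT: "T \<in> closed_ops" "bisectorial \<omega> T" and \<omega>: "0 < \<omega>" "\<omega> < \<theta>" "\<theta> < pi / 2"
    and inj: "inj_on T (dom T)" and f: "f \<in> SH_L (dsector \<theta>)"
    and C: "C \<ge> 0" "\<And>s. s \<in> dsector \<theta> \<Longrightarrow> norm (f s) \<le> C * (1 / norm s ^ k + norm s ^ k)"
  shows "f \<in> SH_Lreg \<omega> \<theta> T"
proof -
  have \<theta>: "0 < \<theta>" "\<theta> < pi / 2" using \<omega> by auto
  obtain K where K: "K > 0" "\<And>a b :: 'n clifford. norm (a \<odot> b) \<le> norm a * norm b * K"
    using lmul_norm_bound by blast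
  obtain G where G: "fcalc (square_resolvent T) (\<lambda>u. (u * (1 - u)) ^ Suc k) G"
    "blinfun_apply G = (\<lambda>v. square_resolvent T (v - square_resolvent T v)) ^^ Suc k"
    using fcalc_base_power by blast
  define e where "e = (lift (\<lambda>z. (quad_inv z * (1 - quad_inv z)) ^ Suc k) :: 'n clifford \<Rightarrow> 'n clifford)"
  have e0: "e \<in> intrinsic0 \<theta>"
    using fcalc_intrinsic0[OF G(1) \<theta>] by (simp add: e_def)
  \<comment> \<open>The regularizer vanishes at 0 and at infinity, so it is its own remainder and
    the extended calculus returns just \<open>G\<close>.\<close>
  have comp: "bnd_components \<theta> e (axis {} 0) (axis {} 0) e"
    unfolding bnd_components_def using e0 by (simp add: intrinsic0_def lmul.zero_right)
  have "e \<in> intrinsic_bnd \<theta>"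
    unfolding intrinsic_bnd_def using comp e0 by blast
  moreover have "inj (ext_calculus \<omega> \<theta> T e)"
  proof -
    have \<phi>: "\<omega> < (\<omega> + \<theta>) / 2" "(\<omega> + \<theta>) / 2 < pi / 2" using \<omega> by auto
    interpret bisectorial_operator T \<omega> "(\<omega> + \<theta>) / 2"
      using TT \<omega> \<phi> by unfold_locales auto
    have "ext_calculus \<omega> \<theta> T e = (\<lambda>v. A (v - A v)) ^^ Suc k"
      using ext_calculus_fcalc[OF TT \<omega> G(1) comp[unfolded e_def], folded e_def] G(2)
      by (simp add: fun_eq_iff square_resolvent_eq)
    then show ?thesis by (simp only: inj_fn[OF inj_base[OF inj]])
  qed
  moreover have "(\<lambda>s. e s \<odot> f s) \<in> SH_Lbnd \<theta>"
  proof -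
    obtain E where E: "E \<ge> 0" "\<And>s. s \<in> dsector \<theta> \<Longrightarrow>
        norm (lift (\<lambda>z. quad_inv z * (1 - quad_inv z)) (s :: 'n clifford)) \<le> E * (norm s)\<^sup>2 / (1 + (norm s)\<^sup>2)\<^sup>2"
      using fcalc_lift_bound[OF fcalc.base \<theta>] by blast
    have e_bound: "norm (e s) \<le> (E * ((norm s)\<^sup>2 / (1 + (norm s)\<^sup>2)\<^sup>2)) ^ Suc k" if s: "s \<in> dsector \<theta>" for s
    proof -
      obtain J z where J: "J \<in> imag_sphere" and sz: "s = cslice J z"
        using dsectorE[OF s \<theta>] by metis
      have 1: "e s = cslice J ((quad_inv z * (1 - quad_inv z)) ^ Suc k)"
        and 2: "lift (\<lambda>z. quad_inv z * (1 - quad_inv z)) s = cslice J (quad_inv z * (1 - quad_inv z))"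
        unfolding e_def sz by (intro lift_cslice[OF J]; simp add: quad_inv_cnj)+
      show ?thesis
        using power_mono[OF E(2)[OF s], of "Suc k"] unfolding 1 2 norm_cslice[OF J] norm_power by simp
    qed
    have "(\<lambda>s. e s \<odot> f s) \<in> SH_L0 \<theta>"
    proof (rule SH_L0I[where C = "2 * C * E ^ Suc k * K"])
      obtain g' where g': "continuous_on UNIV g'" "\<And>z. ((\<lambda>u. (u * (1 - u)) ^ Suc k) has_field_derivative g' z) (at (z :: complex))"
        using fcalc_differentiable[OF G(1)] by blast
      show "(\<lambda>s. e s \<odot> f s) \<in> SH_L (dsector \<theta>)"
        unfolding e_def by (rule lift_mult_SH_L[OF f \<theta> fcalc_cnj[OF G(1)] g'])
      fix s :: "'n clifford" assume s: "s \<in> dsector \<theta>"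
      define x where "x = norm s"
      define w where "w = 1 + x\<^sup>2"
      obtain J z where "J \<in> imag_sphere" "z \<in> plane_sector \<theta>" "s = cslice J z"
        using dsectorE[OF s \<theta>] by blast
      then have x: "x > 0" by (auto simp: x_def norm_cslice plane_sector_def)
      have w: "w \<ge> 1" by (simp add: w_def)
      have "x ^ (2 * k) \<le> w ^ k"
        using power_le_one_plus_square[of x "2 * k" k] x by (simp add: w_def)
      moreover have "(1::real) \<le> w ^ k" using w by (rule one_le_power)
      ultimately have "1 + x ^ (2 * k) \<le> 2 * w ^ k" by linarith
      then have 1: "(1 + x ^ (2 * k)) / w ^ k \<le> 2"
        using w by (simp add: divide_le_eq)
      have "x \<le> w" using le_one_plus_square[of x] by (simp add: w_def)
      then have 2: "(x / w) ^ Suc k \<le> 1" using x w by (intro power_le_one) auto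
      \<comment> \<open>One factor \<open>x / w\<close> is kept as the final decay; the other two
        factors are at most 1 and at most 2.\<close>
      have "(x\<^sup>2 / w\<^sup>2) ^ Suc k * (1 / x ^ k + x ^ k) = x / w * ((x / w) ^ Suc k * ((1 + x ^ (2 * k)) / w ^ k))"
      proof -
        define X W where "X = x ^ k" and "W = w ^ k"
        have nz: "X > 0" "W > 0" using x w by (auto simp: X_def W_def)
        have a: "(x\<^sup>2 / w\<^sup>2) ^ Suc k = X * X * x * x / (W * W * w * w)"
          by (simp add: X_def W_def power_divide power2_eq_square power_mult_distrib mult_ac)
        have b: "x ^ (2 * k) = X * X" by (simp add: X_def mult_2 power_add)
        have c: "(x / w) ^ Suc k = x * X / (w * W)" by (simp add: X_def W_def power_divide)
        show ?thesis
          unfolding a b c X_def[symmetric] W_def[symmetric] using nz x w by (simp add: field_simps)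
      qed
      also have "\<dots> \<le> x / w * (1 * 2)"
        using x w by (intro mult_left_mono mult_mono 1 2) auto
      finally have fx: "(x\<^sup>2 / w\<^sup>2) ^ Suc k * (1 / x ^ k + x ^ k) \<le> x / w * (1 * 2)" .
      have "norm (e s) * norm (f s) * K \<le> (E * (x\<^sup>2 / w\<^sup>2)) ^ Suc k * (C * (1 / x ^ k + x ^ k)) * K"
        using e_bound[OF s] C(2)[OF s] K(1) C(1) E(1) x unfolding x_def w_def
        by (intro mult_right_mono mult_mono) auto
      also have "\<dots> = C * E ^ Suc k * K * ((x\<^sup>2 / w\<^sup>2) ^ Suc k * (1 / x ^ k + x ^ k))"
        by (simp only: power_mult_distrib mult_ac)
      also have "\<dots> \<le> C * E ^ Suc k * K * (x / w * (1 * 2))"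
        using C E K by (intro mult_left_mono fx) auto
      finally show "norm (e s \<odot> f s) \<le> 2 * C * E ^ Suc k * K * norm s / (1 + (norm s)\<^sup>2)"
        using K(2)[of "e s" "f s"] by (simp add: x_def w_def mult_ac)
    qed (use C E K in auto)
    then have "bnd_components \<theta> (\<lambda>s. e s \<odot> f s) 0 0 (\<lambda>s. e s \<odot> f s)"
      unfolding bnd_components_def by (simp add: lmul.zero_right)
    then show ?thesis unfolding SH_Lbnd_def by blast
  qed
  ultimately show ?thesis
    unfolding SH_Lreg_def using f by blast
qed

theorem proposition5p2:
  fixes T :: "('v::banach, 'n::{finite,linorder}) op" and \<omega> \<theta> :: real
  assumes "T \<in> closed_ops"
    and "0 < \<omega>" and "\<omega> < pi / 2"
    and "bisectorial \<omega> T"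
    and "\<omega> < \<theta>" and "\<theta> < pi / 2"
  shows "(\<forall>f\<in>SH_L (dsector \<theta>).
            (\<exists>r>0. \<exists>f0. \<forall>J\<in>imag_sphere. \<forall>\<phi>\<in>angles \<theta>.
               (\<integral>\<^sup>+t\<in>{0<..<r}. ennreal (norm (f (t *\<^sub>R expi J \<phi>) - f0) / t) \<partial>lborel) < \<infinity>) \<and>
            (\<exists>(k::nat) C. C \<ge> 0 \<and> (\<forall>s\<in>dsector \<theta>. norm (f s) \<le> C * (1 + norm s ^ k)))
            \<longrightarrow> f \<in> SH_Lreg \<omega> \<theta> T)
       \<and> (inj_on T (dom T) \<longrightarrow>
          (\<forall>f\<in>SH_L (dsector \<theta>).
            (\<exists>(k::nat) C. C \<ge> 0 \<and> (\<forall>s\<in>dsector \<theta>. norm (f s) \<le> C * (1 / norm s ^ k + norm s ^ k)))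
            \<longrightarrow> f \<in> SH_Lreg \<omega> \<theta> T))"
proof (intro conjI impI ballI)
  fix f :: "'n clifford \<Rightarrow> 'n clifford"
  assume f: "f \<in> SH_L (dsector \<theta>)"
    and "(\<exists>r>0. \<exists>f0. \<forall>J\<in>imag_sphere. \<forall>\<phi>\<in>angles \<theta>.
        (\<integral>\<^sup>+t\<in>{0<..<r}. ennreal (norm (f (t *\<^sub>R expi J \<phi>) - f0) / t) \<partial>lborel) < \<infinity>) \<and>
      (\<exists>(k::nat) C. C \<ge> 0 \<and> (\<forall>s\<in>dsector \<theta>. norm (f s) \<le> C * (1 + norm s ^ k)))"
  then obtain r f0 k C where r: "r > 0"
    and int: "\<And>J \<phi>. J \<in> imag_sphere \<Longrightarrow> \<phi> \<in> angles \<theta> \<Longrightarrow>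
        (\<integral>\<^sup>+t\<in>{0<..<r}. ennreal (norm (f (t *\<^sub>R expi J \<phi>) - f0) / t) \<partial>lborel) < \<infinity>"
    and C: "C \<ge> 0" "\<And>s. s \<in> dsector \<theta> \<Longrightarrow> norm (f s) \<le> C * (1 + norm s ^ k)"
    by blast
  show "f \<in> SH_Lreg \<omega> \<theta> T"
    by (rule SH_Lreg_regular_at_zero[OF assms(1,4,2,5,6) f r int C])
next
  fix f :: "'n clifford \<Rightarrow> 'n clifford"
  assume inj: "inj_on T (dom T)" and f: "f \<in> SH_L (dsector \<theta>)"
    and "\<exists>(k::nat) C. C \<ge> 0 \<and> (\<forall>s\<in>dsector \<theta>. norm (f s) \<le> C * (1 / norm s ^ k + norm s ^ k))"
  then obtain k C where C: "C \<ge> 0" "\<And>s. s \<in> dsector \<theta> \<Longrightarrow> norm (f s) \<le> C * (1 / norm s ^ k + norm s ^ k)"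
    by blast
  show "f \<in> SH_Lreg \<omega> \<theta> T"
    by (rule SH_Lreg_injective[OF assms(1,4,2,5,6) inj f C])
qed

end
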